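(* Let $p_0,p_1,q_0,q_1\in(0,\infty]$ and $s_0,s_1\in\mathbb{R}$. Consider the (possible) embedding $\mathscr{B}^{s_0}_{p_0q_0}(\mathbb{R}^n)\hookrightarrow\mathscr{B}^{s_1}_{p_1q_1}(\mathbb{R}^n)$. Then: (i) there is no embedding if and only if one of the following holds: $p_0>p_1$; or $s_0-s_1<\frac n{p_0}-\frac n{p_1}$; or $s_0-s_1=\frac n{p_0}-\frac n{p_1}\ge0$ and $q_0>q_1$. (ii) The embedding is non-compact but finitely strictly singular if and only if either $s_0-s_1=\frac n{p_0}-\frac n{p_1}>0$ and $q_0<q_1$; or $s_0-s_1>\frac n{p_0}-\frac n{p_1}>0$. (iii) The embedding is not strictly singular if and only if one of the following holds: $s_0-s_1>0$ and $p_0=p_1$; or $s_0=s_1$, $p_0=p_1$ and $q_0\le q_1$; or $s_0-s_1=\frac n{p_0}-\frac n{p_1}>0$ and $q_0=q_1$.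
   Context: Besov spaces on $\mathbb{R}^n$: fix $\varphi_0\in\mathscr{S}(\mathbb{R}^n)$ with $\operatorname{supp}\widehat{\varphi}_0\subset B(0,2)$, $\widehat\varphi_0\equiv1$ on $\overline{B(0,1)}$, and for $j\ge1$ let $\widehat{\varphi}_j(\xi)=\widehat{\varphi}_0(2^{-j}\xi)-\widehat{\varphi}_0(2^{1-j}\xi)$. For $s\in\mathbb{R}$, $p,q\in(0,\infty]$, $\mathscr{B}^s_{pq}(\mathbb{R}^n)$ is the space of tempered distributions $f$ with $\|f\|=\big(\sum_{j\ge0}\|2^{js}\varphi_j*f\|_{L^p}^q\big)^{1/q}<\infty$ (supremum if $q=\infty$). For a bounded linear map $T:X\to Y$ between quasi-Banach spaces, the $n$th Bernstein number is $b_n(T)=\sup\{\inf_{x\in X_n,\|x\|_X=1}\|Tx\|_Y: X_n\subseteq X,\ \dim X_n=n\}$. $T$ is finitely strictly singular if $b_n(T)\to0$; $T$ is strictly singular if there is no infinite-dimensional subspace $Z\subseteq X$ such that $T|_Z$ is an isomorphism onto $T(Z)$. *)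

theory Defs
  imports "HOL-Analysis.Analysis" "HOL-Probability.Essential_Supremum"
begin

text \<open>Ambient space: real^'n with n = CARD('n). Tempered distributions are
  represented as complex functionals on functions real^'n => complex that are
  continuous linear on the Schwartz space and vanish outside it (canonical
  representative).\<close>

type_synonym 'n distr = "(real^'n \<Rightarrow> complex) \<Rightarrow> complex"

definition pd :: "'n::finite \<Rightarrow> (real^'n \<Rightarrow> complex) \<Rightarrow> real^'n \<Rightarrow> complex" where
  "pd i f x = vector_derivative (\<lambda>t. f (x + t *\<^sub>R axis i 1)) (at 0)"

fun pdl :: "'n::finite list \<Rightarrow> (real^'n \<Rightarrow> complex) \<Rightarrow> real^'n \<Rightarrow> complex" where
  "pdl [] f = f"
| "pdl (i # is) f = pd i (pdl is f)"

definition schwartz :: "(real^'n::finite \<Rightarrow> complex) set" where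
  "schwartz = {f. (\<forall>\<alpha> x. pdl \<alpha> f differentiable (at x)) \<and>
      (\<forall>\<alpha> (m::nat). bounded (range (\<lambda>x. (1 + norm x) ^ m * norm (pdl \<alpha> f x))))}"

definition sw_sn :: "nat \<Rightarrow> 'n::finite list \<Rightarrow> (real^'n \<Rightarrow> complex) \<Rightarrow> real" where
  "sw_sn m \<alpha> f = (SUP x. (1 + norm x) ^ m * norm (pdl \<alpha> f x))"

definition tempered :: "'n::finite distr set" where
  "tempered = {T. (\<forall>f. f \<notin> schwartz \<longrightarrow> T f = 0) \<and>
      (\<forall>f\<in>schwartz. \<forall>g\<in>schwartz. T (\<lambda>x. f x + g x) = T f + T g) \<and>
      (\<forall>c. \<forall>f\<in>schwartz. T (\<lambda>x. c * f x) = c * T f) \<and>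
      (\<exists>C N. \<forall>f\<in>schwartz. norm (T f) \<le> C * (\<Sum>\<alpha>\<in>{\<alpha>::'n list. length \<alpha> \<le> N}. sw_sn N \<alpha> f))}"

definition fourier :: "(real^'n::finite \<Rightarrow> complex) \<Rightarrow> real^'n \<Rightarrow> complex" where
  "fourier f \<xi> = (LINT x|lborel. f x * cis (- 2 * pi * (x \<bullet> \<xi>)))"

definition conv :: "(real^'n::finite \<Rightarrow> complex) \<Rightarrow> 'n distr \<Rightarrow> real^'n \<Rightarrow> complex" where
  "conv \<phi> T x = T (\<lambda>y. \<phi> (x - y))"

definition enn_powr :: "ennreal \<Rightarrow> real \<Rightarrow> ennreal" where
  "enn_powr a r = (if a = top then top else ennreal (enn2real a powr r))"

definition Lp_en :: "ennreal \<Rightarrow> (real^'n::finite \<Rightarrow> complex) \<Rightarrow> ennreal" where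
  "Lp_en p g = (if p = top then esssup lborel (\<lambda>x. ennreal (norm (g x)))
     else enn_powr (\<integral>\<^sup>+x. ennreal (norm (g x) powr enn2real p) \<partial>lborel) (1 / enn2real p))"

definition admissible :: "(nat \<Rightarrow> real^'n::finite \<Rightarrow> complex) \<Rightarrow> bool" where
  "admissible \<phi> \<longleftrightarrow> \<phi> 0 \<in> schwartz \<and>
     closure {\<xi>. fourier (\<phi> 0) \<xi> \<noteq> 0} \<subseteq> ball 0 2 \<and>
     (\<forall>\<xi>\<in>cball 0 1. fourier (\<phi> 0) \<xi> = 1) \<and>
     (\<forall>j\<ge>1. \<phi> j \<in> schwartz \<and> (\<forall>\<xi>. fourier (\<phi> j) \<xi> =
        fourier (\<phi> 0) ((2 powr - real j) *\<^sub>R \<xi>) - fourier (\<phi> 0) ((2 powr (1 - real j)) *\<^sub>R \<xi>)))"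

definition besov_norm :: "(nat \<Rightarrow> real^'n::finite \<Rightarrow> complex) \<Rightarrow> real \<Rightarrow> ennreal \<Rightarrow> ennreal \<Rightarrow> 'n distr \<Rightarrow> ennreal" where
  "besov_norm \<phi> s p q T =
    (let a = (\<lambda>j. ennreal (2 powr (real j * s)) * Lp_en p (conv (\<phi> j) T)) in
     if q = top then (SUP j. a j)
     else enn_powr (\<Sum>j. enn_powr (a j) (enn2real q)) (1 / enn2real q))"

definition besov :: "(nat \<Rightarrow> real^'n::finite \<Rightarrow> complex) \<Rightarrow> real \<Rightarrow> ennreal \<Rightarrow> ennreal \<Rightarrow> 'n distr set" where
  "besov \<phi> s p q = {T \<in> tempered. besov_norm \<phi> s p q T < top}"

definition inv_en :: "ennreal \<Rightarrow> real" where
  "inv_en p = (if p = top then 0 else 1 / enn2real p)"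

definition lincomb :: "nat \<Rightarrow> (nat \<Rightarrow> complex) \<Rightarrow> (nat \<Rightarrow> 'n distr) \<Rightarrow> 'n distr" where
  "lincomb k c e = (\<lambda>f. \<Sum>i<k. c i * e i f)"

definition lin_indep :: "nat \<Rightarrow> (nat \<Rightarrow> 'n distr) \<Rightarrow> bool" where
  "lin_indep k e \<longleftrightarrow> (\<forall>c. lincomb k c e = (\<lambda>f. 0) \<longrightarrow> (\<forall>i<k. c i = 0))"

definition embeds :: "'n distr set \<Rightarrow> ('n distr \<Rightarrow> ennreal) \<Rightarrow> 'n distr set \<Rightarrow> ('n distr \<Rightarrow> ennreal) \<Rightarrow> bool" where
  "embeds X nX Y nY \<longleftrightarrow> X \<subseteq> Y \<and> (\<exists>C::real. \<forall>f\<in>X. nY f \<le> ennreal C * nX f)"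

definition compact_emb :: "'n distr set \<Rightarrow> ('n distr \<Rightarrow> ennreal) \<Rightarrow> 'n distr set \<Rightarrow> ('n distr \<Rightarrow> ennreal) \<Rightarrow> bool" where
  "compact_emb X nX Y nY \<longleftrightarrow>
    (\<forall>u::nat \<Rightarrow> 'n distr. (\<forall>k. u k \<in> X) \<and> (\<exists>B::real. \<forall>k. nX (u k) \<le> ennreal B) \<longrightarrow>
      (\<exists>(r::nat\<Rightarrow>nat) g. strict_mono r \<and> g \<in> Y \<and> ((\<lambda>k. nY (\<lambda>f. u (r k) f - g f)) \<longlonglongrightarrow> 0)))"

text \<open>k-th Bernstein number of the inclusion X -> Y; a k-dimensional subspace is
  the span of k linearly independent elements.\<close>
definition bernstein :: "'n distr set \<Rightarrow> ('n distr \<Rightarrow> ennreal) \<Rightarrow> ('n distr \<Rightarrow> ennreal) \<Rightarrow> nat \<Rightarrow> ennreal" where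
  "bernstein X nX nY k = (SUP e \<in> {e. (\<forall>i<k. e i \<in> X) \<and> lin_indep k e}.
      INF c \<in> {c. nX (lincomb k c e) = 1}. nY (lincomb k c e))"

definition fin_strictly_singular :: "'n distr set \<Rightarrow> ('n distr \<Rightarrow> ennreal) \<Rightarrow> ('n distr \<Rightarrow> ennreal) \<Rightarrow> bool" where
  "fin_strictly_singular X nX nY \<longleftrightarrow> (bernstein X nX nY \<longlonglongrightarrow> 0)"

definition strictly_singular :: "'n distr set \<Rightarrow> ('n distr \<Rightarrow> ennreal) \<Rightarrow> ('n distr \<Rightarrow> ennreal) \<Rightarrow> bool" where
  "strictly_singular X nX nY \<longleftrightarrow> \<not> (\<exists>Z. Z \<subseteq> X \<and> (\<lambda>f. 0) \<in> Z \<and>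
      (\<forall>x\<in>Z. \<forall>y\<in>Z. (\<lambda>f. x f + y f) \<in> Z) \<and> (\<forall>c. \<forall>x\<in>Z. (\<lambda>f. c * x f) \<in> Z) \<and>
      (\<forall>k. \<exists>e. (\<forall>i<k. e i \<in> Z) \<and> lin_indep k e) \<and>
      (\<exists>C::real. \<forall>x\<in>Z. nX x \<le> ennreal C * nY x))"

end

theory Submission
  imports Defs "HOL-Probability.Characteristic_Functions" "HOL-Probability.Sinc_Integral"
begin

text \<open>
  Write \<open>f\<^sub>j = \<phi>\<^sub>j * f\<close>. Since \<open>f\<^sub>j\<close> reproduces under convolution with a dilate of \<open>\<phi>\<^sub>0\<close>, it satisfies
  Nikolskii's inequality (also for \<open>p < 1\<close>), which together with the nesting of the sequence spaces gives
  the embedding. All negative results come from wave packets: modulated dilates of \<open>\<phi>\<^sub>0\<close> whose Fourier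
  transform lies where a single multiplier equals 1. One packet at varying frequency or width, or sums
  of critically normalised packets over many frequencies, disprove the embedding; translates of a
  packet disprove compactness and, for equal \<open>p\<close>, strict singularity; packets at all frequencies span a
  copy of \<open>l\<^sub>q\<close> on which the critical norms are equivalent when \<open>q\<^sub>0 = q\<^sub>1\<close>.

  Finite strict singularity rests on the weighted supremum \<open>M f = sup 2^(j (s\<^sub>0 - n/p\<^sub>0)) |f\<^sub>j (x)|\<close>. A
  \<open>k\<close>-dimensional space contains an \<open>f\<close> for which \<open>M f\<close> is nearly attained at \<open>k\<close> points of the lattices
  of mesh \<open>h 2^(-j)\<close>. As \<open>f\<^sub>j\<close> varies slowly on this scale, the source norm of \<open>f\<close> is at least a positive
  power of \<open>k\<close> times \<open>M f\<close>, while interpolation bounds the target norm by the source norm to a power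
  smaller than 1 times a power of \<open>M f\<close>. Above the critical line one first embeds into a critical space
  with a smaller second index.
\<close>

section \<open>Lebesgue norms with values in the extended nonnegative reals\<close>

text \<open>On the critical line \<open>s - n/p\<close> is the same for source and target, so one
  weighted supremum M is bounded by the source norm and has the right scaling for the target. A
  supremum suits the extremal argument that produces k equal peaks; sampling on lattices makes it
  discrete, and since p0 < p1 and q0 < q1 force p0 and q0 to be finite, only finitely many samples
  of a given function exceed a given height. The same volume count that proves this bounds the
  source norm B below by a multiple of k^\<kappa>, where \<kappa> is the smaller of 1/p0 and 1/q0.
  Each strict inequality is spent on one interpolation, in x at fixed frequency and then across
  frequencies: with M at most 2 the target norm is at most a constant times B^(1 - \<gamma>), where
  \<gamma> = (1 - \<theta>) (1 - \<theta>'), \<theta> = p0/p1 and \<theta>' = q0/q1. If either pair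
  of exponents coincides then \<gamma> = 0, and indeed translates or copies of l_q then obstruct.
  Exponents below 1 exclude duality and Minkowski's inequality; pointwise suprema and quasi-triangle
  inequalities take their place.\<close>

lemma enn_powr_ennreal: "0 \<le> x \<Longrightarrow> enn_powr (ennreal x) r = ennreal (x powr r)"
  by (simp add: enn_powr_def)

lemma enn_powr_top [simp]: "enn_powr top r = top"
  by (simp add: enn_powr_def)

lemma enn_powr_0 [simp]: "enn_powr 0 r = 0"
  by (simp add: enn_powr_def)

lemma enn_powr_one [simp]: "enn_powr a 1 = a"
  by (cases a) (auto simp: enn_powr_ennreal)

lemma enn_powr_mono: "0 \<le> r \<Longrightarrow> a \<le> b \<Longrightarrow> enn_powr a r \<le> enn_powr b r"
  by (cases a; cases b) (auto simp: enn_powr_ennreal powr_mono2 ennreal_leI top_unique)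

lemma enn_powr_mult: "0 < r \<Longrightarrow> enn_powr (a * b) r = enn_powr a r * enn_powr b r"
  apply (cases a; cases b)
     apply (auto simp: enn_powr_ennreal ennreal_mult[symmetric] powr_mult ennreal_mult_top ennreal_top_mult)
  done

lemma enn_powr_enn_powr: "enn_powr (enn_powr a r) s = enn_powr a (r * s)"
  by (cases a) (auto simp: enn_powr_ennreal powr_powr)

lemma enn_powr_inverse_le_iff:
  assumes "0 < r" "0 \<le> L"
  shows "enn_powr a (1/r) \<le> ennreal L \<longleftrightarrow> a \<le> ennreal (L powr r)"
proof
  assume "enn_powr a (1/r) \<le> ennreal L"
  from enn_powr_mono[OF _ this, of r] assms show "a \<le> ennreal (L powr r)"
    by (simp add: enn_powr_enn_powr enn_powr_ennreal)
next
  assume "a \<le> ennreal (L powr r)"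
  from enn_powr_mono[OF _ this, of "1/r"] assms show "enn_powr a (1/r) \<le> ennreal L"
    by (simp add: enn_powr_ennreal powr_powr)
qed

text \<open>The sum is at most twice the larger term. This crude bound treats exponents below and
  above 1 alike.\<close>

lemma enn_powr_add_le:
  assumes "0 < r"
  shows "enn_powr (a + b) r \<le> ennreal (2 powr r) * (enn_powr a r + enn_powr b r)"
proof -
  have *: "enn_powr (a + b) r \<le> ennreal (2 powr r) * (enn_powr a r + enn_powr b r)" if "a \<le> b" for a b
  proof -
    have "a + b \<le> ennreal 2 * b"
      using that by (simp add: mult_2 add_right_mono)
    then have "enn_powr (a + b) r \<le> enn_powr (ennreal 2 * b) r"
      using assms by (intro enn_powr_mono) auto
    also have "\<dots> = ennreal (2 powr r) * enn_powr b r"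
      using assms by (simp only: enn_powr_mult) (simp add: enn_powr_ennreal del: ennreal_numeral)
    also have "\<dots> \<le> ennreal (2 powr r) * (enn_powr a r + enn_powr b r)"
      by (intro mult_left_mono) auto
    finally show ?thesis .
  qed
  show ?thesis
    using *[of a b] *[of b a] by (cases "a \<le> b") (auto simp: add.commute)
qed

lemma measurable_enn_powr [measurable (raw)]:
  "u \<in> borel_measurable M \<Longrightarrow> (\<lambda>x. enn_powr (u x) r) \<in> borel_measurable M"
proof -
  assume [measurable]: "u \<in> borel_measurable M"
  have [measurable]: "(\<lambda>x. enn2real (u x)) \<in> borel_measurable M" by simp
  have "(\<lambda>x. ennreal (enn2real (u x) powr r)) \<in> borel_measurable M" by simp
  moreover have "{x \<in> space M. u x = top} \<in> sets M" by measurable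
  ultimately show ?thesis unfolding enn_powr_def by (intro measurable_If) auto
qed

text \<open>An infinite \<open>a\<close> makes the right-hand side infinite. For a finite value l
  the hypothesis is applied at \<open>l + e / C\<close>, which is positive even if l = 0 and costs
  only an extra \<open>e\<close>. Quasi-norm inequalities are thereby reduced to positive real
  bounds.\<close>

lemma ennreal_le_by_bounds:
  assumes "C > 0" "\<And>L. L > 0 \<Longrightarrow> a \<le> ennreal L \<Longrightarrow> b \<le> ennreal (C * L)"
  shows "b \<le> ennreal C * a"
proof (cases a)
  case (real l)
  have "b \<le> ennreal (C * l) + ennreal e" if "e > 0" for e
  proof -
    have "b \<le> ennreal (C * (l + e / C))"
      using that assms(1) real by (intro assms(2)) (auto intro!: ennreal_leI add_nonneg_pos)
    also have "C * (l + e / C) = C * l + e"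
      using assms(1) by (simp add: field_simps)
    finally show ?thesis using that real assms(1) by simp
  qed
  then have "b \<le> ennreal (C * l)"
    by (rule ennreal_le_epsilon) auto
  then show ?thesis using real assms(1) by (simp add: ennreal_mult)
qed (use assms in \<open>simp add: ennreal_mult_top\<close>)

text \<open>\<open>Lp_en\<close> is the case of Lebesgue measure and the sum over frequencies in
  \<open>besov_norm\<close> the case of counting measure, so interpolation and homogeneity are
  proved once for both layers of the Besov norm.\<close>

definition Lnorm :: "'a measure \<Rightarrow> ennreal \<Rightarrow> ('a \<Rightarrow> ennreal) \<Rightarrow> ennreal" where
  "Lnorm M p u = (if p = top then esssup M u
     else enn_powr (\<integral>\<^sup>+x. enn_powr (u x) (enn2real p) \<partial>M) (1 / enn2real p))"

lemma Lp_en_eq_Lnorm: "Lp_en p g = Lnorm lborel p (\<lambda>x. ennreal (norm (g x)))"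
  by (simp add: Lp_en_def Lnorm_def enn_powr_ennreal)

lemma esssup_count_space:
  fixes a :: "'a \<Rightarrow> ennreal"
  shows "esssup (count_space UNIV) a = (SUP j. a j)"
proof (rule antisym)
  show "esssup (count_space UNIV) a \<le> (SUP j. a j)"
    by (rule esssup_I) (auto intro: SUP_upper)
  show "(SUP j. a j) \<le> esssup (count_space UNIV) a"
    using esssup_AE[of a "count_space UNIV"] by (intro SUP_least) (simp add: AE_count_space)
qed

abbreviation lnorm :: "ennreal \<Rightarrow> (nat \<Rightarrow> ennreal) \<Rightarrow> ennreal" where
  "lnorm \<equiv> Lnorm (count_space UNIV)"

lemma besov_norm_eq_lnorm:
  "besov_norm \<phi> s p q T = lnorm q (\<lambda>j. ennreal (2 powr (real j * s)) * Lp_en p (conv (\<phi> j) T))"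
  by (simp add: besov_norm_def Lnorm_def Let_def esssup_count_space nn_integral_count_space_nat)

lemma enn2real_pos: "0 < p \<Longrightarrow> p \<noteq> top \<Longrightarrow> 0 < enn2real p"
  by (cases p) (auto simp: enn2real_positive_iff)

lemma inv_en_nonneg [simp]: "0 \<le> inv_en p"
  by (simp add: inv_en_def)

lemma inv_en_le_iff:
  assumes "0 < p" "0 < q" shows "inv_en q \<le> inv_en p \<longleftrightarrow> p \<le> q"
proof (cases "p = top \<or> q = top")
  case True
  then show ?thesis using assms enn2real_pos[of p] enn2real_pos[of q]
    by (auto simp: inv_en_def top_unique divide_le_0_iff)
next
  case False
  then obtain a b where ab: "p = ennreal a" "q = ennreal b" "a > 0" "b > 0"
    using assms by (cases p; cases q) auto
  have "1 / b \<le> 1 / a \<longleftrightarrow> a \<le> b" using ab by (simp add: divide_simps)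
  then show ?thesis using ab by (simp add: inv_en_def)
qed

lemma Lnorm_mono:
  assumes "u \<in> borel_measurable M" "\<And>x. u x \<le> v x" "0 < p"
  shows "Lnorm M p u \<le> Lnorm M p v"
  using assms by (auto simp: Lnorm_def esssup_mono intro!: enn_powr_mono nn_integral_mono)

lemma Lnorm_le_iff:
  assumes "0 < p" "p \<noteq> top" "0 \<le> L"
  shows "Lnorm M p u \<le> ennreal L \<longleftrightarrow> (\<integral>\<^sup>+x. enn_powr (u x) (enn2real p) \<partial>M) \<le> ennreal (L powr enn2real p)"
  using assms enn_powr_inverse_le_iff[of "enn2real p" L] enn2real_pos[of p] by (simp add: Lnorm_def)

lemma Lnorm_top_le:
  "u \<in> borel_measurable M \<Longrightarrow> (\<And>x. u x \<le> c) \<Longrightarrow> Lnorm M top u \<le> c"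
  by (auto simp: Lnorm_def)

lemma Lnorm_zero [simp]: "0 < p \<Longrightarrow> Lnorm M p (\<lambda>x. 0) = 0"
proof (cases "p = top")
  case True
  have "esssup M (\<lambda>x. 0::ennreal) \<le> 0" by (rule esssup_I) auto
  then show ?thesis using True by (simp add: Lnorm_def)
qed (auto simp: Lnorm_def)

lemma Lnorm_cmult:
  assumes [measurable]: "u \<in> borel_measurable M" and "0 < p" "0 \<le> c"
  shows "Lnorm M p (\<lambda>x. ennreal c * u x) = ennreal c * Lnorm M p u"
proof (cases "c = 0")
  case True
  then show ?thesis using assms by simp
next
  case False
  then have c: "c > 0" using assms by simp
  show ?thesis
  proof (cases "p = top")
    case True
    have *: "esssup M (\<lambda>x. ennreal c * u x) \<le> ennreal c * esssup M u"
      if [measurable]: "u \<in> borel_measurable M" for c u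
    proof (rule esssup_I)
      show "AE x in M. ennreal c * u x \<le> ennreal c * esssup M u"
        using esssup_AE[of u M] by eventually_elim (auto intro: mult_left_mono)
    qed auto
    have i: "ennreal (1/c) * (ennreal c * w) = w" for w
      using c by (simp add: mult.assoc[symmetric] ennreal_mult[symmetric])
    have "esssup M u \<le> ennreal (1/c) * esssup M (\<lambda>x. ennreal c * u x)"
      using *[of "\<lambda>x. ennreal c * u x" "1/c"] by (simp add: i)
    then have "ennreal c * esssup M u \<le> ennreal c * (ennreal (1/c) * esssup M (\<lambda>x. ennreal c * u x))"
      by (intro mult_left_mono) auto
    also have "\<dots> = esssup M (\<lambda>x. ennreal c * u x)"
      using c by (simp add: mult.assoc[symmetric] ennreal_mult[symmetric])
    finally show ?thesis using * True by (auto simp: Lnorm_def intro: antisym)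
  next
    case False
    then have r: "enn2real p > 0" using enn2real_pos assms by auto
    have "ennreal c = enn_powr (enn_powr (ennreal c) (enn2real p)) (1/enn2real p)"
      using r by (simp add: enn_powr_enn_powr)
    then show ?thesis
      using r False by (simp add: Lnorm_def enn_powr_mult nn_integral_cmult)
  qed
qed

text \<open>\<open>enn_powr_add_le\<close> is used twice, with exponent r under the integral and
  with 1/r outside; taking the root of the first factor leaves 2. The constant depends on p alone,
  hence is uniform over the frequencies.\<close>

lemma Lnorm_add_le:
  assumes p: "0 < p"
  obtains C where "C > 0" and "\<And>(M::'a measure) u v. u \<in> borel_measurable M \<Longrightarrow> v \<in> borel_measurable M \<Longrightarrow>
     Lnorm M p (\<lambda>x. u x + v x) \<le> ennreal C * (Lnorm M p u + Lnorm M p v)"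
proof (cases "p = top")
  case True
  show ?thesis
  proof (rule that[of 1])
    fix M :: "'a measure" and u v :: "'a \<Rightarrow> ennreal"
    assume [measurable]: "u \<in> borel_measurable M" "v \<in> borel_measurable M"
    have "esssup M (\<lambda>x. u x + v x) \<le> esssup M u + esssup M v"
    proof (rule esssup_I)
      show "AE x in M. u x + v x \<le> esssup M u + esssup M v"
        using esssup_AE[of u M] esssup_AE[of v M] by eventually_elim (auto intro: add_mono)
    qed auto
    then show "Lnorm M p (\<lambda>x. u x + v x) \<le> ennreal 1 * (Lnorm M p u + Lnorm M p v)"
      using True by (simp add: Lnorm_def)
  qed auto
next
  case False
  define r where "r = enn2real p"
  have r: "r > 0" using enn2real_pos False p r_def by auto
  show ?thesis
  proof (rule that[of "2 * 2 powr (1/r)"])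
    fix M :: "'a measure" and u v :: "'a \<Rightarrow> ennreal"
    assume [measurable]: "u \<in> borel_measurable M" "v \<in> borel_measurable M"
    let ?I = "\<lambda>w. \<integral>\<^sup>+x. enn_powr (w x) r \<partial>M"
    have "?I (\<lambda>x. u x + v x) \<le> (\<integral>\<^sup>+x. ennreal (2 powr r) * (enn_powr (u x) r + enn_powr (v x) r) \<partial>M)"
      using r by (intro nn_integral_mono enn_powr_add_le)
    also have "\<dots> = ennreal (2 powr r) * (?I u + ?I v)"
      by (simp add: nn_integral_cmult nn_integral_add)
    finally have "enn_powr (?I (\<lambda>x. u x + v x)) (1/r) \<le> enn_powr (ennreal (2 powr r) * (?I u + ?I v)) (1/r)"
      using r by (intro enn_powr_mono) auto
    also have "\<dots> = ennreal 2 * enn_powr (?I u + ?I v) (1/r)"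
      using r by (simp add: enn_powr_mult enn_powr_ennreal powr_powr)
    also have "\<dots> \<le> ennreal 2 * (ennreal (2 powr (1/r)) * (enn_powr (?I u) (1/r) + enn_powr (?I v) (1/r)))"
      using r by (intro mult_left_mono enn_powr_add_le) auto
    finally show "Lnorm M p (\<lambda>x. u x + v x) \<le> ennreal (2 * 2 powr (1/r)) * (Lnorm M p u + Lnorm M p v)"
      using False by (simp add: Lnorm_def r_def ennreal_mult mult.assoc)
  qed auto
qed

text \<open>Split \<open>u powr b = u powr (b - a) * u powr a\<close> and bound the first factor by
  the supremum. The ratio \<open>\<theta>\<close> is a / b, and 0 for infinite \<open>p1\<close>,
  where only the supremum remains.\<close>

lemma Lnorm_interp:
  assumes [measurable]: "u \<in> borel_measurable M" and p: "0 < p0" "p0 \<le> p1" "p0 \<noteq> top"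
    and ub: "\<And>x. u x \<le> ennreal e" "e > 0" and L: "L > 0" "Lnorm M p0 u \<le> ennreal L"
  defines "\<theta> \<equiv> inv_en p1 / inv_en p0"
  shows "Lnorm M p1 u \<le> ennreal (L powr \<theta> * e powr (1 - \<theta>))"
proof (cases "p1 = top")
  case True
  then show ?thesis using Lnorm_top_le[OF assms(1) ub(1)] L ub by (simp add: \<theta>_def inv_en_def)
next
  case False
  obtain a b where ab: "p0 = ennreal a" "p1 = ennreal b" "a > 0" "b > 0" "a \<le> b"
    using p False by (cases p0; cases p1) auto
  have th: "\<theta> = a / b" using ab by (simp add: \<theta>_def inv_en_def)
  have pw: "enn_powr (u x) b \<le> ennreal (e powr (b - a)) * enn_powr (u x) a" for x
  proof -
    obtain t where t: "u x = ennreal t" "t \<ge> 0" "t \<le> e"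
      using ub(1)[of x] ub(2) by (cases "u x") (auto simp: top_unique)
    have "t powr b = t powr (b - a) * t powr a"
      by (metis add.commute diff_add_cancel powr_add)
    also have "\<dots> \<le> e powr (b - a) * t powr a"
      using t ab by (intro mult_right_mono powr_mono2) auto
    finally show ?thesis
      using t by (simp add: enn_powr_ennreal ennreal_mult[symmetric] ennreal_leI)
  qed
  have "(\<integral>\<^sup>+x. enn_powr (u x) b \<partial>M) \<le> (\<integral>\<^sup>+x. ennreal (e powr (b - a)) * enn_powr (u x) a \<partial>M)"
    by (intro nn_integral_mono pw)
  also have "\<dots> = ennreal (e powr (b - a)) * (\<integral>\<^sup>+x. enn_powr (u x) a \<partial>M)"
    by (simp add: nn_integral_cmult)
  also have "\<dots> \<le> ennreal (e powr (b - a)) * ennreal (L powr a)"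
    using L Lnorm_le_iff[of p0 L M u] p ab by (intro mult_left_mono) auto
  also have "\<dots> = ennreal (e powr (b - a) * L powr a)" by (simp add: ennreal_mult)
  also have "e powr (b - a) * L powr a = (L powr \<theta> * e powr (1 - \<theta>)) powr b"
    using ab ub L by (simp add: th powr_mult powr_powr left_diff_distrib)
  finally show ?thesis
    using False ab ub L by (subst Lnorm_le_iff) auto
qed

text \<open>Interpolation with \<open>e = L\<close>, where the two powers of L recombine. For
  sequences the pointwise bound comes for free from the norm itself, which gives the nesting of the
  spaces l_q.\<close>

lemma Lnorm_mono_exponent:
  assumes [measurable]: "u \<in> borel_measurable M" and p: "0 < p0" "p0 \<le> p1"
    and "\<And>x. u x \<le> ennreal L" "L > 0" "Lnorm M p0 u \<le> ennreal L"
  shows "Lnorm M p1 u \<le> ennreal L"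
proof (cases "p0 = top")
  case True then show ?thesis using assms by (simp add: top_unique)
next
  case False
  show ?thesis
    using Lnorm_interp[OF assms(1) p False assms(4,5,5,6)] assms(5) by (simp add: powr_add[symmetric])
qed

section \<open>Norms of sequences indexed by frequency\<close>

lemma lnorm_ge: "0 < q \<Longrightarrow> a j \<le> lnorm q a"
proof (cases "q = top")
  case True
  then show ?thesis by (auto simp: Lnorm_def esssup_count_space intro: SUP_upper)
next
  case False
  assume "0 < q"
  then have r: "enn2real q > 0" using False enn2real_pos by auto
  have "enn_powr (a j) (enn2real q) \<le> (\<Sum>j. enn_powr (a j) (enn2real q))"
    using sum_le_suminf[of "\<lambda>j. enn_powr (a j) (enn2real q)" "{j}"] by simp
  from enn_powr_mono[OF _ this, of "1/enn2real q"] r False show ?thesis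
    by (simp add: Lnorm_def nn_integral_count_space_nat enn_powr_enn_powr)
qed

lemma lnorm_mono_exponent:
  assumes "0 < q0" "q0 \<le> q1" "L > 0" "lnorm q0 a \<le> ennreal L"
  shows "lnorm q1 a \<le> ennreal L"
proof (rule Lnorm_mono_exponent)
  show "a j \<le> ennreal L" for j using lnorm_ge[of q0 a j] assms by (meson order_trans)
qed (use assms in auto)

lemma lnorm_indicator:
  assumes "0 < q" "D \<ge> 0" "K > 0"
  shows "lnorm q (\<lambda>j. if j < K then ennreal D else 0) = ennreal (D * real K powr inv_en q)"
proof (cases "q = top")
  case True
  have "(SUP j. if j < K then ennreal D else 0) = ennreal D"
    using assms SUP_upper[of 0 UNIV "\<lambda>j. if j < K then ennreal D else 0"]
    by (intro antisym SUP_least) auto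
  then show ?thesis using True assms by (simp add: Lnorm_def esssup_count_space inv_en_def)
next
  case False
  define r where "r = enn2real q"
  have r: "r > 0" using False assms r_def enn2real_pos by auto
  have "(\<Sum>j. enn_powr (if j < K then ennreal D else 0) r) = (\<Sum>j<K. enn_powr (if j < K then ennreal D else 0) r)"
    by (rule suminf_finite) auto
  also have "\<dots> = ennreal (real K * D powr r)"
    using assms by (simp add: enn_powr_ennreal ennreal_mult ennreal_of_nat_eq_real_of_nat)
  finally show ?thesis
    using False r assms
    by (simp add: Lnorm_def r_def[symmetric] nn_integral_count_space_nat enn_powr_ennreal inv_en_def
        powr_mult powr_powr mult.commute)
qed

lemma lnorm_single:
  assumes "0 < q" "\<And>j. j \<noteq> l \<Longrightarrow> a j = 0"
  shows "lnorm q a = a l"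
proof (cases "q = top")
  case True
  have "(SUP j. a j) = a l"
  proof (intro antisym SUP_least)
    show "a j \<le> a l" for j using assms(2)[of j] by (cases "j = l") auto
  qed (auto intro: SUP_upper)
  then show ?thesis using True by (simp add: Lnorm_def esssup_count_space)
next
  case False
  define r where "r = enn2real q"
  have r: "r > 0" using False assms r_def enn2real_pos by auto
  have "(\<Sum>j. enn_powr (a j) r) = (\<Sum>j\<in>{l}. enn_powr (a j) r)"
    using assms by (intro suminf_finite) auto
  then show ?thesis
    using False r by (simp add: Lnorm_def r_def[symmetric] nn_integral_count_space_nat enn_powr_enn_powr)
qed

text \<open>Every power of a geometric sequence is summable, so above the critical line a bound on
  the single levels suffices, whatever the second indices are.\<close>

lemma lnorm_geometric:
  assumes "0 < q" "\<delta> > 0"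
  obtains C where "C > 0" "\<And>a L. L \<ge> 0 \<Longrightarrow> (\<And>j. a j \<le> ennreal (L * 2 powr (- real j * \<delta>))) \<Longrightarrow> lnorm q a \<le> ennreal (C * L)"
proof (cases "q = top")
  case True
  show ?thesis
  proof (rule that[of 1])
    fix a :: "nat \<Rightarrow> ennreal" and L :: real
    assume L: "L \<ge> 0" and *: "\<And>j. a j \<le> ennreal (L * 2 powr (- real j * \<delta>))"
    have "a j \<le> ennreal L" for j
    proof (rule order_trans[OF *])
      have "L * 2 powr (- real j * \<delta>) \<le> L * 2 powr 0"
        using L assms by (intro mult_left_mono powr_mono) (auto)
      then show "ennreal (L * 2 powr (- real j * \<delta>)) \<le> ennreal L" by (intro ennreal_leI) auto
    qed
    then show "lnorm q a \<le> ennreal (1 * L)"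
      using True by (auto simp: Lnorm_def esssup_count_space intro: SUP_least)
  qed auto
next
  case False
  define r where "r = enn2real q"
  have r: "r > 0" using False assms r_def enn2real_pos by auto
  define x where "x = 2 powr (- \<delta> * r)"
  have x: "0 < x" "x < 1" using assms r by (auto simp: x_def powr_less_one)
  have e: "(2 powr (- real j * \<delta>)) powr r = x ^ j" for j
    by (simp add: x_def powr_powr powr_realpow[symmetric] mult_ac)
  show ?thesis
  proof (rule that[of "(1/(1-x)) powr (1/r)"])
    fix a :: "nat \<Rightarrow> ennreal" and L :: real
    assume L: "L \<ge> 0" and *: "\<And>j. a j \<le> ennreal (L * 2 powr (- real j * \<delta>))"
    have "(\<Sum>j. enn_powr (a j) r) \<le> (\<Sum>j. ennreal (L powr r * x ^ j))"
    proof (rule suminf_le)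
      fix j
      have "enn_powr (a j) r \<le> enn_powr (ennreal (L * 2 powr (- real j * \<delta>))) r"
        using * r by (intro enn_powr_mono) auto
      also have "\<dots> = ennreal (L powr r * x ^ j)"
        using L by (simp only: enn_powr_ennreal powr_mult e mult_nonneg_nonneg powr_ge_zero)
      finally show "enn_powr (a j) r \<le> ennreal (L powr r * x ^ j)" .
    qed auto
    also have "\<dots> = ennreal (L powr r * (1/(1-x)))"
      using x by (intro suminf_ennreal_eq sums_mult geometric_sums) (auto)
    also have "L powr r * (1/(1-x)) = ((1/(1-x)) powr (1/r) * L) powr r"
      using x L r by (simp add: powr_mult powr_powr)
    finally show "lnorm q a \<le> ennreal ((1/(1-x)) powr (1/r) * L)"
      using L False assms by (subst Lnorm_le_iff) (auto simp: nn_integral_count_space_nat r_def)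
  next
    show "0 < (1/(1-x)) powr (1/r)" using x by (simp only: powr_gt_zero) simp
  qed
qed

section \<open>Rapidly decreasing functions and the Fourier transform\<close>

text \<open>Lebesgue measure is the image of the product of one-dimensional ones under expansion in
  the basis. Both the weight of \<open>integrable_inverse_weight\<close> and the Gaussian are
  treated coordinatewise through it.\<close>

lemma lborel_prod_integral:
  fixes u :: "'a::euclidean_space \<Rightarrow> real \<Rightarrow> 'b::{real_normed_field,banach,second_countable_topology}"
  assumes u: "\<And>b. b \<in> Basis \<Longrightarrow> integrable lborel (u b)"
  shows "integrable lborel (\<lambda>x::'a. \<Prod>b\<in>Basis. u b (x \<bullet> b))" (is ?A)
    and "(LINT x|lborel. (\<Prod>b\<in>Basis. u b ((x::'a) \<bullet> b))) = (\<Prod>b\<in>Basis. LINT x|lborel. u b x)" (is ?B)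
proof -
  interpret product_sigma_finite "\<lambda>_::'a. lborel::real measure" by standard
  have m: "(\<lambda>x::'a. \<Prod>b\<in>Basis. u b (x \<bullet> b)) \<in> borel_measurable borel"
    using u by (auto intro!: borel_measurable_prod simp: integrable_iff_bounded
        intro: measurable_compose[where N = borel and g = "u _"])
  have e: "(\<Prod>b\<in>Basis. u b ((\<Sum>c\<in>Basis. f c *\<^sub>R c) \<bullet> b)) = (\<Prod>b\<in>Basis. u b (f b))" for f :: "'a \<Rightarrow> real"
    by (intro prod.cong refl) simp
  have t: "(\<lambda>f. \<Sum>b\<in>Basis. f b *\<^sub>R b) \<in> (\<Pi>\<^sub>M b\<in>Basis. lborel) \<rightarrow>\<^sub>M (borel :: 'a measure)"
    by simp
  show ?A
    unfolding lborel_eq[where 'a='a] integrable_distr_eq[OF t m] e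
    by (intro product_integrable_prod u finite_Basis)
  show ?B
    unfolding lborel_eq[where 'a='a] integral_distr[OF t m] e
    by (intro product_integral_prod u finite_Basis)
qed

text \<open>Every coordinate is at most the norm in absolute value, so two powers of
  \<open>1 + norm x\<close> dominate one factor \<open>1 + (x \<bullet> b)^2\<close>; one such
  factor per basis vector explains the exponent \<open>2 * DIM('a)\<close>.\<close>

lemma integrable_inverse_weight:
  "integrable lborel (\<lambda>x::'a::euclidean_space. 1 / (1 + norm x) ^ (2 * DIM('a)))"
proof (rule Bochner_Integration.integrable_bound)
  have "integrable lborel (\<lambda>x::real. inverse (1 + x\<^sup>2))"
    using integrable_inverse_1_plus_square by (simp add: set_integrable_def)
  then show "integrable lborel (\<lambda>x::'a. \<Prod>b\<in>Basis. inverse (1 + (x \<bullet> b)\<^sup>2))"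
    by (rule lborel_prod_integral)
  have "1 / (1 + norm x) ^ (2 * DIM('a)) \<le> (\<Prod>b\<in>Basis. inverse (1 + (x \<bullet> b)\<^sup>2))" for x :: 'a
  proof -
    have "(\<Prod>b\<in>(Basis::'a set). inverse ((1 + norm x)\<^sup>2)) \<le> (\<Prod>b\<in>Basis. inverse (1 + (x \<bullet> b)\<^sup>2))"
    proof (intro prod_mono conjI le_imp_inverse_le)
      fix b :: 'a assume "b \<in> Basis"
      then have "\<bar>x \<bullet> b\<bar> \<le> norm x" by (rule Basis_le_norm)
      then have "\<bar>x \<bullet> b\<bar>\<^sup>2 \<le> (norm x)\<^sup>2" by (intro power_mono) auto
      then show "1 + (x \<bullet> b)\<^sup>2 \<le> (1 + norm x)\<^sup>2"
        using norm_ge_zero[of x] by (simp add: power2_sum del: norm_ge_zero)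
    qed (auto simp: add_pos_nonneg)
    then show ?thesis by (simp add: power_mult power_inverse divide_inverse)
  qed
  then show "AE x::'a in lborel. norm (1 / (1 + norm x) ^ (2 * DIM('a))) \<le> norm (\<Prod>b\<in>Basis. inverse (1 + (x \<bullet> b)\<^sup>2))"
    by (intro AE_I2) (simp add: prod_nonneg abs_of_nonneg)
qed measurable

text \<open>Unlike for the Schwartz class, membership of the modulated test functions below requires no
  differentiability to be checked.\<close>

definition rapid :: "('a::euclidean_space \<Rightarrow> complex) \<Rightarrow> bool" where
  "rapid f \<longleftrightarrow> continuous_on UNIV f \<and> (\<forall>m::nat. \<exists>C. \<forall>x. (1 + norm x) ^ m * norm (f x) \<le> C)"

lemma rapid_continuous: "rapid f \<Longrightarrow> continuous_on UNIV f"
  by (simp add: rapid_def)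

lemma rapid_measurable [measurable]: "rapid f \<Longrightarrow> f \<in> borel_measurable borel"
  by (simp add: rapid_def borel_measurable_continuous_onI)

lemma rapid_boundE:
  fixes f :: "'a::euclidean_space \<Rightarrow> complex"
  assumes "rapid f"
  obtains C where "C > 0" "\<And>x::'a. (1 + norm x) ^ m * norm (f x) \<le> C"
    "\<And>x::'a. norm (f x) \<le> C / (1 + norm x) ^ m"
proof -
  obtain C where C: "\<And>x. (1 + norm x) ^ m * norm (f x) \<le> C"
    using assms unfolding rapid_def by blast
  have C': "(1 + norm x) ^ m * norm (f x) \<le> max C 1" for x
    using C[of x] by linarith
  show ?thesis
  proof (rule that[of "max C 1"])
    fix x :: 'a
    have "(1 + norm x) ^ m > 0" by (simp add: add_pos_nonneg)
    with C'[of x] show "norm (f x) \<le> max C 1 / (1 + norm x) ^ m"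
      by (simp add: pos_le_divide_eq mult.commute)
  qed (use C' in auto)
qed

lemma rapid_bounded:
  assumes "rapid f" obtains C where "C > 0" "\<And>x. norm (f x) \<le> C"
  using rapid_boundE[OF assms, of 0] by auto

lemma rapid_weight_integrable:
  fixes f :: "'a::euclidean_space \<Rightarrow> complex"
  assumes "rapid f"
  shows "integrable lborel (\<lambda>x. (1 + norm x) ^ m * norm (f x))"
proof -
  obtain C where C: "C > 0" "\<And>x. (1 + norm x) ^ (m + 2 * DIM('a)) * norm (f x) \<le> C"
    using rapid_boundE[OF assms] by metis
  show ?thesis
  proof (rule Bochner_Integration.integrable_bound)
    show "integrable lborel (\<lambda>x::'a. C * (1 / (1 + norm x) ^ (2 * DIM('a))))"
      by (intro integrable_mult_right integrable_inverse_weight)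
    have "(1 + norm x) ^ m * norm (f x) \<le> C / (1 + norm x) ^ (2 * DIM('a))" for x
    proof -
      have "(1 + norm x) ^ (2 * DIM('a)) > 0" by (simp add: add_pos_nonneg)
      then show ?thesis using C(2)[of x] by (simp add: pos_le_divide_eq power_add mult_ac)
    qed
    then show "AE x in lborel. norm ((1 + norm x) ^ m * norm (f x)) \<le> norm (C * (1 / (1 + norm x) ^ (2 * DIM('a))))"
      using C(1) by (intro AE_I2) (simp add: add_nonneg_nonneg)
  qed (use assms in measurable)
qed

lemma rapid_integrable:
  assumes "rapid f" shows "integrable lborel f"
  using rapid_weight_integrable[OF assms, of 0] assms
  by (simp add: integrable_norm_iff rapid_measurable)

lemma rapid_norm_integrable:
  assumes "rapid f" shows "integrable lborel (\<lambda>x. norm (f x))"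
  using rapid_integrable[OF assms] by (rule integrable_norm)

lemma rapidI:
  assumes "continuous_on UNIV f" "\<And>m. \<exists>C. \<forall>x. (1 + norm x) ^ m * norm (f x) \<le> C"
  shows "rapid f"
  using assms by (simp add: rapid_def)

lemma rapid_affine:
  assumes f: "rapid f" and a: "a \<noteq> 0"
  shows "rapid (\<lambda>x. f (a *\<^sub>R x + b))"
proof (rule rapidI)
  show "continuous_on UNIV (\<lambda>x. f (a *\<^sub>R x + b))"
    by (rule continuous_on_compose2[OF rapid_continuous[OF f]]) (auto intro!: continuous_intros)
  fix m :: nat
  obtain C where C: "C > 0" "\<And>x. (1 + norm x) ^ m * norm (f x) \<le> C" using rapid_boundE[OF f] by metis
  define c where "c = 1 + (1 + norm b) / \<bar>a\<bar>"
  have "(1 + norm x) ^ m * norm (f (a *\<^sub>R x + b)) \<le> c ^ m * C" for x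
  proof -
    let ?y = "a *\<^sub>R x + b"
    have "\<bar>a\<bar> * norm x = norm (?y - b)" by simp
    also have "\<dots> \<le> norm ?y + norm b" by (rule norm_triangle_ineq4)
    finally have "norm x \<le> (norm ?y + norm b) / \<bar>a\<bar>"
      using a by (simp add: pos_le_divide_eq mult.commute)
    also have "\<dots> \<le> ((1 + norm ?y) * (1 + norm b)) / \<bar>a\<bar>"
      using a by (intro divide_right_mono) (auto simp: algebra_simps)
    finally have "1 + norm x \<le> c * (1 + norm ?y)"
      using norm_ge_zero[of ?y] by (simp add: c_def algebra_simps add_divide_distrib del: norm_ge_zero)
    then have "(1 + norm x) ^ m \<le> c ^ m * (1 + norm ?y) ^ m"
      by (metis power_mono power_mult_distrib add_nonneg_nonneg norm_ge_zero zero_le_one)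
    then have "(1 + norm x) ^ m * norm (f ?y) \<le> c ^ m * ((1 + norm ?y) ^ m * norm (f ?y))"
      by (simp add: mult.assoc[symmetric] mult_right_mono)
    also have "\<dots> \<le> c ^ m * C" by (intro mult_left_mono C) (simp add: c_def)
    finally show ?thesis .
  qed
  then show "\<exists>C. \<forall>x. (1 + norm x) ^ m * norm (f (a *\<^sub>R x + b)) \<le> C" by blast
qed

lemma rapid_reflect: "rapid f \<Longrightarrow> rapid (\<lambda>y. f (x - y))"
  using rapid_affine[of f "-1" x] by (simp add: algebra_simps)

lemma rapid_shift: "rapid f \<Longrightarrow> rapid (\<lambda>x. f (x - y))"
  using rapid_affine[of f 1 "- y"] by simp

lemma rapid_mult_bounded:
  assumes "rapid f" "continuous_on UNIV g" "\<And>x. norm (g x) \<le> B"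
  shows "rapid (\<lambda>x. g x * f x)"
proof (rule rapidI)
  show "continuous_on UNIV (\<lambda>x. g x * f x)"
    using assms rapid_continuous by (intro continuous_on_mult) auto
  fix m :: nat
  obtain C where C: "C > 0" "\<And>x. (1 + norm x) ^ m * norm (f x) \<le> C" using rapid_boundE[OF assms(1)] by metis
  have "B \<ge> 0" using assms(3)[of 0] norm_ge_zero order_trans by blast
  then have "norm (g x) * ((1 + norm x) ^ m * norm (f x)) \<le> B * C" for x
    using C assms(3) by (intro mult_mono) auto
  then show "\<exists>C. \<forall>x. (1 + norm x) ^ m * norm (g x * f x) \<le> C"
    by (auto simp: norm_mult mult_ac intro!: exI[of _ "B * C"])
qed

lemma rapid_cmult: "rapid f \<Longrightarrow> rapid (\<lambda>x. c * f x)"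
  by (rule rapid_mult_bounded[where B="norm c"]) auto

lemma rapid_add:
  assumes "rapid f" "rapid g" shows "rapid (\<lambda>x. f x + g x)"
proof (rule rapidI)
  show "continuous_on UNIV (\<lambda>x. f x + g x)"
    using assms rapid_continuous by (intro continuous_on_add) auto
  fix m :: nat
  obtain C where C: "C > 0" "\<And>x. (1 + norm x) ^ m * norm (f x) \<le> C" using rapid_boundE[OF assms(1)] by metis
  obtain D where D: "D > 0" "\<And>x. (1 + norm x) ^ m * norm (g x) \<le> D" using rapid_boundE[OF assms(2)] by metis
  have "(1 + norm x) ^ m * norm (f x + g x) \<le> C + D" for x
  proof -
    have "(1 + norm x) ^ m * norm (f x + g x) \<le> (1 + norm x) ^ m * (norm (f x) + norm (g x))"
      by (intro mult_left_mono norm_triangle_ineq) auto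
    then show ?thesis using C(2)[of x] D(2)[of x] by (simp add: distrib_left)
  qed
  then show "\<exists>C. \<forall>x. (1 + norm x) ^ m * norm (f x + g x) \<le> C" by blast
qed

lemma rapid_diff: "rapid f \<Longrightarrow> rapid g \<Longrightarrow> rapid (\<lambda>x. f x - g x)"
  using rapid_add[of f "\<lambda>x. - 1 * g x"] rapid_cmult[of g "-1"] by simp

lemma rapid_zero: "rapid (\<lambda>x. 0)"
  by (auto simp: rapid_def)

lemma rapid_sum: "(\<And>i. i \<in> I \<Longrightarrow> rapid (f i)) \<Longrightarrow> rapid (\<lambda>x. \<Sum>i\<in>I. f i x)"
  by (induction I rule: infinite_finite_induct) (auto intro: rapid_add rapid_zero)

section \<open>Affine changes of variables and convolution\<close>

lemma lborel_integral_affine: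
  fixes f :: "'a::euclidean_space \<Rightarrow> 'b::{banach,second_countable_topology}"
  assumes f[measurable]: "f \<in> borel_measurable borel" and a: "a \<noteq> 0"
  shows "(LINT x|lborel. f (a *\<^sub>R x + t)) = (1 / \<bar>a\<bar> ^ DIM('a)) *\<^sub>R (LINT x|lborel. f x)"
proof -
  have "(LINT x|lborel. f x) = (LINT x|density (distr lborel borel (\<lambda>x. t + a *\<^sub>R x)) (\<lambda>_. \<bar>a\<bar>^DIM('a)). f x)"
    using lborel_affine[OF a, of t] by simp
  also have "\<dots> = \<bar>a\<bar>^DIM('a) *\<^sub>R (LINT x|lborel. f (t + a *\<^sub>R x))"
    by (subst integral_density) (auto simp: integral_distr)
  finally show ?thesis using a by (simp add: add.commute)
qed

lemma lborel_nn_integral_affine: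
  fixes f :: "'a::euclidean_space \<Rightarrow> ennreal"
  assumes f[measurable]: "f \<in> borel_measurable borel" and a: "a \<noteq> 0"
  shows "(\<integral>\<^sup>+x. f (a *\<^sub>R x + t) \<partial>lborel) = ennreal (1 / \<bar>a\<bar> ^ DIM('a)) * (\<integral>\<^sup>+x. f x \<partial>lborel)"
proof -
  have "(\<integral>\<^sup>+x. f x \<partial>lborel) = (\<integral>\<^sup>+x. f x \<partial>density (distr lborel borel (\<lambda>x. t + a *\<^sub>R x)) (\<lambda>_. \<bar>a\<bar>^DIM('a)))"
    using lborel_affine[OF a, of t] by simp
  also have "\<dots> = ennreal (\<bar>a\<bar>^DIM('a)) * (\<integral>\<^sup>+x. f (t + a *\<^sub>R x) \<partial>lborel)"
    by (subst nn_integral_density) (auto simp: nn_integral_distr nn_integral_cmult)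
  finally show ?thesis using a by (simp add: add.commute mult.assoc[symmetric] ennreal_mult[symmetric])
qed

lemma integrable_pair_prod:
  fixes f g :: "'a::euclidean_space \<Rightarrow> complex"
  assumes f: "integrable lborel f" and g: "integrable lborel g"
  shows "integrable (lborel \<Otimes>\<^sub>M lborel) (\<lambda>(x, y). f x * g y)"
proof -
  have [measurable]: "f \<in> borel_measurable borel" "g \<in> borel_measurable borel"
    using f g by (auto simp: integrable_iff_bounded)
  show ?thesis
    using f g by (intro lborel_pair.Fubini_integrable)
      (auto simp: norm_mult intro!: integrable_mult_left integrable_mult_right integrable_norm)
qed

text \<open>Peetre's inequality: the weight \<open>1 + norm x\<close> is submultiplicative, since
  the expanded product contains the sum of the two norms. It carries polynomial weights through
  translations and convolutions.\<close>

lemma norm_split_weight: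
  fixes x y :: "'a::real_normed_vector"
  shows "(1 + norm x) ^ m \<le> (1 + norm y) ^ m * (1 + norm (x - y)) ^ m"
proof -
  have "norm x \<le> norm y + norm (x - y)" using norm_triangle_ineq[of y "x - y"] by simp
  then have "1 + norm x \<le> (1 + norm y) * (1 + norm (x - y))"
  proof -
    have "(1 + norm y) * (1 + norm (x - y)) = 1 + norm y + norm (x - y) + norm y * norm (x - y)"
      by (simp add: algebra_simps)
    moreover have "0 \<le> norm y * norm (x - y)" by simp
    moreover note \<open>norm x \<le> norm y + norm (x - y)\<close>
    ultimately show ?thesis by linarith
  qed
  then show ?thesis by (metis power_mono power_mult_distrib add_nonneg_nonneg norm_ge_zero zero_le_one)
qed

definition convol :: "('a::euclidean_space \<Rightarrow> complex) \<Rightarrow> ('a \<Rightarrow> complex) \<Rightarrow> 'a \<Rightarrow> complex" where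
  "convol f k x = (LINT y|lborel. f y * k (x - y))"

lemma rapid_mult_shift_integrable:
  assumes "rapid f" "rapid k" shows "integrable lborel (\<lambda>y. f y * k (x - y))"
proof -
  obtain B where B: "\<And>x. norm (k x) \<le> B" using rapid_bounded[OF assms(2)] by metis
  have "rapid (\<lambda>y. k (x - y) * f y)"
    using rapid_continuous[OF rapid_reflect[OF assms(2)]] B
    by (intro rapid_mult_bounded assms) auto
  then show ?thesis by (simp add: rapid_integrable mult.commute)
qed

lemma rapid_convol:
  assumes f: "rapid f" and k: "rapid k"
  shows "rapid (convol f k)"
proof (rule rapidI)
  obtain B where B: "\<And>x. norm (k x) \<le> B" using rapid_bounded[OF k] by metis
  have [measurable]: "f \<in> borel_measurable borel" "k \<in> borel_measurable borel"
    using f k by (auto intro: rapid_measurable)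
  show "continuous_on UNIV (convol f k)"
    unfolding continuous_on_sequentially
  proof (intro ballI allI impI, elim conjE)
    fix x :: 'a and X assume X: "X \<longlonglongrightarrow> x"
    show "(convol f k \<circ> X) \<longlonglongrightarrow> convol f k x"
      unfolding comp_def convol_def
    proof (rule integral_dominated_convergence[where w="\<lambda>y. B * norm (f y)"])
      show "integrable lborel (\<lambda>y. B * norm (f y))"
        by (intro integrable_mult_right rapid_norm_integrable f)
      have "isCont k z" for z using rapid_continuous[OF k] by (simp add: continuous_on_eq_continuous_at)
      then show "AE y in lborel. (\<lambda>n. f y * k (X n - y)) \<longlonglongrightarrow> f y * k (x - y)"
        using X by (intro AE_I2 tendsto_mult tendsto_const isCont_tendsto_compose[where g=k] tendsto_diff)
      show "AE y in lborel. norm (f y * k (X n - y)) \<le> B * norm (f y)" for n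
        using B by (intro AE_I2) (simp add: norm_mult mult.commute[of B] mult_left_mono)
    qed measurable
  qed
  fix m :: nat
  obtain C where C: "C > 0" "\<And>x. (1 + norm x) ^ m * norm (k x) \<le> C" using rapid_boundE[OF k] by metis
  have "(1 + norm x) ^ m * norm (convol f k x) \<le> (LINT y|lborel. C * ((1 + norm y) ^ m * norm (f y)))" for x
  proof -
    have "(1 + norm x) ^ m * norm (convol f k x) \<le> (1 + norm x) ^ m * (LINT y|lborel. norm (f y * k (x - y)))"
      unfolding convol_def by (intro mult_left_mono integral_norm_bound) auto
    also have "\<dots> = (LINT y|lborel. (1 + norm x) ^ m * norm (f y * k (x - y)))" by simp
    also have "\<dots> \<le> (LINT y|lborel. C * ((1 + norm y) ^ m * norm (f y)))"
    proof (rule integral_mono)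
      show "integrable lborel (\<lambda>y. (1 + norm x) ^ m * norm (f y * k (x - y)))"
        by (intro integrable_mult_right integrable_norm rapid_mult_shift_integrable f k)
      show "integrable lborel (\<lambda>y. C * ((1 + norm y) ^ m * norm (f y)))"
        by (intro integrable_mult_right rapid_weight_integrable f)
      fix y
      have "(1 + norm x) ^ m * norm (f y * k (x - y)) \<le> ((1 + norm y) ^ m * (1 + norm (x - y)) ^ m) * norm (f y * k (x - y))"
        by (intro mult_right_mono norm_split_weight) auto
      also have "\<dots> = ((1 + norm y) ^ m * norm (f y)) * ((1 + norm (x - y)) ^ m * norm (k (x - y)))"
        by (simp add: norm_mult mult_ac)
      also have "\<dots> \<le> ((1 + norm y) ^ m * norm (f y)) * C"
        by (intro mult_left_mono C) auto
      finally show "(1 + norm x) ^ m * norm (f y * k (x - y)) \<le> C * ((1 + norm y) ^ m * norm (f y))"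
        by (simp add: mult_ac)
    qed
    finally show ?thesis .
  qed
  then show "\<exists>C. \<forall>x. (1 + norm x) ^ m * norm (convol f k x) \<le> C" by blast
qed

lemma convol_commute:
  assumes f: "rapid f" and k: "rapid k" shows "convol f k x = convol k f x"
proof -
  have [measurable]: "f \<in> borel_measurable borel" "k \<in> borel_measurable borel"
    using f k by (auto intro: rapid_measurable)
  show ?thesis
    using lborel_integral_affine[of "\<lambda>y. f y * k (x - y)" "-1" x]
    by (simp add: convol_def mult.commute)
qed

lemma continuous_cis_inner [continuous_intros]:
  "continuous_on A (\<lambda>x. cis (c * (x \<bullet> \<xi>)))"
  by (intro continuous_on_cis continuous_intros)

lemma rapid_cis: "rapid f \<Longrightarrow> rapid (\<lambda>x. cis (c * (x \<bullet> \<xi>)) * f x)"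
  by (rule rapid_mult_bounded[where B=1]) (auto intro!: continuous_intros)

lemma fourier_integrable: "rapid f \<Longrightarrow> integrable lborel (\<lambda>x. f x * cis (c * (x \<bullet> \<xi>)))"
  using rapid_integrable[OF rapid_cis[of f c \<xi>]] by (simp add: mult.commute)

lemma fourier_affine:
  fixes f :: "real^'n::finite \<Rightarrow> complex"
  assumes f: "rapid f" and t: "t \<noteq> 0"
  shows "fourier (\<lambda>x. f (t *\<^sub>R (x - y))) \<xi> = (1 / \<bar>t\<bar> ^ CARD('n)) *\<^sub>R (cis (- 2 * pi * (y \<bullet> \<xi>)) * fourier f ((1/t) *\<^sub>R \<xi>))"
proof -
  have [measurable]: "f \<in> borel_measurable borel" using f by (rule rapid_measurable)
  have [measurable]: "(\<lambda>x. cis (c * (x \<bullet> \<xi>))) \<in> borel_measurable borel" for c and \<xi> :: "real^'n"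
    by (intro borel_measurable_continuous_onI continuous_intros)
  let ?h = "\<lambda>x. f x * cis (- 2 * pi * (x \<bullet> ((1/t) *\<^sub>R \<xi>)))"
  have *: "f (t *\<^sub>R (x - y)) * cis (- 2 * pi * (x \<bullet> \<xi>)) =
      cis (- 2 * pi * (y \<bullet> \<xi>)) * ?h (t *\<^sub>R x + - (t *\<^sub>R y))" for x
    using t by (simp add: cis_mult scaleR_diff_right inner_diff_left algebra_simps)
  show ?thesis
    unfolding fourier_def * integral_mult_right_zero
  proof (subst lborel_integral_affine[OF _ t])
    show "?h \<in> borel_measurable borel" by measurable
  qed simp
qed

lemma fourier_modulate:
  "fourier (\<lambda>x. cis (2 * pi * (x \<bullet> \<eta>)) * f x) \<xi> = fourier f (\<xi> - \<eta>)"
proof -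
  have "cis (2 * pi * (x \<bullet> \<eta>)) * f x * cis (- 2 * pi * (x \<bullet> \<xi>)) = f x * cis (- 2 * pi * (x \<bullet> (\<xi> - \<eta>)))" for x
  proof -
    have "cis (2 * pi * (x \<bullet> \<eta>)) * cis (- 2 * pi * (x \<bullet> \<xi>)) = cis (- 2 * pi * (x \<bullet> (\<xi> - \<eta>)))"
      by (simp only: cis_mult inner_diff_right) (simp add: algebra_simps)
    then show ?thesis by (metis mult.assoc mult.commute)
  qed
  then show ?thesis by (simp only: fourier_def)
qed

lemma fourier_add: "rapid f \<Longrightarrow> rapid g \<Longrightarrow> fourier (\<lambda>x. f x + g x) \<xi> = fourier f \<xi> + fourier g \<xi>"
  using fourier_integrable[of f "- 2 * pi" \<xi>] fourier_integrable[of g "- 2 * pi" \<xi>]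
  by (simp add: fourier_def distrib_right)

lemma fourier_cmult: "fourier (\<lambda>x. c * f x) \<xi> = c * fourier f \<xi>"
  by (simp add: fourier_def mult.assoc)

lemma fourier_diff: "rapid f \<Longrightarrow> rapid g \<Longrightarrow> fourier (\<lambda>x. f x - g x) \<xi> = fourier f \<xi> - fourier g \<xi>"
  using fourier_add[of f "\<lambda>x. - 1 * g x" \<xi>] rapid_cmult[of g "-1"] fourier_cmult[of "-1" g \<xi>] by simp

lemma fourier_convol:
  fixes f k :: "real^'n::finite \<Rightarrow> complex"
  assumes f: "rapid f" and k: "rapid k"
  shows "fourier (convol f k) \<xi> = fourier f \<xi> * fourier k \<xi>"
proof -
  have [measurable]: "f \<in> borel_measurable borel" "k \<in> borel_measurable borel"
    using f k by (auto intro: rapid_measurable)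
  have [measurable]: "(\<lambda>x. cis (c * (x \<bullet> \<xi>))) \<in> borel_measurable borel" for c and \<xi> :: "real^'n"
    by (intro borel_measurable_continuous_onI continuous_intros)
  let ?e = "\<lambda>x. cis (- 2 * pi * (x \<bullet> \<xi>))"
  let ?m = "2 * DIM(real^'n)"
  let ?w = "\<lambda>x::real^'n. complex_of_real (1 / (1 + norm x) ^ ?m)"
  \<comment> \<open>The weight is spent twice on f: once to pass from decay in \<open>x - y\<close>
    to decay in x, once for decay in y. The resulting product bound in x and y is what Fubini
    requires.\<close>
  obtain C where C: "C > 0" "\<And>x. (1 + norm x) ^ (?m + ?m) * norm (f x) \<le> C" using rapid_boundE[OF f] by metis
  obtain D where D: "D > 0" "\<And>x. (1 + norm x) ^ ?m * norm (k x) \<le> D" using rapid_boundE[OF k] by metis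
  have bd: "norm (f y * k (x - y)) \<le> C * D * norm (?w x * ?w y)" for x y
  proof -
    have p: "(1 + norm x) ^ ?m > 0" "(1 + norm y) ^ ?m > 0" by (auto simp: add_pos_nonneg)
    have "(1 + norm x) ^ ?m * (1 + norm y) ^ ?m * norm (f y * k (x - y))
      \<le> ((1 + norm y) ^ ?m * (1 + norm (x - y)) ^ ?m) * (1 + norm y) ^ ?m * norm (f y * k (x - y))"
      by (intro mult_right_mono norm_split_weight) auto
    also have "\<dots> = ((1 + norm y) ^ (?m + ?m) * norm (f y)) * ((1 + norm (x - y)) ^ ?m * norm (k (x - y)))"
      by (simp only: norm_mult power_add mult_ac)
    also have "\<dots> \<le> C * D" using C D by (intro mult_mono) auto
    finally have "norm (f y * k (x - y)) \<le> C * D / ((1 + norm x) ^ ?m * (1 + norm y) ^ ?m)"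
      using p by (simp add: pos_le_divide_eq mult_ac)
    also have "\<dots> = C * D * norm (?w x * ?w y)"
      unfolding norm_mult norm_of_real using p by simp
    finally show ?thesis .
  qed
  have wi: "integrable lborel ?w"
    by (intro integrable_of_real integrable_inverse_weight)
  have int: "integrable (lborel \<Otimes>\<^sub>M lborel) (\<lambda>(x, y). f y * k (x - y) * ?e x)"
  proof (rule Bochner_Integration.integrable_bound)
    show "integrable (lborel \<Otimes>\<^sub>M lborel) (\<lambda>z. C * D * norm (case z of (x, y) \<Rightarrow> ?w x * ?w y))"
      by (intro integrable_mult_right integrable_norm integrable_pair_prod wi)
    show "AE z in lborel \<Otimes>\<^sub>M lborel. norm (case z of (x, y) \<Rightarrow> f y * k (x - y) * ?e x)
        \<le> norm (C * D * norm (case z of (x, y) \<Rightarrow> ?w x * ?w y))"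
    proof (rule AE_I2)
      fix z :: "(real^'n) \<times> (real^'n)"
      obtain x y where z: "z = (x, y)" by (cases z)
      have "norm (f y * k (x - y) * ?e x) \<le> C * D * norm (?w x * ?w y)"
        using bd[where x=x and y=y] by (simp add: norm_mult)
      also have "\<dots> \<le> norm (C * D * norm (?w x * ?w y))" by simp
      finally show "norm (case z of (x, y) \<Rightarrow> f y * k (x - y) * ?e x)
        \<le> norm (C * D * norm (case z of (x, y) \<Rightarrow> ?w x * ?w y))" unfolding z prod.case .
    qed
    show "(\<lambda>(x, y). f y * k (x - y) * ?e x) \<in> borel_measurable (lborel \<Otimes>\<^sub>M lborel)"
      by measurable
  qed
  have "fourier (convol f k) \<xi> = (LINT x|lborel. LINT y|lborel. f y * k (x - y) * ?e x)"
    unfolding fourier_def convol_def by (simp only: integral_mult_left_zero)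
  also have "\<dots> = (LINT y|lborel. LINT x|lborel. f y * k (x - y) * ?e x)"
    using lborel_pair.Fubini_integral[OF int] by simp
  also have "\<dots> = (LINT y|lborel. f y * (?e y * fourier k \<xi>))"
  proof (intro Bochner_Integration.integral_cong refl)
    fix y
    have "(LINT x|lborel. f y * k (x - y) * ?e x) = f y * fourier (\<lambda>x. k (1 *\<^sub>R (x - y))) \<xi>"
      by (simp add: fourier_def mult.assoc)
    then show "(LINT x|lborel. f y * k (x - y) * ?e x) = f y * (?e y * fourier k \<xi>)"
      by (subst (asm) fourier_affine[OF k]) auto
  qed
  also have "\<dots> = (LINT y|lborel. f y * ?e y * fourier k \<xi>)" by (simp add: mult.assoc)
  also have "\<dots> = fourier f \<xi> * fourier k \<xi>" unfolding fourier_def[of f] by (simp only: integral_mult_left_zero)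
  finally show ?thesis .
qed

section \<open>Gaussians and injectivity of the Fourier transform\<close>

definition gauss :: "'a::euclidean_space \<Rightarrow> complex" where
  "gauss x = (\<Prod>b\<in>Basis. complex_of_real (std_normal_density (x \<bullet> b)))"

lemma integrable_gauss: "integrable lborel (gauss :: 'a::euclidean_space \<Rightarrow> complex)"
  unfolding gauss_def[abs_def]
  by (rule lborel_prod_integral) (intro integrable_of_real integrable_normal_density, simp)

lemma integral_gauss: "(LINT x|lborel. gauss (x::'a::euclidean_space)) = 1"
  unfolding gauss_def
  by (subst lborel_prod_integral(2)) (auto intro!: integrable_of_real integral_normal_density prod.neutral)

text \<open>Coordinatewise this is the characteristic function of the standard normal law; the
  powers of \<open>sqrt (2 * pi)\<close> make up for the normalisation of the density, whose
  integral is 1.\<close>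

lemma gauss_fourier:
  fixes x :: "'a::euclidean_space"
  shows "(LINT t|lborel. gauss t * cis (t \<bullet> x)) = of_real (sqrt (2 * pi) ^ DIM('a)) * gauss x"
proof -
  have i: "integrable lborel (\<lambda>s. complex_of_real (std_normal_density s) * cis (s * c))" for c
  proof (rule Bochner_Integration.integrable_bound)
    show "integrable lborel std_normal_density" by simp
    have "(\<lambda>s. cis (s * c)) \<in> borel_measurable borel"
      by (intro borel_measurable_continuous_onI continuous_on_cis continuous_intros)
    then show "(\<lambda>s. complex_of_real (std_normal_density s) * cis (s * c)) \<in> borel_measurable lborel" by simp
  qed (simp add: norm_mult)
  have v: "(LINT s|lborel. complex_of_real (std_normal_density s) * cis (s * c)) = of_real (sqrt (2 * pi)) * of_real (std_normal_density c)" for c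
  proof -
    have "char std_normal_distribution c = (LINT s|lborel. complex_of_real (std_normal_density s) * cis (s * c))"
      unfolding char_def
      by (subst integral_density) (auto simp: scaleR_conv_of_real cis_conv_exp mult_ac)
    then have "(LINT s|lborel. complex_of_real (std_normal_density s) * cis (s * c)) = complex_of_real (exp (- (c^2) / 2))"
      by (simp only: char_std_normal_distribution)
    then show ?thesis
      by (simp add: std_normal_density_def)
  qed
  have "gauss t * cis (t \<bullet> x) = (\<Prod>b\<in>Basis. complex_of_real (std_normal_density (t \<bullet> b)) * cis ((t \<bullet> b) * (x \<bullet> b)))" for t
  proof -
    have "cis (t \<bullet> x) = (\<Prod>b\<in>Basis. cis ((t \<bullet> b) * (x \<bullet> b)))"
      unfolding euclidean_inner[of t x]
      by (simp add: cis_conv_exp sum_distrib_left exp_sum)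
    then show ?thesis by (simp add: gauss_def prod.distrib)
  qed
  note gc = this
  show ?thesis
    unfolding gc using lborel_prod_integral(2)[where u="\<lambda>b s. complex_of_real (std_normal_density s) * cis (s * (x \<bullet> b))"] i
    by (simp add: v prod.distrib gauss_def)
qed

text \<open>Testing against the Gaussians centred at \<open>y\<close>, which are Fourier transforms, and shrinking
  them to a point recovers the value at \<open>y\<close>.\<close>

lemma fourier_eq_zeroD:
  fixes h :: "real^'n::finite \<Rightarrow> complex"
  assumes h: "rapid h" and z: "\<And>\<xi>. fourier h \<xi> = 0"
  shows "h y = 0"
proof -
  have [measurable]: "h \<in> borel_measurable borel" using h by (rule rapid_measurable)
  have gm[measurable]: "(gauss :: real^'n \<Rightarrow> complex) \<in> borel_measurable borel"
    using integrable_gauss by (auto simp: integrable_iff_bounded)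
  obtain B where B: "\<And>x. norm (h x) \<le> B" using rapid_bounded[OF h] by metis
  \<comment> \<open>The scaled Gaussian is written as an integral of characters over t;
    interchanging the integrals leaves values of \<open>fourier h\<close>, which vanish.\<close>
  have 0: "(LINT x|lborel. h x * gauss ((1/a) *\<^sub>R (x - y))) = 0" if a: "a > 0" for a
  proof -
    let ?G = "\<lambda>x t. h x * (gauss t * cis (t \<bullet> ((1/a) *\<^sub>R (x - y))))"
    have cm[measurable]: "(\<lambda>z. cis (snd z \<bullet> ((1/a) *\<^sub>R (fst z - y)))) \<in> borel_measurable (lborel \<Otimes>\<^sub>M lborel)"
      unfolding lborel_prod
      using that by (simp, intro borel_measurable_continuous_onI continuous_on_cis continuous_intros) auto
    have int: "integrable (lborel \<Otimes>\<^sub>M lborel) (\<lambda>(x, t). ?G x t)"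
    proof (rule Bochner_Integration.integrable_bound)
      show "integrable (lborel \<Otimes>\<^sub>M lborel) (\<lambda>(x, t::real^'n). h x * gauss t)"
        by (rule integrable_pair_prod[OF rapid_integrable[OF h] integrable_gauss])
      show "(\<lambda>(x, t). ?G x t) \<in> borel_measurable (lborel \<Otimes>\<^sub>M lborel)"
        unfolding split_beta by (intro borel_measurable_times cm) measurable
    qed (auto simp: norm_mult)
    have "of_real (sqrt (2 * pi) ^ DIM(real^'n)) * (LINT x|lborel. h x * gauss ((1/a) *\<^sub>R (x - y)))
      = (LINT x|lborel. h x * (of_real (sqrt (2 * pi) ^ DIM(real^'n)) * gauss ((1/a) *\<^sub>R (x - y))))"
      by (subst integral_mult_right_zero[symmetric]) (simp add: mult_ac)
    also have "\<dots> = (LINT x|lborel. LINT t|lborel. ?G x t)"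
      by (simp only: gauss_fourier[symmetric] integral_mult_right_zero)
    also have "\<dots> = (LINT t|lborel. LINT x|lborel. ?G x t)"
      using lborel_pair.Fubini_integral[OF int] by simp
    also have "\<dots> = (LINT t::real^'n|lborel. 0)"
    proof (intro Bochner_Integration.integral_cong refl)
      fix t :: "real^'n"
      \<comment> \<open>The factor \<open>- 1 / (2 * pi * a)\<close> translates the character
        \<open>cis (t \<bullet> x / a)\<close> into the convention
        \<open>cis (- 2 * pi * (x \<bullet> \<xi>))\<close> of \<open>fourier\<close>.\<close>
      define \<xi> where "\<xi> = (- 1 / (2 * pi * a)) *\<^sub>R t"
      have "?G x t = gauss t * cis (- ((1/a) * (t \<bullet> y))) * (h x * cis (- 2 * pi * (x \<bullet> \<xi>)))" for x
      proof -
        have "- 2 * pi * (x \<bullet> \<xi>) = (1/a) * (t \<bullet> x)"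
          using a by (simp add: \<xi>_def inner_commute)
        then have "cis (t \<bullet> ((1/a) *\<^sub>R (x - y))) = cis (- ((1/a) * (t \<bullet> y))) * cis (- 2 * pi * (x \<bullet> \<xi>))"
          by (simp only: cis_mult) (simp add: inner_diff_right diff_divide_distrib)
        then show ?thesis by (simp add: mult_ac)
      qed
      then have "(LINT x|lborel. ?G x t) = gauss t * cis (- ((1/a) * (t \<bullet> y))) * fourier h \<xi>"
        unfolding fourier_def by (simp only: integral_mult_right_zero)
      then show "(LINT x|lborel. ?G x t) = 0" by (simp add: z)
    qed
    finally show ?thesis by simp
  qed
  have 1: "(LINT x|lborel. h (y + a *\<^sub>R x) * gauss x) = 0" if a: "a > 0" for a
    using lborel_integral_affine[of "\<lambda>x. h x * gauss ((1/a) *\<^sub>R (x - y))" a y] a 0[OF a]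
    by (simp add: add.commute)
  have "(\<lambda>m. LINT x|lborel. h (y + (1 / real (Suc m)) *\<^sub>R x) * gauss x) \<longlonglongrightarrow> (LINT x|lborel. h (y + 0 *\<^sub>R x) * gauss x)"
  proof (rule integral_dominated_convergence[where w="\<lambda>x. B * norm (gauss x)"])
    show "integrable lborel (\<lambda>x::real^'n. B * norm (gauss x))"
      by (intro integrable_mult_right integrable_norm integrable_gauss)
    have "isCont h z" for z using rapid_continuous[OF h] by (simp add: continuous_on_eq_continuous_at)
    then show "AE x in lborel. (\<lambda>m. h (y + (1 / real (Suc m)) *\<^sub>R x) * gauss x) \<longlonglongrightarrow> h (y + 0 *\<^sub>R x) * gauss x"
      by (intro AE_I2 tendsto_mult tendsto_const isCont_tendsto_compose[where g=h] tendsto_add tendsto_scaleR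
          LIMSEQ_Suc[OF lim_1_over_n])
    show "AE x in lborel. norm (h (y + (1 / real (Suc m)) *\<^sub>R x) * gauss x) \<le> B * norm (gauss x)" for m
      using B by (intro AE_I2) (simp add: norm_mult mult_right_mono)
  qed measurable
  then have "(\<lambda>m. 0) \<longlonglongrightarrow> h y" by (simp add: 1 integral_gauss)
  then show ?thesis by (simp add: LIMSEQ_const_iff)
qed

lemma fourier_inject:
  assumes "rapid f" "rapid g" "\<And>\<xi>. fourier f \<xi> = fourier g \<xi>"
  shows "f = g"
  using fourier_eq_zeroD[OF rapid_diff[OF assms(1,2)]] assms(3) fourier_diff[OF assms(1,2)] by fastforce

section \<open>Schwartz functions\<close>

lemma pd_eq_derivative:
  assumes "(f has_derivative D) (at x)"
  shows "pd i f x = D (axis i 1)"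
proof -
  have "((\<lambda>t. x + t *\<^sub>R axis i 1) has_derivative (\<lambda>t. t *\<^sub>R axis i 1)) (at (0::real))"
    by (auto intro!: derivative_eq_intros)
  then have "((\<lambda>t. f (x + t *\<^sub>R axis i 1)) has_derivative (\<lambda>t. D (t *\<^sub>R axis i 1))) (at (0::real))"
    by (rule has_derivative_compose) (use assms in simp)
  moreover have "linear D" using assms by (rule has_derivative_linear)
  ultimately have "((\<lambda>t. f (x + t *\<^sub>R axis i 1)) has_vector_derivative D (axis i 1)) (at 0)"
    by (simp add: has_vector_derivative_def linear_scale)
  then show ?thesis unfolding pd_def by (rule vector_derivative_at)
qed

lemma has_derivative_pd:
  fixes f :: "real^'n::finite \<Rightarrow> complex"
  assumes "f differentiable (at x)"
  shows "(f has_derivative (\<lambda>h. \<Sum>i\<in>UNIV. h $ i *\<^sub>R pd i f x)) (at x)"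
proof -
  obtain D where D: "(f has_derivative D) (at x)" using assms by (auto simp: differentiable_def)
  then have "linear D" by (rule has_derivative_linear)
  have "D h = (\<Sum>i\<in>UNIV. h $ i *\<^sub>R pd i f x)" for h
  proof -
    have "D h = D (\<Sum>i\<in>UNIV. h $ i *\<^sub>R axis i 1)" by (simp add: basis_expansion scalar_mult_eq_scaleR[symmetric])
    also have "\<dots> = (\<Sum>i\<in>UNIV. h $ i *\<^sub>R pd i f x)"
      by (simp add: linear_sum[OF \<open>linear D\<close>] linear_scale[OF \<open>linear D\<close>] pd_eq_derivative[OF D])
    finally show ?thesis .
  qed
  then have "D = (\<lambda>h. \<Sum>i\<in>UNIV. h $ i *\<^sub>R pd i f x)" by blast
  with D show ?thesis by simp
qed

lemma pdl_append: "pdl (\<alpha> @ \<beta>) f = pdl \<alpha> (pdl \<beta> f)"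
  by (induction \<alpha>) auto

lemma schwartz_differentiable: "f \<in> schwartz \<Longrightarrow> pdl \<alpha> f differentiable (at x)"
  by (simp add: schwartz_def)

lemma schwartz_pdl: "f \<in> schwartz \<Longrightarrow> pdl \<beta> f \<in> schwartz"
  by (simp add: schwartz_def pdl_append[symmetric])

lemma schwartz_pd: "f \<in> schwartz \<Longrightarrow> pd i f \<in> schwartz"
  using schwartz_pdl[of f "[i]"] by simp

lemma schwartz_bdd:
  assumes "f \<in> schwartz"
  shows "bdd_above (range (\<lambda>x. (1 + norm x) ^ m * norm (pdl \<alpha> f x)))"
  using assms by (auto simp: schwartz_def intro: bounded_imp_bdd_above)

lemma sw_sn_ge: "f \<in> schwartz \<Longrightarrow> (1 + norm x) ^ m * norm (pdl \<alpha> f x) \<le> sw_sn m \<alpha> f"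
  unfolding sw_sn_def by (rule cSUP_upper) (auto intro: schwartz_bdd)

lemma sw_sn_nonneg: "f \<in> schwartz \<Longrightarrow> 0 \<le> sw_sn m \<alpha> f"
  by (rule order_trans[OF _ sw_sn_ge[of f 0]]) auto

lemma sw_sn_le: "(\<And>x. (1 + norm x) ^ m * norm (pdl \<alpha> f x) \<le> C) \<Longrightarrow> sw_sn m \<alpha> f \<le> C"
  unfolding sw_sn_def by (rule cSUP_least) auto

lemma schwartzI:
  assumes "\<And>\<alpha> x. pdl \<alpha> f differentiable (at x)"
    "\<And>\<alpha> m. \<exists>C. \<forall>x. (1 + norm x) ^ m * norm (pdl \<alpha> f x) \<le> C"
  shows "f \<in> schwartz"
proof -
  have "bounded (range (\<lambda>x. (1 + norm x) ^ m * norm (pdl \<alpha> f x)))" for \<alpha> m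
  proof -
    obtain C where "\<And>x. (1 + norm x) ^ m * norm (pdl \<alpha> f x) \<le> C" using assms(2) by blast
    then show ?thesis by (intro boundedI[where B=C]) auto
  qed
  then show ?thesis using assms(1) by (simp add: schwartz_def)
qed

lemma schwartz_rapid:
  assumes "f \<in> schwartz" shows "rapid f"
proof (rule rapidI)
  show "continuous_on UNIV f"
    using schwartz_differentiable[OF assms, of "[]"]
    by (auto simp: continuous_on_eq_continuous_at intro: differentiable_imp_continuous_within)
  show "\<exists>C. \<forall>x. (1 + norm x) ^ m * norm (f x) \<le> C" for m
    using sw_sn_ge[OF assms, of _ m "[]"] by auto
qed

lemma schwartz_has_derivative:
  "f \<in> schwartz \<Longrightarrow> (pdl \<alpha> f has_derivative (\<lambda>h. \<Sum>i\<in>UNIV. h $ i *\<^sub>R pdl (i # \<alpha>) f x)) (at x)"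
  using has_derivative_pd[OF schwartz_differentiable[of f \<alpha> x]] by simp

lemma onorm_components_le:
  fixes p :: "'n::finite \<Rightarrow> complex"
  shows "onorm (\<lambda>h::real^'n. \<Sum>i\<in>UNIV. h $ i *\<^sub>R p i) \<le> (\<Sum>i\<in>UNIV. norm (p i))"
proof (rule onorm_le)
  fix h :: "real^'n"
  have "norm (\<Sum>i\<in>UNIV. h $ i *\<^sub>R p i) \<le> (\<Sum>i\<in>UNIV. norm h * norm (p i))"
    by (rule order_trans[OF norm_sum sum_mono])
       (use component_le_norm_cart in \<open>auto intro!: mult_right_mono\<close>)
  then show "norm (\<Sum>i\<in>UNIV. h $ i *\<^sub>R p i) \<le> (\<Sum>i\<in>UNIV. norm (p i)) * norm h"
    by (simp add: sum_distrib_left[symmetric] mult.commute)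
qed

text \<open>Mean value inequality along the segment between the two arguments. Each point w of it
  has distance at most \<open>norm y + norm y'\<close> from z, so the weight at z can be exchanged
  for the weight at w at the stated price. Applied to all derivatives, it bounds a seminorm of a
  difference of translates.\<close>

lemma schwartz_weighted_lipschitz:
  fixes k :: "real^'n::finite \<Rightarrow> complex"
  assumes k: "k \<in> schwartz"
  obtains L where "L > 0" "\<And>z y y'. (1 + norm z) ^ m * norm (k (z - y) - k (z - y'))
      \<le> L * norm (y - y') * (1 + norm y + norm y') ^ m"
proof
  define L where "L = 1 + (\<Sum>i\<in>UNIV. sw_sn m [i] k)"
  show "L > 0" unfolding L_def by (intro add_pos_nonneg sum_nonneg sw_sn_nonneg k) auto
  fix z y y' :: "real^'n"
  let ?R = "1 + norm y + norm y'"
  let ?B = "L * ?R ^ m / (1 + norm z) ^ m"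
  have p: "(1 + norm z) ^ m > 0" by (simp add: add_pos_nonneg)
  have "norm (k (z - y) - k (z - y')) \<le> ?B * norm ((z - y) - (z - y'))"
  proof (rule differentiable_bound[where S="closed_segment (z - y) (z - y')" and f'="\<lambda>w h. \<Sum>i\<in>UNIV. h $ i *\<^sub>R pd i k w"])
    fix w assume "w \<in> closed_segment (z - y) (z - y')"
    show "(k has_derivative (\<lambda>h. \<Sum>i\<in>UNIV. h $ i *\<^sub>R pd i k w)) (at w within closed_segment (z - y) (z - y'))"
      using schwartz_has_derivative[OF k, of "[]" w] by (auto intro: has_derivative_at_withinI)
    from \<open>w \<in> _\<close> obtain u where u: "0 \<le> u" "u \<le> 1" "w = (1 - u) *\<^sub>R (z - y) + u *\<^sub>R (z - y')"
      by (auto simp: closed_segment_def)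
    have "norm (z - w) = norm ((1 - u) *\<^sub>R y + u *\<^sub>R y')" unfolding u by (simp add: algebra_simps)
    also have "\<dots> \<le> (1 - u) * norm y + u * norm y'"
      using u norm_triangle_ineq[of "(1 - u) *\<^sub>R y" "u *\<^sub>R y'"] by simp
    also have "\<dots> \<le> 1 * norm y + 1 * norm y'" using u by (intro add_mono mult_right_mono) auto
    finally have zw: "(1 + norm (z - w)) ^ m \<le> ?R ^ m" by (intro power_mono) auto
    have "onorm (\<lambda>h. \<Sum>i\<in>UNIV. h $ i *\<^sub>R pd i k w) \<le> (\<Sum>i\<in>UNIV. norm (pd i k w))"
      by (rule onorm_components_le)
    also have "\<dots> \<le> ?B"
    proof -
      have "(1 + norm z) ^ m * (\<Sum>i\<in>UNIV. norm (pd i k w)) \<le> ((1 + norm w) ^ m * (1 + norm (z - w)) ^ m) * (\<Sum>i\<in>UNIV. norm (pd i k w))"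
        by (intro mult_right_mono norm_split_weight sum_nonneg) auto
      also have "\<dots> = (1 + norm (z - w)) ^ m * (\<Sum>i\<in>UNIV. (1 + norm w) ^ m * norm (pd i k w))"
        unfolding sum_distrib_left[symmetric] by (simp add: mult_ac)
      also have "\<dots> \<le> ?R ^ m * (\<Sum>i\<in>UNIV. sw_sn m [i] k)"
        using sw_sn_ge[OF k, of w m "[_]"] zw by (intro mult_mono sum_mono sum_nonneg) auto
      also have "\<dots> \<le> ?R ^ m * L" unfolding L_def by (intro mult_left_mono) auto
      finally show ?thesis using p by (simp add: pos_le_divide_eq mult.commute)
    qed
    finally show "onorm (\<lambda>h. \<Sum>i\<in>UNIV. h $ i *\<^sub>R pd i k w) \<le> ?B" .
  qed auto
  then have "(1 + norm z) ^ m * norm (k (z - y) - k (z - y')) \<le> (1 + norm z) ^ m * (?B * norm (y - y'))"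
    by (intro mult_left_mono) (auto simp: norm_minus_commute)
  also have "\<dots> = L * norm (y - y') * ?R ^ m" using less_imp_neq[OF p] by (auto simp: mult_ac)
  finally show "(1 + norm z) ^ m * norm (k (z - y) - k (z - y')) \<le> L * norm (y - y') * ?R ^ m" .
qed

section \<open>Operations preserving the Schwartz class\<close>

lemma has_derivative_affine_comp:
  fixes f :: "real^'n::finite \<Rightarrow> complex"
  assumes "f differentiable (at (a *\<^sub>R x + b))"
  shows "((\<lambda>x. f (a *\<^sub>R x + b)) has_derivative (\<lambda>h. \<Sum>i\<in>UNIV. h $ i *\<^sub>R (a *\<^sub>R pd i f (a *\<^sub>R x + b)))) (at x)"
proof -
  have "((\<lambda>x. a *\<^sub>R x + b) has_derivative (\<lambda>h. a *\<^sub>R h)) (at x)"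
    by (auto intro!: derivative_eq_intros)
  from has_derivative_compose[OF this has_derivative_pd[OF assms]]
  show ?thesis by (simp add: mult.commute)
qed

lemma sum_axis:
  fixes p :: "'n::finite \<Rightarrow> 'b::real_vector"
  shows "(\<Sum>i\<in>UNIV. axis j 1 $ i *\<^sub>R p i) = p j"
proof -
  have "(\<Sum>i\<in>UNIV. axis j (1::real) $ i *\<^sub>R p i) = (\<Sum>i\<in>UNIV. if i = j then p i else 0)"
    by (intro sum.cong) (auto simp: axis_def)
  then show ?thesis by simp
qed

lemma pdl_affine:
  assumes f: "f \<in> schwartz"
  shows "pdl \<alpha> (\<lambda>x. f (a *\<^sub>R x + b)) = (\<lambda>x. a ^ length \<alpha> *\<^sub>R pdl \<alpha> f (a *\<^sub>R x + b))"
proof (induction \<alpha>)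
  case (Cons j \<alpha>)
  show ?case
  proof
    fix x
    have "((\<lambda>x. a ^ length \<alpha> *\<^sub>R pdl \<alpha> f (a *\<^sub>R x + b)) has_derivative
       (\<lambda>h. a ^ length \<alpha> *\<^sub>R (\<Sum>i\<in>UNIV. h $ i *\<^sub>R (a *\<^sub>R pd i (pdl \<alpha> f) (a *\<^sub>R x + b))))) (at x)"
      by (intro has_derivative_scaleR_right has_derivative_affine_comp schwartz_differentiable f)
    from pd_eq_derivative[OF this, of j, unfolded sum_axis] show "pdl (j # \<alpha>) (\<lambda>x. f (a *\<^sub>R x + b)) x = a ^ length (j # \<alpha>) *\<^sub>R pdl (j # \<alpha>) f (a *\<^sub>R x + b)"
      by (simp add: Cons mult.commute)
  qed
qed simp

lemma schwartz_affine:
  assumes f: "f \<in> schwartz" and a: "a \<noteq> 0"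
  shows "(\<lambda>x. f (a *\<^sub>R x + b)) \<in> schwartz"
proof (rule schwartzI)
  fix \<alpha>
  show "pdl \<alpha> (\<lambda>x. f (a *\<^sub>R x + b)) differentiable (at x)" for x
    unfolding pdl_affine[OF f] differentiable_def
    using has_derivative_scaleR_right[OF has_derivative_affine_comp[OF schwartz_differentiable[OF f]]] by blast
  fix m
  have "rapid (\<lambda>x. complex_of_real (a ^ length \<alpha>) * pdl \<alpha> f (a *\<^sub>R x + b))"
    by (intro rapid_cmult rapid_affine schwartz_rapid schwartz_pdl f a)
  then show "\<exists>C. \<forall>x. (1 + norm x) ^ m * norm (pdl \<alpha> (\<lambda>x. f (a *\<^sub>R x + b)) x) \<le> C"
    unfolding pdl_affine[OF f] by (simp add: rapid_def norm_mult norm_power power_abs)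
qed

lemma schwartz_shift: "k \<in> schwartz \<Longrightarrow> (\<lambda>z. k (z - y)) \<in> schwartz"
  using schwartz_affine[of k 1 "- y"] by simp

lemma pdl_shift: "k \<in> schwartz \<Longrightarrow> pdl \<alpha> (\<lambda>z. k (z - y)) = (\<lambda>z. pdl \<alpha> k (z - y))"
  using pdl_affine[of k \<alpha> 1 "- y"] by simp

lemma schwartz_reflect: "k \<in> schwartz \<Longrightarrow> (\<lambda>z. k (x - z)) \<in> schwartz"
  using schwartz_affine[of k "-1" x] by simp

lemma pdl_add:
  assumes "f \<in> schwartz" "g \<in> schwartz"
  shows "pdl \<alpha> (\<lambda>x. f x + g x) = (\<lambda>x. pdl \<alpha> f x + pdl \<alpha> g x)"
proof (induction \<alpha>)
  case (Cons j \<alpha>)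
  show ?case
    using pd_eq_derivative[OF has_derivative_add[OF schwartz_has_derivative[OF assms(1)] schwartz_has_derivative[OF assms(2)]]]
    by (auto simp: Cons sum_axis)
qed simp

lemma pdl_cmult:
  assumes "f \<in> schwartz"
  shows "pdl \<alpha> (\<lambda>x. c * f x) = (\<lambda>x. c * pdl \<alpha> f x)"
proof (induction \<alpha>)
  case (Cons j \<alpha>)
  show ?case
    using pd_eq_derivative[OF has_derivative_mult_right[OF schwartz_has_derivative[OF assms(1)]]]
    by (auto simp: Cons sum_axis)
qed simp

lemma schwartz_add:
  assumes "f \<in> schwartz" "g \<in> schwartz" shows "(\<lambda>x. f x + g x) \<in> schwartz"
proof (rule schwartzI)
  show "pdl \<alpha> (\<lambda>x. f x + g x) differentiable (at x)" for \<alpha> x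
    unfolding pdl_add[OF assms] using assms by (intro differentiable_add schwartz_differentiable)
  show "\<exists>C. \<forall>x. (1 + norm x) ^ m * norm (pdl \<alpha> (\<lambda>x. f x + g x) x) \<le> C" for \<alpha> m
    using rapid_add[OF schwartz_rapid[OF schwartz_pdl[OF assms(1)]] schwartz_rapid[OF schwartz_pdl[OF assms(2)]]]
    by (simp add: pdl_add[OF assms] rapid_def)
qed

lemma schwartz_cmult:
  assumes "f \<in> schwartz" shows "(\<lambda>x. c * f x) \<in> schwartz"
proof (rule schwartzI)
  show "pdl \<alpha> (\<lambda>x. c * f x) differentiable (at x)" for \<alpha> x
    unfolding pdl_cmult[OF assms] using assms by (intro differentiable_mult schwartz_differentiable) auto
  show "\<exists>C. \<forall>x. (1 + norm x) ^ m * norm (pdl \<alpha> (\<lambda>x. c * f x) x) \<le> C" for \<alpha> m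
    using rapid_cmult[OF schwartz_rapid[OF schwartz_pdl[OF assms]]]
    by (simp add: pdl_cmult[OF assms] rapid_def)
qed

lemma schwartz_diff: "f \<in> schwartz \<Longrightarrow> g \<in> schwartz \<Longrightarrow> (\<lambda>x. f x - g x) \<in> schwartz"
  using schwartz_add[of f "\<lambda>x. - 1 * g x"] schwartz_cmult[of g "-1"] by simp

lemma pdl_diff:
  assumes "f \<in> schwartz" "g \<in> schwartz"
  shows "pdl \<alpha> (\<lambda>x. f x - g x) = (\<lambda>x. pdl \<alpha> f x - pdl \<alpha> g x)"
  using pdl_add[OF assms(1) schwartz_cmult[OF assms(2), of "-1"], of \<alpha>] pdl_cmult[OF assms(2), of \<alpha> "-1"] by simp

lemma pdl_zero: "pdl \<alpha> (\<lambda>x. 0) = (\<lambda>x. 0)"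
  by (induction \<alpha>) (auto simp: pd_def)

lemma schwartz_zero: "(\<lambda>x. 0) \<in> schwartz"
  by (rule schwartzI) (auto simp: pdl_zero)

lemma schwartz_sum:
  assumes "\<And>i. i \<in> I \<Longrightarrow> f i \<in> schwartz"
  shows "(\<lambda>x. \<Sum>i\<in>I. f i x) \<in> schwartz" "pdl \<alpha> (\<lambda>x. \<Sum>i\<in>I. f i x) = (\<lambda>x. \<Sum>i\<in>I. pdl \<alpha> (f i) x)"
  using assms
proof (induction I rule: infinite_finite_induct)
  case (insert i I)
  { case 1 with insert show ?case by (auto intro!: schwartz_add) }
  { case 2
    then have "f i \<in> schwartz" "(\<lambda>x. \<Sum>i\<in>I. f i x) \<in> schwartz" using insert by auto
    from pdl_add[OF this] insert 2 show ?case by simp }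
qed (auto simp: schwartz_zero pdl_zero)

text \<open>The Taylor remainder of \<open>k\<close> is quadratic uniformly in the base point, so it can be integrated directly.\<close>

lemma has_derivative_convol:
  fixes k :: "real^'n::finite \<Rightarrow> complex"
  assumes f: "rapid f" and k: "k \<in> schwartz"
  shows "(convol f k has_derivative (\<lambda>h. \<Sum>i\<in>UNIV. h $ i *\<^sub>R convol f (pd i k) x)) (at x)"
proof -
  have "\<forall>i. \<exists>L>0. \<forall>z y y'. (1 + norm z) ^ 0 * norm (pd i k (z - y) - pd i k (z - y')) \<le> L * norm (y - y') * (1 + norm y + norm y') ^ 0"
    using schwartz_weighted_lipschitz[OF schwartz_pd[OF k], of 0] by metis
  then obtain L where L: "\<And>i. L i > 0" "\<And>i z y y'. norm (pd i k (z - y) - pd i k (z - y')) \<le> L i * norm (y - y')"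
    by (simp, metis)
  define B where "B = (\<Sum>i\<in>UNIV. L i)"
  have B: "B \<ge> 0" unfolding B_def using L(1) by (simp add: sum_nonneg less_imp_le)
  let ?d = "\<lambda>w h. \<Sum>i\<in>UNIV. h $ i *\<^sub>R pd i k w"
  have taylor: "norm (k (w + h) - k w - ?d w h) \<le> B * (norm h)\<^sup>2" for w h :: "real^'n"
  proof -
    have "norm (k (w + h) - k w - ?d w ((w + h) - w)) \<le> norm ((w + h) - w) * (B * norm h)"
    proof (rule differentiable_bound_linearization[where S="cball w (norm h)"])
      fix v assume v: "v \<in> cball w (norm h)"
      show "(k has_derivative ?d v) (at v within cball w (norm h))"
        using schwartz_has_derivative[OF k, of "[]" v] by (auto intro: has_derivative_at_withinI)
      have "?d v - ?d w = (\<lambda>h. \<Sum>i\<in>UNIV. h $ i *\<^sub>R (pd i k v - pd i k w))"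
        by (auto simp: fun_eq_iff sum_subtractf scaleR_diff_right)
      then have "onorm (?d v - ?d w) \<le> (\<Sum>i\<in>UNIV. norm (pd i k v - pd i k w))"
        by (simp add: onorm_components_le)
      also have "\<dots> \<le> (\<Sum>i\<in>UNIV. L i * norm h)"
      proof (rule sum_mono)
        fix i
        have "norm (pd i k v - pd i k w) \<le> L i * norm (- v - - w)"
          using L(2)[of i 0 "- v" "- w"] by simp
        also have "\<dots> \<le> L i * norm h" using v L(1)[of i] by (intro mult_left_mono) (auto simp: dist_norm)
        finally show "norm (pd i k v - pd i k w) \<le> L i * norm h" .
      qed
      finally show "onorm (?d v - ?d w) \<le> B * norm h" by (simp add: B_def sum_distrib_right)
    qed (auto simp: dist_norm mult_left_le_one_le)
    then show ?thesis by (simp add: power2_eq_square mult_ac)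
  qed
  have kr: "rapid k" "\<And>i. rapid (pd i k)" using schwartz_rapid schwartz_pd k by auto
  define C where "C = B * (LINT y|lborel. norm (f y))"
  have est: "norm (convol f k (x + h) - convol f k x - (\<Sum>i\<in>UNIV. h $ i *\<^sub>R convol f (pd i k) x)) \<le> C * (norm h)\<^sup>2" for h
  proof -
    note i = rapid_mult_shift_integrable[OF f kr(1)] rapid_mult_shift_integrable[OF f kr(2)]
    have eq: "f y * (k ((x - y) + h) - k (x - y) - ?d (x - y) h) =
        f y * k (x + h - y) - f y * k (x - y) - (\<Sum>i\<in>UNIV. h $ i *\<^sub>R (f y * pd i k (x - y)))" for y
    proof -
      have "(x - y) + h = x + h - y" by simp
      moreover have "(\<Sum>i\<in>UNIV. h $ i *\<^sub>R (f y * pd i k (x - y))) = f y * ?d (x - y) h"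
        unfolding sum_distrib_left by (intro sum.cong refl) simp
      ultimately show ?thesis by (simp only: right_diff_distrib)
    qed
    have "convol f k (x + h) - convol f k x - (\<Sum>i\<in>UNIV. h $ i *\<^sub>R convol f (pd i k) x)
      = (LINT y|lborel. f y * k (x + h - y) - f y * k (x - y) - (\<Sum>i\<in>UNIV. h $ i *\<^sub>R (f y * pd i k (x - y))))"
      unfolding convol_def using i by simp
    also have "\<dots> = (LINT y|lborel. f y * (k ((x - y) + h) - k (x - y) - ?d (x - y) h))"
      unfolding eq by (rule refl)
    finally have e: "norm (convol f k (x + h) - convol f k x - (\<Sum>i\<in>UNIV. h $ i *\<^sub>R convol f (pd i k) x))
      = norm (LINT y|lborel. f y * (k ((x - y) + h) - k (x - y) - ?d (x - y) h))" by (rule arg_cong)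
    also have "\<dots> \<le> (LINT y|lborel. norm (f y * (k ((x - y) + h) - k (x - y) - ?d (x - y) h)))"
      by (rule integral_norm_bound)
    also have "\<dots> \<le> (LINT y|lborel. norm (f y) * (B * (norm h)\<^sup>2))"
    proof (rule integral_mono)
      have "integrable lborel (\<lambda>y. f y * (k ((x - y) + h) - k (x - y) - ?d (x - y) h))"
        unfolding eq by (intro Bochner_Integration.integrable_diff Bochner_Integration.integrable_sum integrable_scaleR_right i)
      then show "integrable lborel (\<lambda>y. norm (f y * (k ((x - y) + h) - k (x - y) - ?d (x - y) h)))"
        by (rule integrable_norm)
      show "norm (f y * (k ((x - y) + h) - k (x - y) - ?d (x - y) h)) \<le> norm (f y) * (B * (norm h)\<^sup>2)" for y
        unfolding norm_mult by (intro mult_left_mono taylor) auto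
    qed (intro integrable_mult_left rapid_norm_integrable f)
    also have "\<dots> = C * (norm h)\<^sup>2" by (simp add: C_def mult_ac)
    finally show ?thesis .
  qed
  show ?thesis
    unfolding has_derivative_at
  proof
    show "bounded_linear (\<lambda>h. \<Sum>i\<in>UNIV. h $ i *\<^sub>R convol f (pd i k) x)"
      by (intro bounded_linear_sum bounded_linear_scaleR_left[THEN bounded_linear_compose] bounded_linear_vec_nth)
    have "((\<lambda>h::real^'n. C * norm h) \<longlongrightarrow> C * norm (0::real^'n)) (at 0)"
      by (intro tendsto_intros)
    then have "((\<lambda>h::real^'n. C * norm h) \<longlongrightarrow> 0) (at 0)" by simp
    then show "(\<lambda>h. norm (convol f k (x + h) - convol f k x - (\<Sum>i\<in>UNIV. h $ i *\<^sub>R convol f (pd i k) x)) / norm h) \<midarrow>0\<rightarrow> 0"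
    proof (rule Lim_null_comparison[rotated])
      show "\<forall>\<^sub>F h in at 0. norm (norm (convol f k (x + h) - convol f k x - (\<Sum>i\<in>UNIV. h $ i *\<^sub>R convol f (pd i k) x)) / norm h) \<le> C * norm h"
        using est by (intro eventually_at_topological[THEN iffD2] exI[of _ UNIV])
          (auto simp: divide_le_eq power2_eq_square mult_ac)
    qed
  qed
qed

text \<open>All derivatives fall on the Schwartz factor, so \<open>convol f k\<close> inherits its
  smoothness from \<open>k\<close> and its decay from both factors.\<close>

lemma pdl_convol:
  assumes f: "rapid f" and k: "k \<in> schwartz"
  shows "pdl \<alpha> (convol f k) = convol f (pdl \<alpha> k)"
proof (induction \<alpha>)
  case (Cons j \<alpha>)
  show ?case
    using pd_eq_derivative[OF has_derivative_convol[OF f schwartz_pdl[OF k]]] by (auto simp: Cons sum_axis)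
qed simp

lemma schwartz_convol:
  assumes f: "rapid f" and k: "k \<in> schwartz"
  shows "convol f k \<in> schwartz"
proof (rule schwartzI)
  show "pdl \<alpha> (convol f k) differentiable (at x)" for \<alpha> x
    unfolding pdl_convol[OF assms] using has_derivative_convol[OF f schwartz_pdl[OF k]] by (auto simp: differentiable_def)
  show "\<exists>C. \<forall>x. (1 + norm x) ^ m * norm (pdl \<alpha> (convol f k) x) \<le> C" for \<alpha> m
    unfolding pdl_convol[OF assms] using rapid_convol[OF f schwartz_rapid[OF schwartz_pdl[OF k]]] by (simp add: rapid_def)
qed

section \<open>Tempered distributions\<close>

text \<open>The constant in the definition may be negative; as the seminorms are nonnegative, it can
  be truncated at 0.\<close>

lemma temperedE:
  assumes "T \<in> tempered"
  obtains C N where "C \<ge> 0" "\<And>f. f \<in> schwartz \<Longrightarrow> norm (T f) \<le> C * (\<Sum>\<alpha>\<in>{\<alpha>. length \<alpha> \<le> N}. sw_sn N \<alpha> f)"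
proof -
  obtain C N where C: "\<And>f. f \<in> schwartz \<Longrightarrow> norm (T f) \<le> C * (\<Sum>\<alpha>\<in>{\<alpha>. length \<alpha> \<le> N}. sw_sn N \<alpha> f)"
    using assms unfolding tempered_def by blast
  show ?thesis
  proof (rule that[of "max C 0"])
    fix f :: "real^'a \<Rightarrow> complex" assume f: "f \<in> schwartz"
    have "C * (\<Sum>\<alpha>\<in>{\<alpha>. length \<alpha> \<le> N}. sw_sn N \<alpha> f) \<le> max C 0 * (\<Sum>\<alpha>\<in>{\<alpha>. length \<alpha> \<le> N}. sw_sn N \<alpha> f)"
      using f by (intro mult_right_mono sum_nonneg sw_sn_nonneg) auto
    with C[OF f] show "norm (T f) \<le> max C 0 * (\<Sum>\<alpha>\<in>{\<alpha>. length \<alpha> \<le> N}. sw_sn N \<alpha> f)" by linarith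
  qed auto
qed

lemma temperedI:
  assumes "\<And>f. f \<notin> schwartz \<Longrightarrow> T f = 0"
    "\<And>f g. f \<in> schwartz \<Longrightarrow> g \<in> schwartz \<Longrightarrow> T (\<lambda>x. f x + g x) = T f + T g"
    "\<And>c f. f \<in> schwartz \<Longrightarrow> T (\<lambda>x. c * f x) = c * T f"
    "\<And>f. f \<in> schwartz \<Longrightarrow> norm (T f) \<le> C * (\<Sum>\<alpha>\<in>{\<alpha>. length \<alpha> \<le> N}. sw_sn N \<alpha> f)"
  shows "T \<in> tempered"
  using assms unfolding tempered_def by blast

lemma sw_sn_shift:
  assumes k: "k \<in> schwartz"
  shows "(1 + norm z) ^ N * norm (pdl \<alpha> k (z - y)) \<le> sw_sn N \<alpha> k * (1 + norm y) ^ N"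
proof -
  have "(1 + norm z) ^ N * norm (pdl \<alpha> k (z - y)) \<le> ((1 + norm y) ^ N * (1 + norm (z - y)) ^ N) * norm (pdl \<alpha> k (z - y))"
    by (intro mult_right_mono norm_split_weight) auto
  also have "\<dots> = (1 + norm y) ^ N * ((1 + norm (z - y)) ^ N * norm (pdl \<alpha> k (z - y)))" by (simp add: mult_ac)
  also have "\<dots> \<le> (1 + norm y) ^ N * sw_sn N \<alpha> k" by (intro mult_left_mono sw_sn_ge k) auto
  finally show ?thesis by (simp add: mult.commute)
qed

lemma finite_multiindices [simp]: "finite {\<alpha>::'n::finite list. length \<alpha> \<le> N}"
  using finite_lists_length_le[of "UNIV :: 'n set" N] by simp

lemma tempered_add: "T \<in> tempered \<Longrightarrow> f \<in> schwartz \<Longrightarrow> g \<in> schwartz \<Longrightarrow> T (\<lambda>x. f x + g x) = T f + T g"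
  by (simp add: tempered_def)

lemma tempered_cmult: "T \<in> tempered \<Longrightarrow> f \<in> schwartz \<Longrightarrow> T (\<lambda>x. c * f x) = c * T f"
  by (simp add: tempered_def)

lemma tempered_diff: "T \<in> tempered \<Longrightarrow> f \<in> schwartz \<Longrightarrow> g \<in> schwartz \<Longrightarrow> T (\<lambda>x. f x - g x) = T f - T g"
  using tempered_add[of T f "\<lambda>x. - 1 * g x"] tempered_cmult[of T g "-1"] schwartz_cmult[of g "-1"] by simp

lemma tempered_zero: "T \<in> tempered \<Longrightarrow> T (\<lambda>x. 0) = 0"
  using tempered_cmult[of T "\<lambda>x. 0" 0] schwartz_zero by simp

lemma tempered_sum:
  assumes T: "T \<in> tempered" and "\<And>i. i \<in> I \<Longrightarrow> f i \<in> schwartz"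
  shows "T (\<lambda>x. \<Sum>i\<in>I. f i x) = (\<Sum>i\<in>I. T (f i))"
  using assms(2)
  by (induction I rule: infinite_finite_induct)
    (auto simp: tempered_zero[OF T] tempered_add[OF T] schwartz_sum)

text \<open>Induction over finite combinations; the two seminorm bounds are merged at order
  \<open>max N M\<close>, since the sums increase with the order. Sums, multiples and differences of
  tempered distributions are later derived from this.\<close>

lemma tempered_lincomb:
  assumes "\<And>i. i < K \<Longrightarrow> e i \<in> tempered" shows "lincomb K c e \<in> tempered"
  using assms
proof (induction K)
  case 0
  have "\<exists>C N. \<forall>f\<in>schwartz. norm (0::complex) \<le> C * (\<Sum>\<alpha>\<in>{\<alpha>. length \<alpha> \<le> N}. sw_sn N \<alpha> f)"
    by (rule exI[of _ 0]) auto
  then show ?case by (simp add: lincomb_def tempered_def)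
next
  case (Suc K)
  let ?S = "lincomb K c e" and ?T = "e K"
  have S: "?S \<in> tempered" and T: "?T \<in> tempered" using Suc by auto
  obtain C N where C: "C \<ge> 0" "\<And>f. f \<in> schwartz \<Longrightarrow> norm (?S f) \<le> C * (\<Sum>\<alpha>\<in>{\<alpha>. length \<alpha> \<le> N}. sw_sn N \<alpha> f)"
    using temperedE[OF S] by metis
  obtain D M where D: "D \<ge> 0" "\<And>f. f \<in> schwartz \<Longrightarrow> norm (?T f) \<le> D * (\<Sum>\<alpha>\<in>{\<alpha>. length \<alpha> \<le> M}. sw_sn M \<alpha> f)"
    using temperedE[OF T] by metis
  define R where "R = max N M"
  have mono: "(\<Sum>\<alpha>\<in>{\<alpha>. length \<alpha> \<le> N}. sw_sn N \<alpha> f) \<le> (\<Sum>\<alpha>\<in>{\<alpha>. length \<alpha> \<le> R}. sw_sn R \<alpha> f)"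
    if f: "f \<in> schwartz" and N: "N \<le> R" for f :: "real^'a \<Rightarrow> complex" and N
  proof -
    have "sw_sn N \<alpha> f \<le> sw_sn R \<alpha> f" for \<alpha>
    proof (rule sw_sn_le)
      fix x
      have "(1 + norm x) ^ N * norm (pdl \<alpha> f x) \<le> (1 + norm x) ^ R * norm (pdl \<alpha> f x)"
        using N by (intro mult_right_mono power_increasing) auto
      also have "\<dots> \<le> sw_sn R \<alpha> f" by (rule sw_sn_ge[OF f])
      finally show "(1 + norm x) ^ N * norm (pdl \<alpha> f x) \<le> sw_sn R \<alpha> f" .
    qed
    then have "(\<Sum>\<alpha>\<in>{\<alpha>. length \<alpha> \<le> N}. sw_sn N \<alpha> f) \<le> (\<Sum>\<alpha>\<in>{\<alpha>. length \<alpha> \<le> N}. sw_sn R \<alpha> f)"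
      by (rule sum_mono)
    also have "\<dots> \<le> (\<Sum>\<alpha>\<in>{\<alpha>. length \<alpha> \<le> R}. sw_sn R \<alpha> f)"
      using N f by (intro sum_mono2) (auto intro: sw_sn_nonneg)
    finally show ?thesis .
  qed
  have "norm (?S f + c K * ?T f) \<le> (C + norm (c K) * D) * (\<Sum>\<alpha>\<in>{\<alpha>. length \<alpha> \<le> R}. sw_sn R \<alpha> f)"
    if f: "f \<in> schwartz" for f
  proof -
    have "norm (?S f + c K * ?T f) \<le> norm (?S f) + norm (c K) * norm (?T f)"
      by (metis norm_mult norm_triangle_ineq)
    also have "\<dots> \<le> C * (\<Sum>\<alpha>\<in>{\<alpha>. length \<alpha> \<le> R}. sw_sn R \<alpha> f) + norm (c K) * (D * (\<Sum>\<alpha>\<in>{\<alpha>. length \<alpha> \<le> R}. sw_sn R \<alpha> f))"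
      using mono[OF f, of N] mono[OF f, of M] C D f unfolding R_def
      by (intro add_mono mult_left_mono order_trans[OF C(2)[OF f]] order_trans[OF D(2)[OF f]]) auto
    finally show ?thesis by (simp add: algebra_simps)
  qed
  moreover have "lincomb (Suc K) c e = (\<lambda>f. ?S f + c K * ?T f)" by (simp add: lincomb_def fun_eq_iff)
  ultimately have b: "\<And>f. f \<in> schwartz \<Longrightarrow> norm (lincomb (Suc K) c e f) \<le> (C + norm (c K) * D) * (\<Sum>\<alpha>\<in>{\<alpha>. length \<alpha> \<le> R}. sw_sn R \<alpha> f)"
    and l: "lincomb (Suc K) c e = (\<lambda>f. ?S f + c K * ?T f)"
    by simp_all
  show ?case
  proof (rule temperedI[OF _ _ _ b])
    show "lincomb (Suc K) c e f = 0" if "f \<notin> schwartz" for f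
      using that S T by (simp add: l tempered_def)
  qed (auto simp: l tempered_add[OF S] tempered_add[OF T] tempered_cmult[OF S] tempered_cmult[OF T] algebra_simps)
qed

text \<open>For \<open>k (z) = \<phi> (- z)\<close> the function \<open>y \<mapsto> T (k (\<cdot> - y))\<close> is the convolution \<open>\<phi> * T\<close>.\<close>

lemma tempered_shift_bound:
  assumes T: "T \<in> tempered" and k: "k \<in> schwartz"
  obtains B N where "B \<ge> 0" "\<And>y. norm (T (\<lambda>z. k (z - y))) \<le> B * (1 + norm y) ^ N"
proof -
  obtain C N where C: "C \<ge> 0" "\<And>f. f \<in> schwartz \<Longrightarrow> norm (T f) \<le> C * (\<Sum>\<alpha>\<in>{\<alpha>. length \<alpha> \<le> N}. sw_sn N \<alpha> f)"
    using temperedE[OF T] by metis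
  show ?thesis
  proof (rule that[of "C * (\<Sum>\<alpha>\<in>{\<alpha>. length \<alpha> \<le> N}. sw_sn N \<alpha> k)" N])
    show "0 \<le> C * (\<Sum>\<alpha>\<in>{\<alpha>. length \<alpha> \<le> N}. sw_sn N \<alpha> k)"
      using C(1) k by (intro mult_nonneg_nonneg sum_nonneg sw_sn_nonneg) auto
    fix y :: "real^'a"
    have s: "sw_sn N \<alpha> (\<lambda>z. k (z - y)) \<le> sw_sn N \<alpha> k * (1 + norm y) ^ N" for \<alpha>
      by (rule sw_sn_le) (simp add: pdl_shift[OF k] sw_sn_shift[OF k])
    have "norm (T (\<lambda>z. k (z - y))) \<le> C * (\<Sum>\<alpha>\<in>{\<alpha>. length \<alpha> \<le> N}. sw_sn N \<alpha> k * (1 + norm y) ^ N)"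
      by (rule order_trans[OF C(2)[OF schwartz_shift[OF k]]]) (intro mult_left_mono sum_mono s C)
    then show "norm (T (\<lambda>z. k (z - y))) \<le> C * (\<Sum>\<alpha>\<in>{\<alpha>. length \<alpha> \<le> N}. sw_sn N \<alpha> k) * (1 + norm y) ^ N"
      by (simp add: sum_distrib_right mult.assoc)
  qed
qed

text \<open>T is bounded by finitely many seminorms, and in each of them the difference of two
  translates is small by the weighted Lipschitz bound.\<close>

lemma tempered_shift_continuous:
  fixes T :: "'n::finite distr"
  assumes T: "T \<in> tempered" and k: "k \<in> schwartz"
  shows "continuous_on UNIV (\<lambda>y. T (\<lambda>z. k (z - y)))"
proof -
  obtain C N where C: "C \<ge> 0" "\<And>f. f \<in> schwartz \<Longrightarrow> norm (T f) \<le> C * (\<Sum>\<alpha>\<in>{\<alpha>. length \<alpha> \<le> N}. sw_sn N \<alpha> f)"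
    using temperedE[OF T] by metis
  have "\<forall>\<alpha>. \<exists>L>0. \<forall>z y y'. (1 + norm z) ^ N * norm (pdl \<alpha> k (z - y) - pdl \<alpha> k (z - y')) \<le> L * norm (y - y') * (1 + norm y + norm y') ^ N"
    using schwartz_weighted_lipschitz[OF schwartz_pdl[OF k], of N] by metis
  then obtain L where L: "\<And>\<alpha>. L \<alpha> > 0" "\<And>\<alpha> z y y'. (1 + norm z) ^ N * norm (pdl \<alpha> k (z - y) - pdl \<alpha> k (z - y')) \<le> L \<alpha> * norm (y - y') * (1 + norm y + norm y') ^ N"
    by metis
  have est: "norm (T (\<lambda>z. k (z - y)) - T (\<lambda>z. k (z - y'))) \<le> C * (\<Sum>\<alpha>\<in>{\<alpha>. length \<alpha> \<le> N}. L \<alpha> * norm (y - y') * (1 + norm y + norm y') ^ N)" for y y'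
  proof -
    have "norm (T (\<lambda>z. k (z - y)) - T (\<lambda>z. k (z - y'))) = norm (T (\<lambda>z. k (z - y) - k (z - y')))"
      by (simp add: tempered_diff[OF T] schwartz_shift[OF k])
    also have "\<dots> \<le> C * (\<Sum>\<alpha>\<in>{\<alpha>. length \<alpha> \<le> N}. sw_sn N \<alpha> (\<lambda>z. k (z - y) - k (z - y')))"
      by (intro C schwartz_diff schwartz_shift k)
    also have "\<dots> \<le> C * (\<Sum>\<alpha>\<in>{\<alpha>. length \<alpha> \<le> N}. L \<alpha> * norm (y - y') * (1 + norm y + norm y') ^ N)"
      using L(2) by (intro mult_left_mono sum_mono sw_sn_le C)
        (simp add: pdl_diff schwartz_shift[OF k] pdl_shift[OF k])
    finally show ?thesis .
  qed
  have "((\<lambda>y. T (\<lambda>z. k (z - y))) \<longlongrightarrow> T (\<lambda>z. k (z - y'))) (at y')" for y'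
  proof (rule LIM_zero_cancel, rule Lim_null_comparison[OF always_eventually])
    show "\<forall>y. norm (T (\<lambda>z. k (z - y)) - T (\<lambda>z. k (z - y'))) \<le> C * (\<Sum>\<alpha>\<in>{\<alpha>. length \<alpha> \<le> N}. L \<alpha> * norm (y - y') * (1 + norm y + norm y') ^ N)"
      using est by blast
    have "((\<lambda>y. C * (\<Sum>\<alpha>\<in>{\<alpha>. length \<alpha> \<le> N}. L \<alpha> * norm (y - y') * (1 + norm y + norm y') ^ N)) \<longlongrightarrow>
      C * (\<Sum>\<alpha>\<in>{\<alpha>. length \<alpha> \<le> N}. L \<alpha> * norm (y' - y') * (1 + norm y' + norm y') ^ N)) (at y')"
      by (intro tendsto_intros)
    then show "((\<lambda>y. C * (\<Sum>\<alpha>\<in>{\<alpha>. length \<alpha> \<le> N}. L \<alpha> * norm (y - y') * (1 + norm y + norm y') ^ N)) \<longlongrightarrow> 0) (at y')"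
      by simp
  qed
  then show ?thesis by (simp add: continuous_on_def)
qed

section \<open>Action of a distribution on a convolution\<close>

instance bcontfun :: (metric_space, banach) banach ..

text \<open>The weighted translates are regarded as a continuous curve in the Banach space of
  bounded continuous functions. Riemann sums then converge uniformly in z, and with the weight
  included this is convergence in a seminorm of order N.\<close>

lemma weighted_translates_integrable:
  fixes f k :: "real^'n::finite \<Rightarrow> complex"
  assumes f: "continuous_on UNIV f" and k: "k \<in> schwartz"
  shows "\<exists>G. G integrable_on cbox a b \<and>
     (\<forall>y z. apply_bcontfun (G y) z = (1 + norm z) ^ N *\<^sub>R (f y * k (z - y)))"
proof -
  obtain L where L: "L > 0" "\<And>z y y'. (1 + norm z) ^ N * norm (k (z - y) - k (z - y')) \<le> L * norm (y - y') * (1 + norm y + norm y') ^ N"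
    using schwartz_weighted_lipschitz[OF k] by metis
  define S where "S = sw_sn N [] k"
  have kb: "(1 + norm z) ^ N * norm (k (z - y)) \<le> S * (1 + norm y) ^ N" for z y
    using sw_sn_shift[OF k, where \<alpha>="[]"] by (simp add: S_def)
  let ?g = "\<lambda>y z. (1 + norm z) ^ N *\<^sub>R (f y * k (z - y))"
  define G where "G = (\<lambda>y. Bcontfun (?g y))"
  have ck: "continuous_on UNIV (\<lambda>z. k (z - y))" for y
    by (intro rapid_continuous schwartz_rapid schwartz_shift k)
  have "?g y \<in> bcontfun" for y
  proof (rule bcontfun_normI)
    show "continuous_on UNIV (?g y)" by (intro continuous_intros ck)
    show "norm (?g y z) \<le> norm (f y) * (S * (1 + norm y) ^ N)" for z
      using mult_left_mono[OF kb[of z y], of "norm (f y)"] by (simp add: norm_mult mult_ac)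
  qed
  then have ap: "apply_bcontfun (G y) z = ?g y z" for y z
    by (simp add: G_def Bcontfun_inverse)
  have dist: "dist (G y) (G y') \<le> norm (f y - f y') * (S * (1 + norm y') ^ N) + norm (f y) * (L * norm (y - y') * (1 + norm y + norm y') ^ N)" for y y'
  proof (rule dist_bound)
    fix z
    have "dist (G y z) (G y' z) = (1 + norm z) ^ N * norm ((f y - f y') * k (z - y') + f y * (k (z - y) - k (z - y')))"
      unfolding ap dist_norm scaleR_diff_right[symmetric] norm_scaleR by (simp add: algebra_simps)
    also have "\<dots> \<le> (1 + norm z) ^ N * (norm (f y - f y') * norm (k (z - y')) + norm (f y) * norm (k (z - y) - k (z - y')))"
      by (intro mult_left_mono order_trans[OF norm_triangle_ineq]) (auto simp: norm_mult)
    also have "\<dots> = norm (f y - f y') * ((1 + norm z) ^ N * norm (k (z - y'))) + norm (f y) * ((1 + norm z) ^ N * norm (k (z - y) - k (z - y')))"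
      by (simp add: algebra_simps)
    also have "\<dots> \<le> norm (f y - f y') * (S * (1 + norm y') ^ N) + norm (f y) * (L * norm (y - y') * (1 + norm y + norm y') ^ N)"
      by (intro add_mono mult_left_mono kb L) auto
    finally show "dist (G y z) (G y' z) \<le> norm (f y - f y') * (S * (1 + norm y') ^ N) + norm (f y) * (L * norm (y - y') * (1 + norm y + norm y') ^ N)" .
  qed
  have "(G \<longlongrightarrow> G y') (at y')" for y'
  proof (rule tendsto_dist_iff[THEN iffD2])
    show "((\<lambda>y. dist (G y) (G y')) \<longlongrightarrow> 0) (at y')"
    proof (rule Lim_null_comparison[OF always_eventually])
      show "\<forall>y. norm (dist (G y) (G y')) \<le> norm (f y - f y') * (S * (1 + norm y') ^ N) + norm (f y) * (L * norm (y - y') * (1 + norm y + norm y') ^ N)"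
        using dist by simp
      have "(f \<longlongrightarrow> f y') (at y')" using f by (simp add: continuous_on_def)
      then have "((\<lambda>y. norm (f y - f y') * (S * (1 + norm y') ^ N) + norm (f y) * (L * norm (y - y') * (1 + norm y + norm y') ^ N)) \<longlongrightarrow>
        norm (f y' - f y') * (S * (1 + norm y') ^ N) + norm (f y') * (L * norm (y' - y') * (1 + norm y' + norm y') ^ N)) (at y')"
        by (intro tendsto_intros)
      then show "((\<lambda>y. norm (f y - f y') * (S * (1 + norm y') ^ N) + norm (f y) * (L * norm (y - y') * (1 + norm y + norm y') ^ N)) \<longlongrightarrow> 0) (at y')"
        by simp
    qed
  qed
  then have "continuous_on (cbox a b) G"
    by (meson continuous_on_def tendsto_within_subset subset_UNIV)
  then have "G integrable_on cbox a b" by (rule integrable_continuous)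
  with ap show ?thesis by blast
qed

lemma bounded_linear_apply_bcontfun: "bounded_linear (\<lambda>g. apply_bcontfun g z)"
  for z :: "'a::topological_space"
  by (rule bounded_linear_intro[where K=1]) (auto simp: norm_bounded)

text \<open>Dominated convergence along growing cubes. The Riemann sums live on a box, so the rest
  of the space must contribute little.\<close>

lemma cbox_exhaust_tail:
  fixes g :: "'a::euclidean_space \<Rightarrow> real"
  assumes g: "integrable lborel g" and e: "e > 0"
  obtains a b where "(LINT y|lborel. indicator (- cbox a b) y * g y) < e"
proof -
  have [measurable]: "g \<in> borel_measurable borel" using g by (auto simp: integrable_iff_bounded)
  let ?b = "\<lambda>m. cbox (- real m *\<^sub>R One) (real m *\<^sub>R One) :: 'a set"
  have "(\<lambda>m. LINT y|lborel. indicator (- ?b m) y * g y) \<longlonglongrightarrow> (LINT y|lborel. 0 * g y)"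
  proof (rule integral_dominated_convergence[where w="\<lambda>y. \<bar>g y\<bar>"])
    show "AE y in lborel. (\<lambda>m. indicator (- ?b m) y * g y) \<longlonglongrightarrow> 0 * g y"
    proof (rule AE_I2, rule tendsto_mult[OF tendsto_eventually tendsto_const])
      fix y :: 'a
      obtain m0 :: nat where m0: "norm y \<le> real m0" using real_arch_simple by blast
      show "\<forall>\<^sub>F m in sequentially. indicator (- ?b m) y = (0::real)"
        using eventually_ge_at_top[of m0]
      proof eventually_elim
        case (elim m)
        have "y \<in> ?b m"
          unfolding mem_box
        proof (intro ballI)
          fix i :: 'a assume i: "i \<in> Basis"
          then have "\<bar>y \<bullet> i\<bar> \<le> real m" using Basis_le_norm[OF i, of y] m0 elim by simp
          then show "(- real m *\<^sub>R One) \<bullet> i \<le> y \<bullet> i \<and> y \<bullet> i \<le> (real m *\<^sub>R One) \<bullet> i"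
            using i by (auto simp: abs_le_iff)
        qed
        then show ?case by simp
      qed
    qed
    show "AE y in lborel. norm (indicator (- ?b m) y * g y) \<le> \<bar>g y\<bar>" for m
      by (intro AE_I2) (auto simp: indicator_def)
  qed (use g in auto)
  then have "\<forall>\<^sub>F m in sequentially. (LINT y|lborel. indicator (- ?b m) y * g y) < e"
    using e by (auto dest: order_tendstoD(2))
  then obtain m where "(LINT y|lborel. indicator (- ?b m) y * g y) < e"
    using eventually_happens'[OF sequentially_bot] by blast
  then show ?thesis by (rule that)
qed

text \<open>A Riemann sum argument: in every seminorm, \<open>convol f k\<close> is approximated by finite linear combinations
  of translates of \<open>k\<close>.\<close>

lemma tempered_convol:
  fixes T :: "'n::finite distr"
  assumes T: "T \<in> tempered" and f: "rapid f" and k: "k \<in> schwartz"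
  shows "T (convol f k) = (LINT y|lborel. f y * T (\<lambda>z. k (z - y)))"
proof -
  obtain C N where C: "C \<ge> 0" "\<And>f. f \<in> schwartz \<Longrightarrow> norm (T f) \<le> C * (\<Sum>\<alpha>\<in>{\<alpha>. length \<alpha> \<le> N}. sw_sn N \<alpha> f)"
    using temperedE[OF T] by metis
  obtain B M where B: "B \<ge> 0" "\<And>y. norm (T (\<lambda>z. k (z - y))) \<le> B * (1 + norm y) ^ M"
    using tempered_shift_bound[OF T k] by metis
  define \<tau> where "\<tau> = (\<lambda>y. T (\<lambda>z. k (z - y)))"
  have tc: "continuous_on UNIV \<tau>" unfolding \<tau>_def by (rule tempered_shift_continuous[OF T k])
  have fc: "continuous_on UNIV f" using f by (rule rapid_continuous)
  have [measurable]: "f \<in> borel_measurable borel" "\<tau> \<in> borel_measurable borel"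
    "k \<in> borel_measurable borel" "\<And>\<alpha>. pdl \<alpha> k \<in> borel_measurable borel"
    using fc tc k by (auto intro: borel_measurable_continuous_onI rapid_measurable schwartz_rapid schwartz_pdl)
  define A where "A = {\<alpha>::'n list. length \<alpha> \<le> N}"
  have A: "finite A" by (simp add: A_def)
  define g where "g = (\<lambda>y. (1 + norm y) ^ (N + M) * norm (f y))"
  have gi: "integrable lborel g" unfolding g_def by (intro rapid_weight_integrable f)
  have g1: "(1 + norm y) ^ N * norm (f y) \<le> g y" "(1 + norm y) ^ M * norm (f y) \<le> g y" for y
    unfolding g_def by (intro mult_right_mono power_increasing; simp)+
  have fti: "integrable lborel (\<lambda>y. f y * \<tau> y)"
  proof (rule Bochner_Integration.integrable_bound)
    show "integrable lborel (\<lambda>y. B * g y)" by (intro integrable_mult_right gi)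
    have "norm (f y * \<tau> y) \<le> B * g y" for y
    proof -
      have "norm (f y * \<tau> y) \<le> norm (f y) * (B * (1 + norm y) ^ M)"
        unfolding norm_mult \<tau>_def by (intro mult_left_mono B) auto
      also have "\<dots> = B * ((1 + norm y) ^ M * norm (f y))" by simp
      also have "\<dots> \<le> B * g y" by (intro mult_left_mono g1 B)
      finally show ?thesis .
    qed
    then show "AE y in lborel. norm (f y * \<tau> y) \<le> norm (B * g y)"
      by (intro AE_I2) (metis norm_ge_zero order_trans abs_ge_self real_norm_def)
  qed measurable
  \<comment> \<open>The parts collect the seminorm error of the Riemann sum together with its tail,
    the Riemann error of the scalar integral, and the tail of the latter, bounded through B.\<close>
  define Q where "Q = C * (\<Sum>\<alpha>\<in>A. sw_sn N \<alpha> k + 1) + (1 + B)"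
  have Q: "Q > 0" unfolding Q_def using C B k
    by (intro add_nonneg_pos mult_nonneg_nonneg sum_nonneg add_nonneg_nonneg sw_sn_nonneg add_pos_nonneg) auto
  have main: "norm (T (convol f k) - (LINT y|lborel. f y * \<tau> y)) \<le> Q * e" if e: "e > 0" for e
  proof -
    obtain lo hi where tail: "(LINT y|lborel. indicator (- cbox lo hi) y * g y) < e"
      using cbox_exhaust_tail[OF gi e] by metis
    define b where "b = cbox lo hi"
    have [measurable]: "b \<in> sets borel" by (simp add: b_def)
    have split: "(LINT y|lborel. u y) = (LINT y|lborel. indicator (- b) y *\<^sub>R u y) + integral b u"
      and int: "integrable lborel (\<lambda>y. indicator (- b) y *\<^sub>R u y)"
      if "integrable lborel u" for u :: "real^'n \<Rightarrow> complex"
    proof -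
      have i: "integrable lborel (\<lambda>y. indicator c y *\<^sub>R u y)" if "c \<in> sets borel" for c
        using that \<open>integrable lborel u\<close> by (intro integrable_mult_indicator) auto
      then show "integrable lborel (\<lambda>y. indicator (- b) y *\<^sub>R u y)" by simp
      have "integral b u = (LINT y|lborel. indicator b y *\<^sub>R u y)"
        using set_borel_integral_eq_integral(2)[of b u] i[of b] by (simp add: set_integrable_def set_lebesgue_integral_def)
      moreover have "(LINT y|lborel. indicator (- b) y *\<^sub>R u y) + (LINT y|lborel. indicator b y *\<^sub>R u y) = (LINT y|lborel. u y)"
      proof -
        have "(LINT y|lborel. u y) = (LINT y|lborel. indicator (- b) y *\<^sub>R u y + indicator b y *\<^sub>R u y)"
          by (intro Bochner_Integration.integral_cong) (auto simp: indicator_def)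
        also have "\<dots> = (LINT y|lborel. indicator (- b) y *\<^sub>R u y) + (LINT y|lborel. indicator b y *\<^sub>R u y)"
          by (rule Bochner_Integration.integral_add[OF i i]) auto
        finally show ?thesis by simp
      qed
      ultimately show "(LINT y|lborel. u y) = (LINT y|lborel. indicator (- b) y *\<^sub>R u y) + integral b u" by simp
    qed
    have tail_le: "norm (LINT y|lborel. indicator (- b) y *\<^sub>R u y) \<le> D * e"
      if u: "integrable lborel u" "\<And>y. norm (u y) \<le> D * g y" "D \<ge> 0" for u :: "real^'n \<Rightarrow> complex" and D
    proof -
      have "norm (LINT y|lborel. indicator (- b) y *\<^sub>R u y) \<le> (LINT y|lborel. norm (indicator (- b) y *\<^sub>R u y))"
        by (rule integral_norm_bound)
      also have "\<dots> \<le> (LINT y|lborel. D * (indicator (- b) y * g y))"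
      proof (rule integral_mono)
        show "integrable lborel (\<lambda>y. norm (indicator (- b) y *\<^sub>R u y))" by (intro integrable_norm int u)
        have "integrable lborel (\<lambda>y. indicator (- b) y *\<^sub>R g y)"
          by (intro integrable_mult_indicator gi) simp
        then show "integrable lborel (\<lambda>y. D * (indicator (- b) y * g y))" by simp
      qed (use u(2) in \<open>auto simp: indicator_def\<close>)
      also have "\<dots> = D * (LINT y|lborel. indicator (- b) y * g y)" by simp
      also have "\<dots> \<le> D * e" using tail u(3) by (intro mult_left_mono) (auto simp: b_def)
      finally show ?thesis .
    qed
    have "\<forall>\<alpha>. \<exists>G. G integrable_on b \<and> (\<forall>y z. apply_bcontfun (G y) z = (1 + norm z) ^ N *\<^sub>R (f y * pdl \<alpha> k (z - y)))"
      unfolding b_def using weighted_translates_integrable[OF fc schwartz_pdl[OF k]] by blast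
    then obtain G where Gi: "\<And>\<alpha>. G \<alpha> integrable_on b"
      and G: "\<And>\<alpha> y z. apply_bcontfun (G \<alpha> y) z = (1 + norm z) ^ N *\<^sub>R (f y * pdl \<alpha> k (z - y))"
      by metis
    \<comment> \<open>One tagged division must be fine enough for the finitely many \<alpha> in A
      and for the scalar integral simultaneously; along a filter the finitely many conditions can be
      intersected.\<close>
    let ?F = "division_filter b"
    have ev1: "\<forall>\<^sub>F p in ?F. norm ((\<Sum>(y, K)\<in>p. measure lborel K *\<^sub>R G \<alpha> y) - integral b (G \<alpha>)) < e" for \<alpha>
      using tendstoD[OF integrable_integral[OF Gi[of \<alpha>], unfolded b_def has_integral_cbox] e]
      unfolding b_def dist_norm .
    have hti: "(\<lambda>y. f y * \<tau> y) integrable_on b"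
      unfolding b_def using fc tc by (intro integrable_continuous continuous_on_mult) (auto intro: continuous_on_subset)
    have ev2: "\<forall>\<^sub>F p in ?F. norm ((\<Sum>(y, K)\<in>p. measure lborel K *\<^sub>R (f y * \<tau> y)) - integral b (\<lambda>y. f y * \<tau> y)) < e"
      using tendstoD[OF integrable_integral[OF hti, unfolded b_def has_integral_cbox] e]
      unfolding b_def dist_norm .
    have "\<forall>\<^sub>F p in ?F. (\<forall>\<alpha>\<in>A. norm ((\<Sum>(y, K)\<in>p. measure lborel K *\<^sub>R G \<alpha> y) - integral b (G \<alpha>)) < e) \<and>
       norm ((\<Sum>(y, K)\<in>p. measure lborel K *\<^sub>R (f y * \<tau> y)) - integral b (\<lambda>y. f y * \<tau> y)) < e \<and> p tagged_division_of b"
      using ev1 ev2 by (intro eventually_conj eventually_ball_finite A ballI eventually_division_filter_tagged_division)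
    then obtain p where p1: "\<And>\<alpha>. \<alpha> \<in> A \<Longrightarrow> norm ((\<Sum>(y, K)\<in>p. measure lborel K *\<^sub>R G \<alpha> y) - integral b (G \<alpha>)) < e"
      and p2: "norm ((\<Sum>(y, K)\<in>p. measure lborel K *\<^sub>R (f y * \<tau> y)) - integral b (\<lambda>y. f y * \<tau> y)) < e"
      and p3: "p tagged_division_of b"
      using eventually_happens'[of ?F] division_filter_not_empty unfolding b_def by blast
    define r where "r = (\<lambda>(q::(real^'n) \<times> (real^'n) set) z. (complex_of_real (measure lborel (snd q)) * f (fst q)) * k (z - fst q))"
    have r: "r q \<in> schwartz" for q unfolding r_def by (intro schwartz_cmult schwartz_shift k)
    have pr: "pdl \<alpha> (r q) = (\<lambda>z. (complex_of_real (measure lborel (snd q)) * f (fst q)) * pdl \<alpha> k (z - fst q))" for \<alpha> q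
      unfolding r_def by (simp add: pdl_cmult[OF schwartz_shift[OF k]] pdl_shift[OF k])
    define R where "R = (\<lambda>z. \<Sum>q\<in>p. r q z)"
    have R: "R \<in> schwartz" unfolding R_def by (intro schwartz_sum r)
    have TR: "T R = (\<Sum>(y, K)\<in>p. measure lborel K *\<^sub>R (f y * \<tau> y))"
    proof -
      have "T R = (\<Sum>q\<in>p. T (r q))" unfolding R_def by (rule tempered_sum[OF T r])
      also have "\<dots> = (\<Sum>(y, K)\<in>p. measure lborel K *\<^sub>R (f y * \<tau> y))"
        by (intro sum.cong refl)
          (auto simp: r_def tempered_cmult[OF T schwartz_shift[OF k]] \<tau>_def scaleR_conv_of_real split_beta)
      finally show ?thesis .
    qed
    have cvs: "convol f k \<in> schwartz" by (intro schwartz_convol f k)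
    have sn: "sw_sn N \<alpha> (\<lambda>z. convol f k z - R z) \<le> (sw_sn N \<alpha> k + 1) * e" if "\<alpha> \<in> A" for \<alpha>
    proof (rule sw_sn_le)
      fix z :: "real^'n"
      let ?W = "(1 + norm z) ^ N" and ?k = "pdl \<alpha> k"
      let ?u = "\<lambda>y. ?W *\<^sub>R (f y * ?k (z - y))"
      have ui: "integrable lborel ?u"
        by (intro integrable_scaleR_right rapid_mult_shift_integrable f schwartz_rapid schwartz_pdl k)
      have ub: "norm (?u y) \<le> sw_sn N \<alpha> k * g y" for y
      proof -
        have "norm (?u y) = norm (f y) * (?W * norm (?k (z - y)))" by (simp add: norm_mult)
        also have "\<dots> \<le> norm (f y) * (sw_sn N \<alpha> k * (1 + norm y) ^ N)"
          by (intro mult_left_mono sw_sn_shift k) auto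
        also have "\<dots> = sw_sn N \<alpha> k * ((1 + norm y) ^ N * norm (f y))" by simp
        also have "\<dots> \<le> sw_sn N \<alpha> k * g y" by (intro mult_left_mono g1 sw_sn_nonneg k)
        finally show ?thesis .
      qed
      \<comment> \<open>Evaluation at z is bounded and linear, so it commutes with the integral of
        the curve and with its Riemann sum; the error at z is then at most the error in supremum
        norm.\<close>
      have bl: "bounded_linear (\<lambda>w. apply_bcontfun w z)" by (rule bounded_linear_apply_bcontfun)
      have ib: "integral b ?u = apply_bcontfun (integral b (G \<alpha>)) z"
        using integral_linear[OF Gi[of \<alpha>] bl] by (simp add: comp_def G)
      have sb: "apply_bcontfun (\<Sum>(y, K)\<in>p. measure lborel K *\<^sub>R G \<alpha> y) z = ?W *\<^sub>R pdl \<alpha> R z"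
      proof -
        have "apply_bcontfun (\<Sum>q\<in>p. measure lborel (snd q) *\<^sub>R G \<alpha> (fst q)) z = (\<Sum>q\<in>p. measure lborel (snd q) *\<^sub>R ?W *\<^sub>R (f (fst q) * ?k (z - fst q)))"
          by (simp add: linear_sum[OF bounded_linear.linear[OF bl]] G)
        also have "\<dots> = ?W *\<^sub>R (\<Sum>q\<in>p. pdl \<alpha> (r q) z)"
          unfolding scaleR_sum_right pr by (intro sum.cong refl) (simp add: scaleR_conv_of_real mult_ac)
        also have "(\<Sum>q\<in>p. pdl \<alpha> (r q) z) = pdl \<alpha> R z"
          unfolding R_def by (subst schwartz_sum(2)) (auto intro: r)
        finally show ?thesis by (simp add: split_beta)
      qed
      have "?W *\<^sub>R pdl \<alpha> (\<lambda>z. convol f k z - R z) z = (LINT y|lborel. ?u y) - ?W *\<^sub>R pdl \<alpha> R z"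
        unfolding pdl_diff[OF cvs R] pdl_convol[OF f k] convol_def[of f ?k] by (simp add: scaleR_diff_right)
      also have "\<dots> = (LINT y|lborel. indicator (- b) y *\<^sub>R ?u y) - apply_bcontfun ((\<Sum>(y, K)\<in>p. measure lborel K *\<^sub>R G \<alpha> y) - integral b (G \<alpha>)) z"
        unfolding split[OF ui] ib sb[symmetric] by simp
      finally have "?W * norm (pdl \<alpha> (\<lambda>z. convol f k z - R z) z) =
          norm ((LINT y|lborel. indicator (- b) y *\<^sub>R ?u y) - apply_bcontfun ((\<Sum>(y, K)\<in>p. measure lborel K *\<^sub>R G \<alpha> y) - integral b (G \<alpha>)) z)"
        by (metis (no_types, lifting) norm_scaleR abs_of_nonneg zero_le_power add_nonneg_nonneg norm_ge_zero zero_le_one)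
      also have "\<dots> \<le> norm (LINT y|lborel. indicator (- b) y *\<^sub>R ?u y) + norm (apply_bcontfun ((\<Sum>(y, K)\<in>p. measure lborel K *\<^sub>R G \<alpha> y) - integral b (G \<alpha>)) z)"
        by (rule norm_triangle_ineq4)
      also have "\<dots> \<le> sw_sn N \<alpha> k * e + e"
      proof (rule add_mono)
        show "norm (LINT y|lborel. indicator (- b) y *\<^sub>R ?u y) \<le> sw_sn N \<alpha> k * e"
          by (intro tail_le ui ub sw_sn_nonneg k)
        show "norm (apply_bcontfun ((\<Sum>(y, K)\<in>p. measure lborel K *\<^sub>R G \<alpha> y) - integral b (G \<alpha>)) z) \<le> e"
          using norm_bounded p1[OF \<open>\<alpha> \<in> A\<close>] by (rule order_trans[OF _ less_imp_le])
      qed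
      finally show "?W * norm (pdl \<alpha> (\<lambda>z. convol f k z - R z) z) \<le> (sw_sn N \<alpha> k + 1) * e"
        by (simp add: distrib_right)
    qed
    have t1: "norm (T (convol f k) - T R) \<le> C * (\<Sum>\<alpha>\<in>A. sw_sn N \<alpha> k + 1) * e"
    proof -
      have "norm (T (convol f k) - T R) = norm (T (\<lambda>z. convol f k z - R z))" using tempered_diff[OF T cvs R] by simp
      also have "\<dots> \<le> C * (\<Sum>\<alpha>\<in>A. sw_sn N \<alpha> (\<lambda>z. convol f k z - R z))"
        unfolding A_def by (intro C schwartz_diff cvs R)
      also have "\<dots> \<le> C * (\<Sum>\<alpha>\<in>A. (sw_sn N \<alpha> k + 1) * e)" by (intro mult_left_mono sum_mono sn C)
      finally show ?thesis by (simp add: sum_distrib_right mult.assoc)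
    qed
    have t2: "norm (integral b (\<lambda>y. f y * \<tau> y) - (LINT y|lborel. f y * \<tau> y)) \<le> B * e"
    proof -
      have "norm (LINT y|lborel. indicator (- b) y *\<^sub>R (f y * \<tau> y)) \<le> B * e"
      proof (rule tail_le[OF fti _ B(1)])
        fix y
        have "norm (f y * \<tau> y) \<le> norm (f y) * (B * (1 + norm y) ^ M)"
          unfolding norm_mult \<tau>_def by (intro mult_left_mono B) auto
        also have "\<dots> = B * ((1 + norm y) ^ M * norm (f y))" by simp
        also have "\<dots> \<le> B * g y" by (intro mult_left_mono g1 B)
        finally show "norm (f y * \<tau> y) \<le> B * g y" .
      qed
      then show ?thesis unfolding split[OF fti] by (simp add: norm_minus_commute)
    qed
    have "norm (T (convol f k) - (LINT y|lborel. f y * \<tau> y)) \<le> norm (T (convol f k) - T R)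
       + (norm (T R - integral b (\<lambda>y. f y * \<tau> y)) + norm (integral b (\<lambda>y. f y * \<tau> y) - (LINT y|lborel. f y * \<tau> y)))"
      by (smt (verit) norm_triangle_ineq diff_add_cancel add_diff_eq)
    also have "\<dots> \<le> C * (\<Sum>\<alpha>\<in>A. sw_sn N \<alpha> k + 1) * e + (e + B * e)"
      using t1 t2 p2 by (intro add_mono) (auto simp: TR)
    finally show ?thesis by (simp add: Q_def algebra_simps)
  qed
  have "norm (T (convol f k) - (LINT y|lborel. f y * \<tau> y)) \<le> 0"
  proof (rule field_le_epsilon)
    fix e :: real assume "e > 0"
    then show "norm (T (convol f k) - (LINT y|lborel. f y * \<tau> y)) \<le> 0 + e"
      using main[of "e / Q"] Q by simp
  qed
  then show ?thesis by (simp add: \<tau>_def)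
qed

section \<open>Littlewood-Paley resolutions\<close>

text \<open>For continuous g the set where the bound fails is open; if it were non-empty it would
  have positive measure.\<close>

lemma norm_le_Lp_top:
  fixes g :: "real^'n::finite \<Rightarrow> complex"
  assumes g: "continuous_on UNIV g" and L: "Lp_en top g \<le> ennreal L" "L \<ge> 0"
  shows "norm (g x) \<le> L"
proof (rule ccontr)
  assume "\<not> norm (g x) \<le> L"
  define U where "U = {y. norm (g y) > L}"
  have o: "open U" unfolding U_def
    using g by (intro open_Collect_less continuous_intros) auto
  have "x \<in> U" using \<open>\<not> norm (g x) \<le> L\<close> by (simp add: U_def)
  have "AE y in lborel. ennreal (norm (g y)) \<le> ennreal L"
    using esssup_AE[of "\<lambda>y. ennreal (norm (g y))" lborel] L(1)
    unfolding Lp_en_def by (auto elim!: eventually_mono)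
  then have "AE y in lborel. y \<notin> U" using L(2) by (auto simp: U_def elim!: eventually_mono)
  then have "U \<in> null_sets lborel" using o by (subst (asm) AE_iff_null_sets[symmetric]) auto
  then have "negligible U" by (simp add: negligible_iff_null_sets null_sets_completionI)
  then show False using open_not_negligible[OF o] \<open>x \<in> U\<close> by auto
qed

lemma powr_integrable_of_Lp:
  fixes g :: "real^'n::finite \<Rightarrow> complex"
  assumes g: "continuous_on UNIV g" and p: "0 < p" and L: "Lp_en (ennreal p) g \<le> ennreal L" "L > 0"
  shows "integrable lborel (\<lambda>y. norm (g y) powr p)" "(LINT y|lborel. norm (g y) powr p) \<le> L powr p"
proof -
  have [measurable]: "g \<in> borel_measurable borel" using g by (rule borel_measurable_continuous_onI)
  have *: "(\<integral>\<^sup>+y. ennreal (norm (g y) powr p) \<partial>lborel) \<le> ennreal (L powr p)"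
    using L Lnorm_le_iff[of "ennreal p" L lborel "\<lambda>y. ennreal (norm (g y))"] p
    by (simp add: Lp_en_eq_Lnorm enn_powr_ennreal)
  show "integrable lborel (\<lambda>y. norm (g y) powr p)"
    by (rule integrableI_bounded) (use * in \<open>auto simp: less_top[symmetric] top_unique\<close>)
  show "(LINT y|lborel. norm (g y) powr p) \<le> L powr p"
    using * by (intro integral_real_bounded) auto
qed

text \<open>The bound follows by absorbing \<open>S powr (1 - p)\<close>, where \<open>S\<close> is a weighted supremum of \<open>g\<close>. The weight
  makes \<open>S\<close> finite a priori; a second application with \<open>N = 0\<close> removes it from the constant \<open>A\<close>.\<close>

lemma reproducing_sup_bound_lt1:
  fixes g \<psi> :: "real^'n::finite \<Rightarrow> complex"
  assumes \<psi>: "rapid \<psi>" and A: "A > 0" "\<And>z. (1 + norm z) ^ N * norm (\<psi> z) \<le> A"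
    and g: "continuous_on UNIV g" "\<And>x. norm (g x) \<le> B * (1 + norm x) ^ N"
    and rep: "\<And>x. g x = (LINT y|lborel. \<psi> (x - y) * g y)"
    and p: "0 < p" "p < 1" and L: "Lp_en (ennreal p) g \<le> ennreal L" "L > 0"
  shows "norm (g x0) \<le> A powr (1/p) * L"
proof -
  have [measurable]: "g \<in> borel_measurable borel" "\<psi> \<in> borel_measurable borel"
    using g(1) \<psi> by (auto intro: borel_measurable_continuous_onI rapid_measurable)
  note P = powr_integrable_of_Lp[OF g(1) p(1) L]
  define v where "v = (\<lambda>x. norm (g x) / (1 + norm (x - x0)) ^ N)"
  have pos: "(1 + norm w) ^ N > 0" for w :: "real^'n" by (simp add: add_pos_nonneg)
  have v0: "v x \<ge> 0" for x using pos by (simp add: v_def)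
  have B: "B \<ge> 0" using order_trans[OF norm_ge_zero g(2)[of 0]] by simp
  have vb: "v x \<le> B * (1 + norm x0) ^ N" for x
  proof -
    have "norm (g x) \<le> B * ((1 + norm x0) ^ N * (1 + norm (x - x0)) ^ N)"
      by (rule order_trans[OF g(2)]) (intro mult_left_mono norm_split_weight B)
    then show ?thesis using pos[of "x - x0"] by (simp add: v_def pos_divide_le_eq mult_ac)
  qed
  define S where "S = (SUP x. v x)"
  have bdd: "bdd_above (range v)" using vb by (auto intro!: bdd_aboveI2)
  have vS: "v x \<le> S" for x unfolding S_def by (rule cSUP_upper[OF UNIV_I bdd])
  have gx0: "norm (g x0) \<le> S" using vS[of x0] by (simp add: v_def)
  show ?thesis
  proof (cases "S = 0")
    case True
    then show ?thesis using gx0 A L by simp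
  next
    case False
    then have S: "S > 0" using vS[of x0] v0[of x0] by linarith
    have "v x \<le> A * S powr (1 - p) * L powr p" for x
    proof -
      let ?w = "A * S powr (1 - p) * (1 + norm (x - x0)) ^ N"
      \<comment> \<open>The power 1 - p of the weighted value \<open>v y\<close> is bounded through
        S, and only the power p is left for integration. The weight at y is split between
        \<open>x - x0\<close> and \<open>x - y\<close>; the second part is absorbed by
        \<open>\<psi>\<close>.\<close>
      have pt: "norm (\<psi> (x - y) * g y) \<le> ?w * norm (g y) powr p" for y
      proof -
        have gv: "norm (g y) = v y * (1 + norm (y - x0)) ^ N" using less_imp_neq[OF pos[of "y - x0"]] by (auto simp: v_def)
        have "v y = v y powr (1 - p) * v y powr p"
        proof (cases "v y = 0")
          case False
          then show ?thesis using v0[of y] by (simp add: powr_add[symmetric])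
        qed (use p in auto)
        also have "\<dots> \<le> S powr (1 - p) * v y powr p"
          using p v0 vS by (intro mult_right_mono powr_mono2) auto
        also have "\<dots> \<le> S powr (1 - p) * norm (g y) powr p"
        proof (rule mult_left_mono)
          have "norm (g y) / (1 + norm (y - x0)) ^ N \<le> norm (g y) / 1"
            by (intro divide_left_mono) (auto intro: one_le_power simp: add_pos_nonneg)
          then show "v y powr p \<le> norm (g y) powr p" using p v0[of y] by (intro powr_mono2) (auto simp: v_def)
        qed simp
        finally have v1: "v y \<le> S powr (1 - p) * norm (g y) powr p" .
        have "(1 + norm (y - x0)) ^ N \<le> (1 + norm (x - x0)) ^ N * (1 + norm (x - y)) ^ N"
          using norm_split_weight[of "y - x0" N "x - x0"] by (simp add: norm_minus_commute)
        then have "norm (\<psi> (x - y) * g y) \<le> norm (\<psi> (x - y)) * (v y * ((1 + norm (x - x0)) ^ N * (1 + norm (x - y)) ^ N))"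
          unfolding norm_mult gv by (intro mult_left_mono v0) auto
        also have "\<dots> = ((1 + norm (x - y)) ^ N * norm (\<psi> (x - y))) * (v y * (1 + norm (x - x0)) ^ N)"
          by (simp add: mult_ac)
        also have "\<dots> \<le> A * ((S powr (1 - p) * norm (g y) powr p) * (1 + norm (x - x0)) ^ N)"
          using A v1 v0 by (intro mult_mono) auto
        finally show ?thesis by (simp add: mult_ac)
      qed
      have i: "integrable lborel (\<lambda>y. ?w * norm (g y) powr p)" by (intro integrable_mult_right P)
      have "norm (g x) \<le> (LINT y|lborel. norm (\<psi> (x - y) * g y))"
        by (subst rep) (rule integral_norm_bound)
      also have "\<dots> \<le> (LINT y|lborel. ?w * norm (g y) powr p)"
        using pt by (intro integral_mono i Bochner_Integration.integrable_bound[OF i])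
          (auto intro!: AE_I2 intro: order_trans[OF _ abs_ge_self])
      also have "\<dots> = ?w * (LINT y|lborel. norm (g y) powr p)" by simp
      also have "\<dots> \<le> ?w * L powr p" using A by (intro mult_left_mono P) auto
      finally show ?thesis using pos[of "x - x0"] by (simp add: v_def pos_divide_le_eq mult_ac)
    qed
    then have "S \<le> A * S powr (1 - p) * L powr p" unfolding S_def by (intro cSUP_least) auto
    also have "S = S powr (1 - p) * S powr p" using S by (simp add: powr_add[symmetric])
    finally have "S powr (1 - p) * S powr p \<le> S powr (1 - p) * (A * L powr p)" using S by (simp add: mult_ac powr_add[symmetric])
    then have "S powr p \<le> A * L powr p" using S by simp
    then have "(S powr p) powr (1/p) \<le> (A * L powr p) powr (1/p)" using p by (intro powr_mono2) auto
    then have "S \<le> A powr (1/p) * L" using p S A L by (simp add: powr_powr powr_mult)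
    then show ?thesis using gx0 by simp
  qed
qed

text \<open>Hoelder's inequality is replaced by a splitting of g at height l:
  \<open>norm (g y) \<le> l + l powr (1 - p) * norm (g y) powr p\<close>. The first term meets the
  integral of \<open>\<psi>\<close>, the second its bound A, and \<open>l = A powr (1/p) * L\<close>
  is chosen so that the second contributes at most l.\<close>

lemma reproducing_sup_bound_ge1:
  fixes g \<psi> :: "real^'n::finite \<Rightarrow> complex"
  assumes \<psi>: "rapid \<psi>" and A: "A > 0" "\<And>z. norm (\<psi> z) \<le> A" and A1: "(LINT z|lborel. norm (\<psi> z)) \<le> A1"
    and g: "continuous_on UNIV g"
    and rep: "\<And>x. g x = (LINT y|lborel. \<psi> (x - y) * g y)"
    and p: "1 \<le> p" and L: "Lp_en (ennreal p) g \<le> ennreal L" "L > 0"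
  shows "norm (g x) \<le> (1 + A1) * A powr (1/p) * L"
proof -
  have [measurable]: "g \<in> borel_measurable borel" "\<psi> \<in> borel_measurable borel"
    using g \<psi> by (auto intro: borel_measurable_continuous_onI rapid_measurable)
  have p0: "0 < p" using p by simp
  note P = powr_integrable_of_Lp[OF g p0 L]
  define l where "l = A powr (1/p) * L"
  have l: "l > 0" using A L by (simp add: l_def)
  have y1: "norm (g y) \<le> l + l powr (1 - p) * norm (g y) powr p" for y
  proof (cases "norm (g y) \<le> l")
    case True
    then show ?thesis by (simp add: add_increasing2)
  next
    case False
    then have "norm (g y) = norm (g y) powr (1 - p) * norm (g y) powr p"
      using l by (simp add: powr_add[symmetric])
    also have "\<dots> \<le> l powr (1 - p) * norm (g y) powr p"
      using False l p by (intro mult_right_mono powr_mono2') auto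
    finally show ?thesis using l by linarith
  qed
  have pt: "norm (\<psi> (x - y) * g y) \<le> l * norm (\<psi> (x - y)) + A * l powr (1 - p) * norm (g y) powr p" for y
  proof -
    have "norm (\<psi> (x - y) * g y) \<le> norm (\<psi> (x - y)) * (l + l powr (1 - p) * norm (g y) powr p)"
      unfolding norm_mult by (intro mult_left_mono y1) auto
    also have "\<dots> = l * norm (\<psi> (x - y)) + norm (\<psi> (x - y)) * (l powr (1 - p) * norm (g y) powr p)"
      by (simp add: algebra_simps)
    also have "\<dots> \<le> l * norm (\<psi> (x - y)) + A * (l powr (1 - p) * norm (g y) powr p)"
      by (intro add_left_mono mult_right_mono A) auto
    finally show ?thesis by (simp add: mult_ac)
  qed
  have i1: "integrable lborel (\<lambda>y. norm (\<psi> (x - y)))"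
    by (intro rapid_norm_integrable rapid_reflect \<psi>)
  have i: "integrable lborel (\<lambda>y. l * norm (\<psi> (x - y)) + A * l powr (1 - p) * norm (g y) powr p)"
    by (intro Bochner_Integration.integrable_add integrable_mult_right P i1)
  have "norm (g x) \<le> (LINT y|lborel. norm (\<psi> (x - y) * g y))"
    by (subst rep) (rule integral_norm_bound)
  also have "\<dots> \<le> (LINT y|lborel. l * norm (\<psi> (x - y)) + A * l powr (1 - p) * norm (g y) powr p)"
    using pt by (intro integral_mono i Bochner_Integration.integrable_bound[OF i])
      (auto intro!: AE_I2 intro: order_trans[OF _ abs_ge_self])
  also have "\<dots> = l * (LINT y|lborel. norm (\<psi> (x - y))) + A * l powr (1 - p) * (LINT y|lborel. norm (g y) powr p)"
    using i1 P by simp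
  also have "(LINT y|lborel. norm (\<psi> (x - y))) = (LINT y|lborel. norm (\<psi> y))"
    using lborel_integral_affine[of "\<lambda>y. norm (\<psi> y)" "-1" x] by simp
  also have "l * (LINT y|lborel. norm (\<psi> y)) + A * l powr (1 - p) * (LINT y|lborel. norm (g y) powr p)
     \<le> l * A1 + A * l powr (1 - p) * L powr p"
    using l A by (intro add_mono mult_left_mono A1 P) auto
  also have "A * l powr (1 - p) * L powr p = l"
  proof -
    have "A * L powr p = l powr p" using A L p0 by (simp add: l_def powr_mult powr_powr)
    then have "A * l powr (1 - p) * L powr p = l powr (1 - p) * l powr p" by (simp add: mult_ac)
    then show ?thesis using l by (simp add: powr_add[symmetric])
  qed
  finally show ?thesis by (simp add: l_def algebra_simps)
qed

section \<open>Frequency multipliers and reproducing kernels\<close>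

locale resolution =
  fixes \<phi> :: "nat \<Rightarrow> real^'n::finite \<Rightarrow> complex"
  assumes adm: "admissible \<phi>"
begin

lemma phi_schwartz: "\<phi> j \<in> schwartz"
  using adm unfolding admissible_def by (cases "j = 0") auto

lemma phi_rapid: "rapid (\<phi> j)"
  by (rule schwartz_rapid[OF phi_schwartz])

lemma fourier_phi0_eq_1: "norm \<xi> \<le> 1 \<Longrightarrow> fourier (\<phi> 0) \<xi> = 1"
  using adm unfolding admissible_def by auto

text \<open>The closed support is compact in the open ball of radius 2, so the norm attains a
  maximum below 2 on it; a unit vector in the support shows that it is at least 1. The gap below 2
  is what leaves room for packets seen by one multiplier only.\<close>

lemma ex_support_radius: "\<exists>r. 1 \<le> r \<and> r < 2 \<and> (\<forall>\<xi>. fourier (\<phi> 0) \<xi> \<noteq> 0 \<longrightarrow> norm \<xi> \<le> r)"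
proof -
  let ?S = "closure {\<xi>. fourier (\<phi> 0) \<xi> \<noteq> 0}"
  have sub: "?S \<subseteq> ball 0 2" using adm unfolding admissible_def by auto
  have c: "compact ?S" using bounded_subset[OF bounded_ball sub] by (simp add: compact_eq_bounded_closed)
  have ne: "axis undefined 1 \<in> ?S"
    using fourier_phi0_eq_1[of "axis undefined 1"] by (auto intro!: subsetD[OF closure_subset] simp: norm_axis_1)
  have "\<exists>x\<in>?S. \<forall>y\<in>?S. norm y \<le> norm x"
  proof (rule continuous_attains_sup[OF c])
    show "?S \<noteq> {}" using ne by (metis empty_iff)
    show "continuous_on ?S norm" by (rule continuous_on_norm_id)
  qed
  then obtain x where x: "x \<in> ?S" "\<And>y. y \<in> ?S \<Longrightarrow> norm y \<le> norm x"
    by metis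
  show ?thesis
  proof (intro exI[of _ "norm x"] conjI allI impI)
    show "1 \<le> norm x" using x(2)[OF ne] by (simp add: norm_axis_1)
    show "norm x < 2" using x(1) sub by auto
    show "norm \<xi> \<le> norm x" if "fourier (\<phi> 0) \<xi> \<noteq> 0" for \<xi>
      using that by (intro x(2)) (auto intro!: subsetD[OF closure_subset])
  qed
qed

definition rho :: real where
  "rho = (SOME r. 1 \<le> r \<and> r < 2 \<and> (\<forall>\<xi>. fourier (\<phi> 0) \<xi> \<noteq> 0 \<longrightarrow> norm \<xi> \<le> r))"

lemma rho: "1 \<le> rho" "rho < 2" "norm \<xi> > rho \<Longrightarrow> fourier (\<phi> 0) \<xi> = 0"
  using someI_ex[OF ex_support_radius] unfolding rho_def[symmetric] by force+

lemma fourier_phi: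
  assumes "j \<ge> 1"
  shows "fourier (\<phi> j) \<xi> = fourier (\<phi> 0) ((1 / 2 ^ j) *\<^sub>R \<xi>) - fourier (\<phi> 0) ((2 / 2 ^ j) *\<^sub>R \<xi>)"
proof -
  have "2 powr (- real j) = 1 / 2 ^ j" "2 powr (1 - real j) = 2 / 2 ^ j"
    by (simp_all add: powr_minus_divide powr_realpow powr_diff)
  then show ?thesis using adm assms unfolding admissible_def by metis
qed

text \<open>The dilate normalised in L^1, whose multiplier is that of \<open>\<phi> 0\<close>
  stretched by \<open>2 ^ J\<close>. It is at once the reproducing kernel of the level below J and
  the partial sum of the resolution up to J.\<close>

definition lowpass :: "nat \<Rightarrow> real^'n \<Rightarrow> complex" where
  "lowpass J x = of_real ((2 ^ J) ^ CARD('n)) * \<phi> 0 (2 ^ J *\<^sub>R x)"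

lemma lowpass_schwartz: "lowpass J \<in> schwartz"
  unfolding lowpass_def[abs_def]
  using schwartz_cmult[OF schwartz_affine[OF phi_schwartz[of 0], where a="2 ^ J" and b=0]] by simp

lemma lowpass_rapid: "rapid (lowpass J)"
  by (rule schwartz_rapid[OF lowpass_schwartz])

lemma fourier_lowpass: "fourier (lowpass J) \<xi> = fourier (\<phi> 0) ((1 / 2 ^ J) *\<^sub>R \<xi>)"
proof -
  have "fourier (lowpass J) \<xi> = of_real ((2 ^ J) ^ CARD('n)) * fourier (\<lambda>x. \<phi> 0 (2 ^ J *\<^sub>R (x - 0))) \<xi>"
    unfolding lowpass_def[abs_def] by (simp add: fourier_cmult)
  also have "\<dots> = fourier (\<phi> 0) ((1 / 2 ^ J) *\<^sub>R \<xi>)"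
    by (subst fourier_affine[OF phi_rapid]) (auto simp: scaleR_conv_of_real)
  finally show ?thesis .
qed

lemma fourier_phi_eq_0:
  assumes "norm \<xi> \<ge> 2 * 2 ^ j" shows "fourier (\<phi> j) \<xi> = 0"
proof -
  have z: "fourier (\<phi> 0) (c *\<^sub>R \<xi>) = 0" if "c \<ge> 1 / 2 ^ j" for c
  proof (rule rho(3))
    have "rho < 2" by (rule rho)
    also have "2 \<le> (1 / 2 ^ j) * norm \<xi>" using assms by (simp add: field_simps)
    also have "\<dots> \<le> c * norm \<xi>" using that by (intro mult_right_mono) auto
    also have "\<dots> \<le> \<bar>c\<bar> * norm \<xi>" by (intro mult_right_mono) auto
    finally show "rho < norm (c *\<^sub>R \<xi>)" by simp
  qed
  show ?thesis
  proof (cases "j = 0")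
    case True
    then show ?thesis using z[of 1] by simp
  next
    case False
    then show ?thesis using fourier_phi[of j \<xi>] z[of "1 / 2 ^ j"] z[of "2 / 2 ^ j"] by (simp add: divide_right_mono)
  qed
qed

text \<open>The multiplier of \<open>\<phi> j\<close> vanishes outside radius
  \<open>2 * 2 ^ j\<close>, and inside it that of \<open>lowpass (Suc j)\<close> equals 1; hence the
  shift of the index by one.\<close>

lemma convol_lowpass_phi: "convol (lowpass (Suc j)) (\<phi> j) = \<phi> j"
proof (rule fourier_inject)
  fix \<xi>
  have "fourier (convol (lowpass (Suc j)) (\<phi> j)) \<xi> = fourier (lowpass (Suc j)) \<xi> * fourier (\<phi> j) \<xi>"
    by (rule fourier_convol[OF lowpass_rapid phi_rapid])
  also have "\<dots> = fourier (\<phi> j) \<xi>"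
  proof (cases "norm \<xi> \<ge> 2 * 2 ^ j")
    case False
    then have "fourier (\<phi> 0) ((1 / 2 ^ Suc j) *\<^sub>R \<xi>) = 1"
      by (intro fourier_phi0_eq_1) (simp add: field_simps)
    then show ?thesis by (simp add: fourier_lowpass)
  qed (simp add: fourier_phi_eq_0)
  finally show "fourier (convol (lowpass (Suc j)) (\<phi> j)) \<xi> = fourier (\<phi> j) \<xi>" .
qed (intro rapid_convol lowpass_rapid phi_rapid)+

text \<open>The multipliers of the levels are differences of consecutive dilates and
  telescope.\<close>

lemma sum_phi: "(\<Sum>j\<le>J. \<phi> j x) = lowpass J x"
proof -
  have "(\<lambda>x. \<Sum>j\<le>J. \<phi> j x) = lowpass J"
  proof (rule fourier_inject)
    fix \<xi>
    show "fourier (\<lambda>x. \<Sum>j\<le>J. \<phi> j x) \<xi> = fourier (lowpass J) \<xi>"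
    proof (induction J)
      case 0
      show ?case using fourier_lowpass[of 0 \<xi>] by simp
    next
      case (Suc J)
      have "fourier (\<lambda>x. (\<Sum>j\<le>J. \<phi> j x) + \<phi> (Suc J) x) \<xi> = fourier (\<lambda>x. \<Sum>j\<le>J. \<phi> j x) \<xi> + fourier (\<phi> (Suc J)) \<xi>"
        by (intro fourier_add rapid_sum phi_rapid)
      then show ?case using Suc fourier_phi[of "Suc J" \<xi>] by (simp add: fourier_lowpass)
    qed
  qed (intro rapid_sum phi_rapid lowpass_rapid)+
  then show ?thesis by metis
qed

lemma conv_eq_shift: "conv (\<phi> j) T y = T (\<lambda>z. \<phi> j (0 - (z - y)))"
  by (simp add: conv_def)

lemma conv_continuous:
  assumes T: "T \<in> tempered" shows "continuous_on UNIV (conv (\<phi> j) T)"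
  using tempered_shift_continuous[OF T schwartz_reflect[OF phi_schwartz[of j], of 0]]
  by (simp add: conv_eq_shift[abs_def])

lemma conv_polynomial_bound:
  assumes T: "T \<in> tempered"
  obtains B N where "\<And>y. norm (conv (\<phi> j) T y) \<le> B * (1 + norm y) ^ N"
  using tempered_shift_bound[OF T schwartz_reflect[OF phi_schwartz[of j], of 0]]
  by (metis conv_eq_shift)

text \<open>The identity \<open>convol_lowpass_phi\<close> is applied to the test function, and the
  integral is pulled out of T by \<open>tempered_convol\<close>.\<close>

lemma conv_reproduce:
  assumes T: "T \<in> tempered"
  shows "conv (\<phi> j) T x = (LINT y|lborel. lowpass (Suc j) (x - y) * conv (\<phi> j) T y)"
proof -
  let ?\<psi> = "lowpass (Suc j)"
  have "convol (\<lambda>y. ?\<psi> (x - y)) (\<lambda>z. \<phi> j (0 - z)) = (\<lambda>z. \<phi> j (x - z))"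
  proof
    fix z
    have [measurable]: "?\<psi> \<in> borel_measurable borel" "\<phi> j \<in> borel_measurable borel"
      using lowpass_rapid phi_rapid by (auto intro: rapid_measurable)
    have "convol (\<lambda>y. ?\<psi> (x - y)) (\<lambda>z. \<phi> j (0 - z)) z = (LINT y|lborel. ?\<psi> (x - y) * \<phi> j (y - z))"
      by (simp add: convol_def)
    also have "\<dots> = (LINT u|lborel. ?\<psi> u * \<phi> j ((x - z) - u))"
      using lborel_integral_affine[of "\<lambda>u. ?\<psi> u * \<phi> j ((x - z) - u)" "-1" x] by simp
    also have "\<dots> = \<phi> j (x - z)" using convol_lowpass_phi[of j] by (metis convol_def)
    finally show "convol (\<lambda>y. ?\<psi> (x - y)) (\<lambda>z. \<phi> j (0 - z)) z = \<phi> j (x - z)" .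
  qed
  then have "conv (\<phi> j) T x = T (convol (\<lambda>y. ?\<psi> (x - y)) (\<lambda>z. \<phi> j (0 - z)))"
    by (simp add: conv_def)
  also have "\<dots> = (LINT y|lborel. ?\<psi> (x - y) * conv (\<phi> j) T y)"
    unfolding conv_eq_shift
    by (rule tempered_convol[OF T rapid_reflect[OF lowpass_rapid] schwartz_reflect[OF phi_schwartz]])
  finally show ?thesis .
qed

lemma integral_norm_lowpass: "(LINT z|lborel. norm (lowpass J z)) = (LINT z|lborel. norm (\<phi> 0 z))"
proof -
  have [measurable]: "\<phi> 0 \<in> borel_measurable borel" using phi_rapid by (rule rapid_measurable)
  show ?thesis
    using lborel_integral_affine[of "\<lambda>z. norm (\<phi> 0 z)" "2 ^ J" 0] by (simp add: lowpass_def norm_mult norm_power)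
qed

lemma nikolskii_sup:
  assumes p: "0 < p"
  obtains C where "C > 0" "\<And>T j L x. T \<in> tempered \<Longrightarrow> L > 0 \<Longrightarrow> Lp_en p (conv (\<phi> j) T) \<le> ennreal L \<Longrightarrow>
     norm (conv (\<phi> j) T x) \<le> C * 2 powr (real j * (real CARD('n) * inv_en p)) * L"
proof (cases "p = top")
  case True
  show ?thesis
  proof (rule that[of 1])
    fix T j L x assume "T \<in> tempered" "(L::real) > 0" "Lp_en p (conv (\<phi> j) T) \<le> ennreal L"
    then show "norm (conv (\<phi> j) T x) \<le> 1 * 2 powr (real j * (real CARD('n) * inv_en p)) * L"
      using norm_le_Lp_top[OF conv_continuous, of T j L x] True by (simp add: inv_en_def)
  qed simp
next
  case False
  then obtain r where r: "p = ennreal r" "r > 0" using p by (cases p) auto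
  obtain M where M: "M > 0" "\<And>x. norm (\<phi> 0 x) \<le> M" using rapid_bounded[OF phi_rapid] by metis
  define A1 where "A1 = (LINT z|lborel. norm (\<phi> 0 z))"
  have A1: "A1 \<ge> 0" unfolding A1_def by simp
  define n where "n = real CARD('n)"
  define C where "C = (1 + A1) * (2 powr n * M) powr (1/r)"
  show ?thesis
  proof (rule that[of C])
    show "C > 0" using A1 M by (simp add: C_def add_pos_nonneg)
    fix T j L x assume T: "T \<in> tempered" and L: "(L::real) > 0" "Lp_en p (conv (\<phi> j) T) \<le> ennreal L"
    let ?g = "conv (\<phi> j) T" and ?\<psi> = "lowpass (Suc j)"
    have gc: "continuous_on UNIV ?g" by (rule conv_continuous[OF T])
    have L': "Lp_en (ennreal r) ?g \<le> ennreal L" using L r by simp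
    \<comment> \<open>\<open>A\<close> bounds the kernel \<open>lowpass (Suc j)\<close>; its root
      \<open>A powr (1/r)\<close> is the source of the growth \<open>2 powr (j n / r)\<close> in
      Nikolskii's inequality.\<close>
    define A where "A = (2 ^ Suc j) ^ CARD('n) * M"
    have A: "A > 0" "norm (?\<psi> z) \<le> A" for z
      unfolding A_def lowpass_def using M by (auto simp: norm_mult norm_power intro!: mult_left_mono)
    have Ae: "A powr (1/r) = (2 powr n * M) powr (1/r) * 2 powr (real j * (n / r))"
    proof -
      have "A = (2 powr n * M) * 2 powr (real j * n)"
        unfolding A_def n_def using M
        by (simp add: powr_realpow[symmetric] powr_powr powr_add[symmetric] algebra_simps power_mult[symmetric] del: power_Suc)
      then show ?thesis using M by (simp add: powr_mult powr_powr)
    qed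
    have "norm (?g x) \<le> (1 + A1) * A powr (1/r) * L"
    proof (cases "r \<ge> 1")
      case True
      show ?thesis
        by (rule reproducing_sup_bound_ge1[OF lowpass_rapid A _ gc conv_reproduce[OF T] True L' L(1)])
          (simp add: integral_norm_lowpass A1_def)
    next
      case False
      then have r1: "r < 1" by simp
      \<comment> \<open>The order N, and with it D, depends on T. This pass only establishes that
        \<open>?g\<close> is bounded; the second pass, with weight exponent 0, has the constant A,
        which is independent of T.\<close>
      obtain B N where B: "\<And>y. norm (?g y) \<le> B * (1 + norm y) ^ N" using conv_polynomial_bound[OF T] by metis
      obtain D where D: "D > 0" "\<And>z. (1 + norm z) ^ N * norm (?\<psi> z) \<le> D" using rapid_boundE[OF lowpass_rapid] by metis
      have "norm (?g y) \<le> (D powr (1/r) * L) * (1 + norm y) ^ 0" for y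
        using reproducing_sup_bound_lt1[OF lowpass_rapid D gc B conv_reproduce[OF T] r(2) r1 L' L(1)] by simp
      moreover have "(1 + norm z) ^ 0 * norm (?\<psi> z) \<le> A" for z using A by simp
      ultimately have "norm (?g x) \<le> A powr (1/r) * L"
        using reproducing_sup_bound_lt1[OF lowpass_rapid A(1) _ gc _ conv_reproduce[OF T] r(2) r1 L' L(1), where N=0] by blast
      also have "\<dots> \<le> (1 + A1) * (A powr (1/r) * L)"
        using A1 L by (simp add: mult_left_le_one_le mult_ge1_I distrib_right)
      finally show ?thesis by (simp add: mult.assoc)
    qed
    then show "norm (?g x) \<le> C * 2 powr (real j * (real CARD('n) * inv_en p)) * L"
      using r by (simp add: C_def Ae inv_en_def n_def mult_ac)
  qed
qed

text \<open>Since \<open>conv (\<phi> j) T\<close> is reproduced by \<open>lowpass (Suc j)\<close>,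
  its oscillation is at most S times the L^1 distance of two translates of this kernel. Rescaling
  turns that into a shift of \<open>\<phi> 0\<close> by \<open>2 ^ Suc j\<close> times the
  displacement, so h can be chosen for all levels at once.\<close>

lemma modulus:
  assumes "\<delta> > 0"
  obtains h where "h > 0" "\<And>T j x x' S. T \<in> tempered \<Longrightarrow> (\<And>y. norm (conv (\<phi> j) T y) \<le> S) \<Longrightarrow>
     2 ^ j * norm (x - x') \<le> h \<Longrightarrow> norm (conv (\<phi> j) T x - conv (\<phi> j) T x') \<le> \<delta> * S"
proof -
  let ?m = "2 * DIM(real^'n)"
  have [measurable]: "\<phi> 0 \<in> borel_measurable borel" "lowpass j \<in> borel_measurable borel" for j
    using phi_rapid lowpass_rapid by (auto intro: rapid_measurable)
  obtain L where L: "L > 0" "\<And>z y y'. (1 + norm z) ^ ?m * norm (\<phi> 0 (z - y) - \<phi> 0 (z - y'))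
      \<le> L * norm (y - y') * (1 + norm y + norm y') ^ ?m"
    using schwartz_weighted_lipschitz[OF phi_schwartz] by metis
  define I where "I = (LINT x::real^'n|lborel. 1 / (1 + norm x) ^ ?m)"
  have I: "I \<ge> 0" unfolding I_def by (intro integral_nonneg_AE) auto
  have om: "(LINT v|lborel. norm (\<phi> 0 v - \<phi> 0 (v + w))) \<le> L * norm w * (1 + norm w) ^ ?m * I" for w
  proof -
    have "(LINT v|lborel. norm (\<phi> 0 v - \<phi> 0 (v + w))) \<le> (LINT v::real^'n|lborel. L * norm w * (1 + norm w) ^ ?m * (1 / (1 + norm v) ^ ?m))"
    proof (rule integral_mono)
      show "integrable lborel (\<lambda>v. norm (\<phi> 0 v - \<phi> 0 (v + w)))"
        using rapid_shift[OF phi_rapid[of 0], of "- w"] by (intro rapid_norm_integrable rapid_diff phi_rapid) simp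
      show "integrable lborel (\<lambda>v::real^'n. L * norm w * (1 + norm w) ^ ?m * (1 / (1 + norm v) ^ ?m))"
        by (intro integrable_mult_right integrable_inverse_weight)
      fix v :: "real^'n"
      have "(1 + norm v) ^ ?m > 0" by (simp add: add_pos_nonneg)
      then show "norm (\<phi> 0 v - \<phi> 0 (v + w)) \<le> L * norm w * (1 + norm w) ^ ?m * (1 / (1 + norm v) ^ ?m)"
        using L(2)[of v 0 "- w"] by (simp add: pos_le_divide_eq mult_ac)
    qed
    also have "\<dots> = L * norm w * (1 + norm w) ^ ?m * I"
      unfolding I_def by (rule integral_mult_right_zero)
    finally show ?thesis .
  qed
  \<comment> \<open>With \<open>h \<le> 1\<close> the rescaled shift has norm at most 2, whence the
    base 3; the summand 1 keeps D positive for the division in h.\<close>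
  define D where "D = L * 3 ^ ?m * I + 1"
  have D: "D > 0" unfolding D_def using L I by (intro add_nonneg_pos) auto
  define h where "h = min 1 (\<delta> / (2 * D))"
  show ?thesis
  proof (rule that[of h])
    show "h > 0" using assms D by (simp add: h_def)
    fix T j S and x x' :: "real^'n"
    assume T: "T \<in> tempered" and S: "\<And>y. norm (conv (\<phi> j) T y) \<le> S" and xx: "2 ^ j * norm (x - x') \<le> h"
    let ?g = "conv (\<phi> j) T" and ?\<psi> = "lowpass (Suc j)"
    have [measurable]: "?g \<in> borel_measurable borel" by (intro borel_measurable_continuous_onI conv_continuous T)
    have S0: "S \<ge> 0" using order_trans[OF norm_ge_zero S[of 0]] .
    define w where "w = 2 ^ Suc j *\<^sub>R (x' - x)"
    have nw: "norm w \<le> 2 * h" using xx by (simp add: w_def norm_minus_commute)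
    have i1: "integrable lborel (\<lambda>y. ?\<psi> (x - y) * ?g y)" for x :: "real^'n"
    proof (rule Bochner_Integration.integrable_bound)
      show "integrable lborel (\<lambda>y. S * norm (?\<psi> (x - y)))"
        by (intro integrable_mult_right rapid_norm_integrable rapid_reflect lowpass_rapid)
      show "AE y in lborel. norm (?\<psi> (x - y) * ?g y) \<le> norm (S * norm (?\<psi> (x - y)))"
        using S S0 by (intro AE_I2) (simp add: norm_mult mult.commute mult_right_mono)
    qed measurable
    have i2: "integrable lborel (\<lambda>y. norm (?\<psi> (x - y) - ?\<psi> (x' - y)))"
      by (intro rapid_norm_integrable rapid_diff rapid_reflect lowpass_rapid)
    have "?g x - ?g x' = (LINT y|lborel. (?\<psi> (x - y) - ?\<psi> (x' - y)) * ?g y)"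
      using i1[of x] i1[of x'] by (subst (1 2) conv_reproduce[OF T]) (simp add: left_diff_distrib)
    then have "norm (?g x - ?g x') = norm (LINT y|lborel. (?\<psi> (x - y) - ?\<psi> (x' - y)) * ?g y)"
      by (rule arg_cong)
    also have "\<dots> \<le> (LINT y|lborel. norm ((?\<psi> (x - y) - ?\<psi> (x' - y)) * ?g y))"
      by (rule integral_norm_bound)
    also have "\<dots> \<le> (LINT y|lborel. S * norm (?\<psi> (x - y) - ?\<psi> (x' - y)))"
    proof (rule integral_mono)
      have "integrable lborel (\<lambda>y. (?\<psi> (x - y) - ?\<psi> (x' - y)) * ?g y)"
        using i1[of x] i1[of x'] by (simp add: left_diff_distrib)
      then show "integrable lborel (\<lambda>y. norm ((?\<psi> (x - y) - ?\<psi> (x' - y)) * ?g y))" by (rule integrable_norm)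
      show "norm ((?\<psi> (x - y) - ?\<psi> (x' - y)) * ?g y) \<le> S * norm (?\<psi> (x - y) - ?\<psi> (x' - y))" for y
        using mult_left_mono[OF S[of y], of "norm (?\<psi> (x - y) - ?\<psi> (x' - y))"] by (simp add: norm_mult mult.commute)
    qed (intro integrable_mult_right i2)
    also have "\<dots> = S * (LINT y|lborel. norm (?\<psi> (x - y) - ?\<psi> (x' - y)))" by simp
    also have "(LINT y|lborel. norm (?\<psi> (x - y) - ?\<psi> (x' - y))) = (LINT v|lborel. norm (\<phi> 0 v - \<phi> 0 (v + w)))"
    proof -
      let ?f = "\<lambda>v. norm (\<phi> 0 v - \<phi> 0 (v + w))"
      let ?a = "- (2 ^ Suc j) :: real"
      have "norm (?\<psi> (x - y) - ?\<psi> (x' - y)) = (2 ^ Suc j) ^ CARD('n) * ?f (?a *\<^sub>R y + 2 ^ Suc j *\<^sub>R x)" for y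
      proof -
        have "?\<psi> (x - y) - ?\<psi> (x' - y) = of_real ((2 ^ Suc j) ^ CARD('n)) * (\<phi> 0 (?a *\<^sub>R y + 2 ^ Suc j *\<^sub>R x) - \<phi> 0 ((?a *\<^sub>R y + 2 ^ Suc j *\<^sub>R x) + w))"
          unfolding lowpass_def w_def right_diff_distrib[symmetric]
          by (simp add: scaleR_diff_right del: power_Suc)
        then show ?thesis by (simp add: norm_mult norm_power del: power_Suc)
      qed
      then show ?thesis
        using lborel_integral_affine[of ?f ?a "2 ^ Suc j *\<^sub>R x"] by (simp del: power_Suc)
    qed
    also have "S * \<dots> \<le> S * (\<delta>)"
    proof (rule mult_left_mono[OF _ S0])
      have h1: "h \<le> 1" "h \<le> \<delta> / (2 * D)" by (auto simp: h_def)
      have "(LINT v|lborel. norm (\<phi> 0 v - \<phi> 0 (v + w))) \<le> L * norm w * (1 + norm w) ^ ?m * I" by (rule om)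
      also have "\<dots> \<le> L * (2 * h) * 3 ^ ?m * I"
        using nw h1 L I \<open>h > 0\<close> by (intro mult_right_mono mult_mono power_mono) auto
      also have "\<dots> = (L * 3 ^ ?m * I) * (2 * h)" by simp
      also have "\<dots> \<le> D * (2 * h)" using \<open>h > 0\<close> by (intro mult_right_mono) (auto simp: D_def)
      also have "\<dots> \<le> D * (2 * (\<delta> / (2 * D)))" using h1 D by (intro mult_left_mono) auto
      finally show "(LINT v|lborel. norm (\<phi> 0 v - \<phi> 0 (v + w))) \<le> \<delta>" using D by simp
    qed
    finally show "norm (?g x - ?g x') \<le> \<delta> * S" by (simp add: mult.commute)
  qed
qed

text \<open>T annihilates \<open>convol f (k J)\<close>, because translates of \<open>k J\<close>
  are finite sums of the kernels that define the vanishing levels. The \<open>k J\<close> are an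
  approximate identity, and \<open>convol f (k J)\<close> tends to f in every seminorm at rate
  \<open>1 / 2 ^ J\<close>.\<close>

lemma conv_injective:
  assumes T: "T \<in> tempered" and z: "\<And>j x. conv (\<phi> j) T x = 0"
  shows "T = (\<lambda>f. 0)"
proof
  fix f
  show "T f = 0"
  proof (cases "f \<in> schwartz")
    case False
    then show ?thesis using T by (simp add: tempered_def)
  next
    case f: True
    obtain C N where C: "C \<ge> 0" "\<And>f. f \<in> schwartz \<Longrightarrow> norm (T f) \<le> C * (\<Sum>\<alpha>\<in>{\<alpha>. length \<alpha> \<le> N}. sw_sn N \<alpha> f)"
      using temperedE[OF T] by metis
    have [measurable]: "\<phi> 0 \<in> borel_measurable borel" "lowpass j \<in> borel_measurable borel" for j
      using phi_rapid lowpass_rapid by (auto intro: rapid_measurable)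
    define k where "k = (\<lambda>J z. lowpass J (0 - z))"
    have ks: "k J \<in> schwartz" for J
      unfolding k_def by (rule schwartz_reflect[OF lowpass_schwartz])
    have kr: "rapid (k J)" for J
      by (rule schwartz_rapid[OF ks])
    have fr: "rapid f" by (rule schwartz_rapid[OF f])
    have Tz: "T (convol f (k J)) = 0" for J
    proof -
      have "T (\<lambda>z. k J (z - y)) = 0" for y
      proof -
        have "(\<lambda>z. k J (z - y)) = (\<lambda>z. \<Sum>j\<le>J. \<phi> j (y - z))" by (simp add: k_def sum_phi)
        then have "T (\<lambda>z. k J (z - y)) = (\<Sum>j\<le>J. conv (\<phi> j) T y)"
          by (simp add: tempered_sum[OF T schwartz_reflect[OF phi_schwartz]] conv_def)
        then show ?thesis by (simp add: z)
      qed
      then show ?thesis using tempered_convol[OF T fr ks] by simp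
    qed
    have "\<forall>\<alpha>. \<exists>L>0. \<forall>z y y'. (1 + norm z) ^ N * norm (pdl \<alpha> f (z - y) - pdl \<alpha> f (z - y')) \<le> L * norm (y - y') * (1 + norm y + norm y') ^ N"
      using schwartz_weighted_lipschitz[OF schwartz_pdl[OF f], of N] by metis
    then obtain L where L: "\<And>\<alpha>. L \<alpha> > 0" "\<And>\<alpha> z y y'. (1 + norm z) ^ N * norm (pdl \<alpha> f (z - y) - pdl \<alpha> f (z - y')) \<le> L \<alpha> * norm (y - y') * (1 + norm y + norm y') ^ N"
      by metis
    define I where "I = (LINT u|lborel. (1 + norm u) ^ Suc N * norm (\<phi> 0 u))"
    have k1: "(LINT y|lborel. k J y) = 1" for J
    proof -
      have "(LINT y|lborel. k J y) = (LINT y|lborel. lowpass J y)"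
        using lborel_integral_affine[of "lowpass J" "-1" 0] by (simp add: k_def)
      also have "\<dots> = fourier (lowpass J) 0" by (simp add: fourier_def)
      finally show ?thesis by (simp add: fourier_lowpass fourier_phi0_eq_1)
    qed
    \<comment> \<open>The first moment of the kernel scales like \<open>1 / 2 ^ J\<close>. The
      additional weight of order N is what the Lipschitz bound for the derivatives of f
      produces.\<close>
    have kI: "(LINT y|lborel. norm (k J y) * (norm y * (1 + norm y) ^ N)) \<le> I / 2 ^ J"
      and ki: "integrable lborel (\<lambda>y. norm (k J y) * (norm y * (1 + norm y) ^ N))" for J
    proof -
      let ?h = "\<lambda>y. (1 + norm y) ^ Suc N * norm (k J y)"
      show "integrable lborel (\<lambda>y. norm (k J y) * (norm y * (1 + norm y) ^ N))"
      proof (rule Bochner_Integration.integrable_bound[OF rapid_weight_integrable[OF kr[of J], of "Suc N"]])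
        have "norm (k J y) * (norm y * (1 + norm y) ^ N) \<le> ?h y" for y
          by (simp add: mult_ac) (intro mult_right_mono mult_left_mono; simp)
        then show "AE y in lborel. norm (norm (k J y) * (norm y * (1 + norm y) ^ N)) \<le> norm (?h y)"
          by (intro AE_I2) simp
      qed (use kr[of J] in \<open>auto intro!: borel_measurable_times borel_measurable_norm simp: rapid_measurable\<close>)
      let ?q = "\<lambda>u. norm (\<phi> 0 u) * (norm ((1 / 2 ^ J) *\<^sub>R u) * (1 + norm ((1 / 2 ^ J) *\<^sub>R u)) ^ N)"
      have "(LINT y|lborel. norm (k J y) * (norm y * (1 + norm y) ^ N)) = (LINT u|lborel. ?q u)"
        using lborel_integral_affine[of ?q "- (2 ^ J)" 0]
        by (simp add: k_def lowpass_def norm_mult norm_power mult.assoc)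
      also have "\<dots> \<le> (LINT u|lborel. (1 / 2 ^ J) * ((1 + norm u) ^ Suc N * norm (\<phi> 0 u)))"
      proof (rule integral_mono_AE')
        show "integrable lborel (\<lambda>u. (1 / 2 ^ J) * ((1 + norm u) ^ Suc N * norm (\<phi> 0 u)))"
          by (intro integrable_mult_right rapid_weight_integrable phi_rapid)
        show "AE u in lborel. ?q u \<le> (1 / 2 ^ J) * ((1 + norm u) ^ Suc N * norm (\<phi> 0 u))"
        proof (rule AE_I2)
          fix u :: "real^'n"
          have "norm ((1 / 2 ^ J) *\<^sub>R u) \<le> norm u" using one_le_power[of "2::real" J]
            by (simp add: divide_le_eq mult_le_cancel_left1 mult_ge1_I)
          then have "norm ((1 / 2 ^ J) *\<^sub>R u) * (1 + norm ((1 / 2 ^ J) *\<^sub>R u)) ^ N \<le> (1 / 2 ^ J) * (1 + norm u) * (1 + norm u) ^ N"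
            by (intro mult_mono power_mono add_left_mono) (auto simp: divide_right_mono)
          from mult_left_mono[OF this, of "norm (\<phi> 0 u)"]
          show "?q u \<le> (1 / 2 ^ J) * ((1 + norm u) ^ Suc N * norm (\<phi> 0 u))" by (simp add: mult_ac)
        qed
        show "AE u in lborel. 0 \<le> (1 / 2 ^ J) * ((1 + norm u) ^ Suc N * norm (\<phi> 0 u))" by (intro AE_I2) simp
      qed
      also have "\<dots> = I / 2 ^ J" by (simp add: I_def)
      finally show "(LINT y|lborel. norm (k J y) * (norm y * (1 + norm y) ^ N)) \<le> I / 2 ^ J" .
    qed
    have cvc: "convol f (k J) = convol (k J) f" for J using convol_commute[OF fr kr] by blast
    have cvs: "convol f (k J) \<in> schwartz" for J by (intro schwartz_convol fr ks)
    have sn: "sw_sn N \<alpha> (\<lambda>z. f z - convol f (k J) z) \<le> L \<alpha> * (I / 2 ^ J)" for \<alpha> J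
    proof (rule sw_sn_le)
      fix z
      let ?F = "pdl \<alpha> f"
      have Fr: "rapid ?F" by (intro schwartz_rapid schwartz_pdl f)
      have "pdl \<alpha> (\<lambda>z. f z - convol f (k J) z) z = ?F z - convol (k J) ?F z"
        unfolding pdl_diff[OF f cvs] by (simp add: cvc pdl_convol[OF kr f])
      also have "\<dots> = (LINT y|lborel. k J y * (?F (z - 0) - ?F (z - y)))"
        using rapid_mult_shift_integrable[OF kr Fr, of J z] rapid_integrable[OF kr, of J] k1[of J]
        by (simp add: convol_def right_diff_distrib)
      finally have "(1 + norm z) ^ N * norm (pdl \<alpha> (\<lambda>z. f z - convol f (k J) z) z) = (1 + norm z) ^ N * norm (LINT y|lborel. k J y * (?F (z - 0) - ?F (z - y)))"
        by simp
      also have "\<dots> \<le> (1 + norm z) ^ N * (LINT y|lborel. norm (k J y * (?F (z - 0) - ?F (z - y))))"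
        by (intro mult_left_mono integral_norm_bound) simp
      also have "\<dots> = (LINT y|lborel. (1 + norm z) ^ N * norm (k J y * (?F (z - 0) - ?F (z - y))))" by simp
      also have "\<dots> \<le> (LINT y|lborel. L \<alpha> * (norm (k J y) * (norm y * (1 + norm y) ^ N)))"
      proof (rule integral_mono_AE')
        show "integrable lborel (\<lambda>y. L \<alpha> * (norm (k J y) * (norm y * (1 + norm y) ^ N)))"
          by (intro integrable_mult_right ki)
        show "AE y in lborel. (1 + norm z) ^ N * norm (k J y * (?F (z - 0) - ?F (z - y))) \<le> L \<alpha> * (norm (k J y) * (norm y * (1 + norm y) ^ N))"
        proof (rule AE_I2)
          fix y
          have "norm (k J y) * ((1 + norm z) ^ N * norm (?F (z - 0) - ?F (z - y))) \<le> norm (k J y) * (L \<alpha> * norm (0 - y) * (1 + norm (0::real^'n) + norm y) ^ N)"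
            by (intro mult_left_mono L) auto
          then show "(1 + norm z) ^ N * norm (k J y * (?F (z - 0) - ?F (z - y))) \<le> L \<alpha> * (norm (k J y) * (norm y * (1 + norm y) ^ N))"
            by (simp add: norm_mult mult_ac)
        qed
        show "AE y in lborel. 0 \<le> L \<alpha> * (norm (k J y) * (norm y * (1 + norm y) ^ N))"
          using L(1)[of \<alpha>] by (intro AE_I2) simp
      qed
      also have "\<dots> = L \<alpha> * (LINT y|lborel. norm (k J y) * (norm y * (1 + norm y) ^ N))" by simp
      also have "\<dots> \<le> L \<alpha> * (I / 2 ^ J)" using L(1)[of \<alpha>] by (intro mult_left_mono kI) auto
      finally show "(1 + norm z) ^ N * norm (pdl \<alpha> (\<lambda>z. f z - convol f (k J) z) z) \<le> L \<alpha> * (I / 2 ^ J)" .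
    qed
    define Q where "Q = C * (\<Sum>\<alpha>\<in>{\<alpha>::'n list. length \<alpha> \<le> N}. L \<alpha> * I)"
    have b: "norm (T f) \<le> Q * (1/2) ^ J" for J
    proof -
      have "norm (T f) = norm (T (\<lambda>z. f z - convol f (k J) z))" using tempered_diff[OF T f cvs] Tz by simp
      also have "\<dots> \<le> C * (\<Sum>\<alpha>\<in>{\<alpha>. length \<alpha> \<le> N}. sw_sn N \<alpha> (\<lambda>z. f z - convol f (k J) z))"
        by (intro C schwartz_diff f cvs)
      also have "\<dots> \<le> C * (\<Sum>\<alpha>\<in>{\<alpha>. length \<alpha> \<le> N}. L \<alpha> * (I / 2 ^ J))"
        by (intro mult_left_mono sum_mono sn C)
      also have "\<dots> = Q * (1/2) ^ J" by (simp add: Q_def sum_divide_distrib[symmetric] power_divide)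
      finally show ?thesis .
    qed
    have "(\<lambda>J. Q * (1/2::real) ^ J) \<longlonglongrightarrow> Q * 0" by (intro tendsto_mult tendsto_const LIMSEQ_power_zero) auto
    then have "norm (T f) \<le> 0" using b by (intro LIMSEQ_le_const[where X="\<lambda>J. Q * (1/2) ^ J"]) auto
    then show ?thesis by simp
  qed
qed

end

section \<open>Embeddings and wave packets\<close>

lemma Lp_en_cmult:
  assumes g: "continuous_on UNIV g" and p: "0 < p"
  shows "Lp_en p (\<lambda>x. c * g x) = ennreal (norm c) * Lp_en p g"
proof -
  have [measurable]: "g \<in> borel_measurable borel" using g by (rule borel_measurable_continuous_onI)
  show ?thesis
    unfolding Lp_en_eq_Lnorm norm_mult ennreal_mult[OF norm_ge_zero norm_ge_zero]
    by (rule Lnorm_cmult) (use p in auto)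
qed

lemma Lp_en_zero: "0 < p \<Longrightarrow> Lp_en p (\<lambda>x. 0) = 0"
  by (simp add: Lp_en_eq_Lnorm)

lemma lincomb_Suc: "lincomb (Suc K) c e = (\<lambda>f. lincomb K c e f + c K * e K f)"
  by (simp add: lincomb_def fun_eq_iff)

lemma tempered_cmult_closed:
  assumes "T \<in> tempered" shows "(\<lambda>f. c * T f) \<in> tempered"
  using tempered_lincomb[of 1 "\<lambda>_. T" "\<lambda>_. c"] assms by (simp add: lincomb_def)

lemma tempered_add_closed:
  assumes "S \<in> tempered" "T \<in> tempered" shows "(\<lambda>f. S f + T f) \<in> tempered"
  using tempered_lincomb[of 2 "\<lambda>i. if i = 0 then S else T" "\<lambda>_. 1"] assms
  by (simp add: lincomb_def numeral_2_eq_2)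

lemma tempered_diff_closed:
  assumes "S \<in> tempered" "T \<in> tempered" shows "(\<lambda>f. S f - T f) \<in> tempered"
  using tempered_add_closed[OF assms(1) tempered_cmult_closed[OF assms(2), of "-1"]] by simp

lemma conv_add: "conv \<psi> (\<lambda>f. S f + T f) x = conv \<psi> S x + conv \<psi> T x"
  by (simp add: conv_def)

lemma conv_cmult: "conv \<psi> (\<lambda>f. c * T f) x = c * conv \<psi> T x"
  by (simp add: conv_def)

lemma conv_lincomb: "conv \<psi> (lincomb K c e) x = (\<Sum>i<K. c i * conv \<psi> (e i) x)"
  by (simp add: conv_def lincomb_def)

lemma exponential_unbounded:
  assumes "a > 0" "\<And>m::nat. 2 powr (real m * a) \<le> K" shows False
proof -
  obtain m :: nat where m: "log 2 (max K 1) < real m * a"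
    using reals_Archimedean3[OF assms(1)] by blast
  have "real m * a \<le> log 2 (max K 1)"
    using assms(2)[of m] by (subst le_log_iff) auto
  with m show False by simp
qed

context resolution
begin

lemma besov_norm_cmult:
  assumes T: "T \<in> tempered" and p: "0 < p" "0 < q"
  shows "besov_norm \<phi> s p q (\<lambda>f. c * T f) = ennreal (norm c) * besov_norm \<phi> s p q T"
proof -
  have "conv (\<phi> j) (\<lambda>f. c * T f) = (\<lambda>x. c * conv (\<phi> j) T x)" for j by (simp add: conv_cmult fun_eq_iff)
  then have "ennreal (2 powr (real j * s)) * Lp_en p (conv (\<phi> j) (\<lambda>f. c * T f)) =
    ennreal (norm c) * (ennreal (2 powr (real j * s)) * Lp_en p (conv (\<phi> j) T))" for j
    by (simp add: Lp_en_cmult[OF conv_continuous[OF T] p(1)] mult_ac)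
  then show ?thesis
    unfolding besov_norm_eq_lnorm using p by (simp add: Lnorm_cmult)
qed

lemma besov_norm_add_le:
  assumes p: "0 < p" "0 < q"
  obtains C where "C > 0" "\<And>S T. S \<in> tempered \<Longrightarrow> T \<in> tempered \<Longrightarrow>
    besov_norm \<phi> s p q (\<lambda>f. S f + T f) \<le> ennreal C * (besov_norm \<phi> s p q S + besov_norm \<phi> s p q T)"
proof -
  obtain A where A: "A > 0" and A': "\<And>(M::(real^'n) measure) u v. u \<in> borel_measurable M \<Longrightarrow> v \<in> borel_measurable M \<Longrightarrow>
     Lnorm M p (\<lambda>x. u x + v x) \<le> ennreal A * (Lnorm M p u + Lnorm M p v)"
    using Lnorm_add_le[OF p(1), where 'a="real^'n"] by metis
  obtain B where B: "B > 0" and B': "\<And>(M::nat measure) u v. u \<in> borel_measurable M \<Longrightarrow> v \<in> borel_measurable M \<Longrightarrow>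
     Lnorm M q (\<lambda>x. u x + v x) \<le> ennreal B * (Lnorm M q u + Lnorm M q v)"
    using Lnorm_add_le[OF p(2), where 'a=nat] by metis
  show ?thesis
  proof (rule that[of "A * B"])
    show "A * B > 0" using A B by simp
    fix S T :: "'n distr" assume S: "S \<in> tempered" and T: "T \<in> tempered"
    let ?a = "\<lambda>T j. ennreal (2 powr (real j * s)) * Lp_en p (conv (\<phi> j) T)"
    have 1: "?a (\<lambda>f. S f + T f) j \<le> ennreal A * (?a S j + ?a T j)" for j
    proof -
      have [measurable]: "conv (\<phi> j) S \<in> borel_measurable borel" "conv (\<phi> j) T \<in> borel_measurable borel"
        using S T by (auto intro: borel_measurable_continuous_onI conv_continuous)
      have "Lp_en p (conv (\<phi> j) (\<lambda>f. S f + T f)) \<le> Lnorm lborel p (\<lambda>x. ennreal (norm (conv (\<phi> j) S x)) + ennreal (norm (conv (\<phi> j) T x)))"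
        unfolding Lp_en_eq_Lnorm conv_add
        using p by (intro Lnorm_mono) (auto simp: ennreal_plus[symmetric] norm_triangle_ineq simp del: ennreal_plus intro!: ennreal_leI)
      also have "\<dots> \<le> ennreal A * (Lp_en p (conv (\<phi> j) S) + Lp_en p (conv (\<phi> j) T))"
        unfolding Lp_en_eq_Lnorm by (rule A') auto
      finally have "?a (\<lambda>f. S f + T f) j \<le> ennreal (2 powr (real j * s)) * (ennreal A * (Lp_en p (conv (\<phi> j) S) + Lp_en p (conv (\<phi> j) T)))"
        by (rule mult_left_mono) simp
      then show ?thesis by (simp add: distrib_left mult_ac)
    qed
    have "besov_norm \<phi> s p q (\<lambda>f. S f + T f) \<le> lnorm q (\<lambda>j. ennreal A * (?a S j + ?a T j))"
      unfolding besov_norm_eq_lnorm using p by (intro Lnorm_mono 1) auto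
    also have "\<dots> = ennreal A * lnorm q (\<lambda>j. ?a S j + ?a T j)"
      using p A by (intro Lnorm_cmult) auto
    also have "\<dots> \<le> ennreal A * (ennreal B * (lnorm q (?a S) + lnorm q (?a T)))"
      by (intro mult_left_mono B') auto
    also have "\<dots> = ennreal (A * B) * (besov_norm \<phi> s p q S + besov_norm \<phi> s p q T)"
      using A B by (simp add: besov_norm_eq_lnorm ennreal_mult mult.assoc)
    finally show "besov_norm \<phi> s p q (\<lambda>f. S f + T f) \<le> ennreal (A * B) * (besov_norm \<phi> s p q S + besov_norm \<phi> s p q T)" .
  qed
qed

lemma besov_tempered: "T \<in> besov \<phi> s p q \<Longrightarrow> T \<in> tempered"
  by (simp add: besov_def)

lemma besov_cmult:
  assumes "T \<in> besov \<phi> s p q" "0 < p" "0 < q" shows "(\<lambda>f. c * T f) \<in> besov \<phi> s p q"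
  using assms by (simp add: besov_def tempered_cmult_closed besov_norm_cmult ennreal_mult_less_top)

lemma besov_add:
  assumes S: "S \<in> besov \<phi> s p q" and T: "T \<in> besov \<phi> s p q" and p: "0 < p" "0 < q"
  shows "(\<lambda>f. S f + T f) \<in> besov \<phi> s p q"
proof -
  obtain C where C: "besov_norm \<phi> s p q (\<lambda>f. S f + T f) \<le> ennreal C * (besov_norm \<phi> s p q S + besov_norm \<phi> s p q T)"
    using besov_norm_add_le[OF p] S T by (metis besov_tempered)
  also have "\<dots> < top" using S T by (simp add: besov_def ennreal_mult_less_top)
  finally show ?thesis using S T by (simp add: besov_def tempered_add_closed)
qed

lemma besov_lincomb:
  assumes "\<And>i. i < K \<Longrightarrow> e i \<in> besov \<phi> s p q" "0 < p" "0 < q"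
  shows "lincomb K c e \<in> besov \<phi> s p q"
  using assms(1)
proof (induction K)
  case 0
  have "(\<lambda>f. 0) \<in> tempered" using tempered_lincomb[of 0] by (simp add: lincomb_def)
  moreover have "conv (\<phi> j) (\<lambda>f. 0) = (\<lambda>x. 0)" for j by (simp add: conv_def fun_eq_iff)
  ultimately show ?case using assms(2,3) by (simp add: lincomb_def besov_def besov_norm_eq_lnorm Lp_en_zero)
next
  case (Suc K)
  have 1: "lincomb K c e \<in> besov \<phi> s p q" by (rule Suc.IH) (use Suc.prems in auto)
  have 2: "e K \<in> besov \<phi> s p q" by (rule Suc.prems) simp
  show ?case unfolding lincomb_Suc by (rule besov_add[OF 1 besov_cmult[OF 2 assms(2,3)] assms(2,3)])
qed

section \<open>Nikolskii's inequality and the embedding\<close>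

lemma nikolskii:
  assumes p: "0 < p0" "p0 \<le> p1"
  obtains C where "C > 0" "\<And>T j. T \<in> tempered \<Longrightarrow> Lp_en p1 (conv (\<phi> j) T) \<le>
     ennreal (C * 2 powr (real j * (real CARD('n) * inv_en p0 - real CARD('n) * inv_en p1))) * Lp_en p0 (conv (\<phi> j) T)"
proof (cases "p0 = top")
  case True
  then have "p1 = top" using p by (simp add: top_unique)
  with True show ?thesis by (intro that[of 1]) auto
next
  case False
  obtain C where C: "C > 0" "\<And>T j L x. T \<in> tempered \<Longrightarrow> L > 0 \<Longrightarrow> Lp_en p0 (conv (\<phi> j) T) \<le> ennreal L \<Longrightarrow>
     norm (conv (\<phi> j) T x) \<le> C * 2 powr (real j * (real CARD('n) * inv_en p0)) * L"
    using nikolskii_sup[OF p(1)] by metis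
  \<comment> \<open>Interpolation between the p0-norm and the supremum supplied by
    \<open>nikolskii_sup\<close>: the growth n/p0 is multiplied by \<open>1 - \<theta>\<close> and
    becomes n/p0 - n/p1.\<close>
  define \<theta> where "\<theta> = inv_en p1 / inv_en p0"
  have ip: "inv_en p0 > 0" using False p enn2real_pos[of p0] by (simp add: inv_en_def)
  show ?thesis
  proof (rule that[of "C powr (1 - \<theta>)"])
    show "C powr (1 - \<theta>) > 0" using C by simp
    fix T :: "'n distr" and j assume T: "T \<in> tempered"
    let ?g = "conv (\<phi> j) T" and ?n = "real CARD('n)"
    have [measurable]: "?g \<in> borel_measurable borel" by (intro borel_measurable_continuous_onI conv_continuous T)
    show "Lp_en p1 ?g \<le> ennreal (C powr (1 - \<theta>) * 2 powr (real j * (?n * inv_en p0 - ?n * inv_en p1))) * Lp_en p0 ?g"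
    proof (rule ennreal_le_by_bounds)
      fix L :: real assume L: "L > 0" "Lp_en p0 ?g \<le> ennreal L"
      define e where "e = C * 2 powr (real j * (?n * inv_en p0)) * L"
      have "Lp_en p1 ?g \<le> ennreal (L powr \<theta> * e powr (1 - \<theta>))"
        unfolding Lp_en_eq_Lnorm \<theta>_def
        by (rule Lnorm_interp) (use p False C(1) C(2)[OF T L] L in \<open>auto simp: e_def Lp_en_eq_Lnorm intro!: ennreal_leI\<close>)
      also have "L powr \<theta> * e powr (1 - \<theta>) = C powr (1 - \<theta>) * 2 powr (real j * (?n * inv_en p0) * (1 - \<theta>)) * (L powr \<theta> * L powr (1 - \<theta>))"
        using C L by (simp add: e_def powr_mult powr_powr mult_ac)
      also have "L powr \<theta> * L powr (1 - \<theta>) = L" using L by (simp add: powr_add[symmetric])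
      also have "real j * (?n * inv_en p0) * (1 - \<theta>) = real j * (?n * inv_en p0 - ?n * inv_en p1)"
        using ip by (simp add: \<theta>_def field_simps)
      finally show "Lp_en p1 ?g \<le> ennreal (C powr (1 - \<theta>) * 2 powr (real j * (?n * inv_en p0 - ?n * inv_en p1)) * L)" .
    qed (use C in simp)
  qed
qed

lemma besov_embedding:
  assumes p: "0 < p0" "p0 \<le> p1" "0 < q0" "0 < q1"
    and s: "s0 - s1 \<ge> real CARD('n) * inv_en p0 - real CARD('n) * inv_en p1"
    and q: "s0 - s1 > real CARD('n) * inv_en p0 - real CARD('n) * inv_en p1 \<or> q0 \<le> q1"
  obtains C where "C > 0" "\<And>T. T \<in> tempered \<Longrightarrow> besov_norm \<phi> s1 p1 q1 T \<le> ennreal C * besov_norm \<phi> s0 p0 q0 T"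
proof -
  let ?d = "real CARD('n) * inv_en p0 - real CARD('n) * inv_en p1"
  obtain B where B: "B > 0" "\<And>T j. T \<in> tempered \<Longrightarrow> Lp_en p1 (conv (\<phi> j) T) \<le>
     ennreal (B * 2 powr (real j * ?d)) * Lp_en p0 (conv (\<phi> j) T)"
    using nikolskii[OF p(1,2)] by metis
  \<comment> \<open>\<open>\<delta>\<close> is the distance from the critical line, and the
    Nikolskii bound gives the j-th level a factor \<open>2 powr (- j \<delta>)\<close>. For
    \<open>\<delta> = 0\<close> the nesting of the sequence spaces has to be used; for
    \<open>\<delta> > 0\<close> bounds on the single levels suffice.\<close>
  define \<delta> where "\<delta> = s0 - s1 - ?d"
  let ?a = "\<lambda>s p T j. ennreal (2 powr (real j * s)) * Lp_en p (conv (\<phi> j) T)"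
  have a: "?a s1 p1 T j \<le> ennreal (B * 2 powr (- real j * \<delta>)) * ?a s0 p0 T j" if T: "T \<in> tempered" for T j
  proof -
    have "?a s1 p1 T j \<le> ennreal (2 powr (real j * s1)) * (ennreal (B * 2 powr (real j * ?d)) * Lp_en p0 (conv (\<phi> j) T))"
      by (intro mult_left_mono B T) auto
    also have "\<dots> = ennreal (2 powr (real j * s1) * (B * 2 powr (real j * ?d))) * Lp_en p0 (conv (\<phi> j) T)"
      using B by (simp add: ennreal_mult mult.assoc)
    also have "2 powr (real j * s1) * (B * 2 powr (real j * ?d)) = B * 2 powr (- real j * \<delta>) * 2 powr (real j * s0)"
      by (simp add: powr_add[symmetric] \<delta>_def algebra_simps)
    also have "ennreal (B * 2 powr (- real j * \<delta>) * 2 powr (real j * s0)) * Lp_en p0 (conv (\<phi> j) T) = ennreal (B * 2 powr (- real j * \<delta>)) * ?a s0 p0 T j"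
      using B by (simp add: ennreal_mult mult.assoc)
    finally show ?thesis .
  qed
  show ?thesis
  proof (cases "\<delta> = 0")
    case True
    then have q01: "q0 \<le> q1" using q by (auto simp: \<delta>_def)
    show ?thesis
    proof (rule that[of B])
      fix T :: "'n distr" assume T: "T \<in> tempered"
      have "besov_norm \<phi> s1 p1 q1 T \<le> lnorm q1 (\<lambda>j. ennreal B * ?a s0 p0 T j)"
        unfolding besov_norm_eq_lnorm using a[OF T] True p by (intro Lnorm_mono) auto
      also have "\<dots> = ennreal B * lnorm q1 (?a s0 p0 T)" using p B by (intro Lnorm_cmult) auto
      also have "lnorm q1 (?a s0 p0 T) \<le> ennreal 1 * lnorm q0 (?a s0 p0 T)"
        by (rule ennreal_le_by_bounds) (use lnorm_mono_exponent[OF p(3) q01] in auto)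
      finally show "besov_norm \<phi> s1 p1 q1 T \<le> ennreal B * besov_norm \<phi> s0 p0 q0 T"
        by (simp add: besov_norm_eq_lnorm mult_left_mono)
    qed (rule B)
  next
    case False
    then have \<delta>: "\<delta> > 0" using s by (simp add: \<delta>_def)
    obtain A where A: "A > 0" "\<And>a L. L \<ge> 0 \<Longrightarrow> (\<And>j. a j \<le> ennreal (L * 2 powr (- real j * \<delta>))) \<Longrightarrow> lnorm q1 a \<le> ennreal (A * L)"
      using lnorm_geometric[OF p(4) \<delta>] by metis
    show ?thesis
    proof (rule that[of "A * B"])
      fix T :: "'n distr" assume T: "T \<in> tempered"
      show "besov_norm \<phi> s1 p1 q1 T \<le> ennreal (A * B) * besov_norm \<phi> s0 p0 q0 T"
      proof (rule ennreal_le_by_bounds)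
        fix L :: real assume L: "L > 0" "besov_norm \<phi> s0 p0 q0 T \<le> ennreal L"
        have "lnorm q1 (?a s1 p1 T) \<le> ennreal (A * (B * L))"
        proof (rule A(2))
          fix j
          have "?a s1 p1 T j \<le> ennreal (B * 2 powr (- real j * \<delta>)) * ?a s0 p0 T j" by (rule a[OF T])
          also have "\<dots> \<le> ennreal (B * 2 powr (- real j * \<delta>)) * ennreal L"
            using lnorm_ge[OF p(3), of "?a s0 p0 T" j] L(2) unfolding besov_norm_eq_lnorm
            by (intro mult_left_mono) (auto intro: order_trans)
          also have "\<dots> = ennreal (B * L * 2 powr (- real j * \<delta>))"
            using B L by (simp add: ennreal_mult[symmetric] mult_ac)
          finally show "?a s1 p1 T j \<le> ennreal (B * L * 2 powr (- real j * \<delta>))" .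
        qed (use B L in simp)
        then show "besov_norm \<phi> s1 p1 q1 T \<le> ennreal (A * B * L)" by (simp add: besov_norm_eq_lnorm mult.assoc)
      qed (use A B in simp)
    qed (use A B in simp)
  qed
qed

end

text \<open>The value 0 off the Schwartz space picks the representative that \<open>tempered\<close>
  prescribes.\<close>

definition tdist :: "(real^'n::finite \<Rightarrow> complex) \<Rightarrow> 'n distr" where
  "tdist g f = (if f \<in> schwartz then (LINT y|lborel. g y * f y) else 0)"

lemma tdist_tempered:
  assumes g: "rapid g" shows "tdist g \<in> tempered"
proof (rule temperedI)
  have i: "integrable lborel (\<lambda>y. g y * f y)" if f: "f \<in> schwartz" for f
  proof -
    obtain B where B: "\<And>x. norm (f x) \<le> B" using rapid_bounded[OF schwartz_rapid[OF f]] by metis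
    have "rapid (\<lambda>y. f y * g y)"
      by (rule rapid_mult_bounded[OF g rapid_continuous[OF schwartz_rapid[OF f]] B])
    then show ?thesis by (simp add: rapid_integrable mult.commute)
  qed
  show "tdist g (\<lambda>x. f x + h x) = tdist g f + tdist g h" if "f \<in> schwartz" "h \<in> schwartz" for f h
    using that i schwartz_add[OF that] by (simp add: tdist_def distrib_left)
  show "tdist g (\<lambda>x. c * f x) = c * tdist g f" if "f \<in> schwartz" for c f
    using that schwartz_cmult[OF that, of c] by (simp add: tdist_def mult.left_commute)
  show "norm (tdist g f) \<le> (LINT y|lborel. norm (g y)) * (\<Sum>\<alpha>\<in>{\<alpha>. length \<alpha> \<le> 0}. sw_sn 0 \<alpha> f)" if f: "f \<in> schwartz" for f
  proof -
    have "norm (tdist g f) \<le> (LINT y|lborel. norm (g y * f y))"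
      using f by (simp add: tdist_def integral_norm_bound)
    also have "\<dots> \<le> (LINT y|lborel. norm (g y) * sw_sn 0 [] f)"
    proof (rule integral_mono)
      show "norm (g y * f y) \<le> norm (g y) * sw_sn 0 [] f" for y
        using sw_sn_ge[OF f, of y 0 "[]"] by (simp add: norm_mult mult_left_mono)
    qed (intro integrable_norm i f integrable_mult_left rapid_norm_integrable g)+
    also have "\<dots> = (LINT y|lborel. norm (g y)) * sw_sn 0 [] f" by simp
    finally show ?thesis by simp
  qed
qed (simp add: tdist_def)

lemma conv_tdist: "\<psi> \<in> schwartz \<Longrightarrow> conv \<psi> (tdist g) = convol g \<psi>"
  by (simp add: fun_eq_iff conv_def tdist_def convol_def schwartz_reflect)

section \<open>Packets living at a single level\<close>

context resolution
begin

text \<open>On this annulus the multiplier of \<open>\<phi> l\<close> equals 1 and all others vanish.\<close>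

definition band :: "nat \<Rightarrow> (real^'n \<Rightarrow> complex) \<Rightarrow> bool" where
  "band l g \<longleftrightarrow> rapid g \<and> (\<forall>\<xi>. fourier g \<xi> \<noteq> 0 \<longrightarrow> rho * 2 ^ l / 2 < norm \<xi> \<and> norm \<xi> < 2 ^ l)"

text \<open>In the annulus the multiplier of \<open>\<phi> 0\<close> stretched by
  \<open>2 ^ j\<close> is 1 for \<open>j \<ge> l\<close> and, because
  \<open>2 * norm \<xi> / 2 ^ l > rho\<close>, 0 for \<open>j < l\<close>. Differences of
  consecutive dilates therefore single out \<open>j = l\<close>.\<close>

lemma fourier_phi_annulus:
  assumes x: "rho * 2 ^ l / 2 < norm \<xi>" "norm \<xi> < 2 ^ l"
  shows "fourier (\<phi> j) \<xi> = (if j = l then 1 else 0)"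
proof -
  have one: "fourier (\<phi> 0) (c *\<^sub>R \<xi>) = 1" if "0 \<le> c" "c \<le> 1 / 2 ^ l" for c
  proof (rule fourier_phi0_eq_1)
    have "norm (c *\<^sub>R \<xi>) \<le> (1 / 2 ^ l) * 2 ^ l" unfolding norm_scaleR
      using that x by (intro mult_mono) auto
    then show "norm (c *\<^sub>R \<xi>) \<le> 1" by simp
  qed
  have zero: "fourier (\<phi> 0) (c *\<^sub>R \<xi>) = 0" if "c \<ge> 2 / 2 ^ l" for c
  proof (rule rho(3))
    have "rho = (2 / 2 ^ l) * (rho * 2 ^ l / 2)" by simp
    also have "\<dots> < (2 / 2 ^ l) * norm \<xi>" using x by (intro mult_strict_left_mono) auto
    also have "\<dots> \<le> c * norm \<xi>" using that by (intro mult_right_mono) auto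
    also have "\<dots> \<le> \<bar>c\<bar> * norm \<xi>" by (intro mult_right_mono) auto
    finally show "rho < norm (c *\<^sub>R \<xi>)" by simp
  qed
  show ?thesis
  proof (cases "j = 0")
    case True
    show ?thesis
    proof (cases "l = 0")
      case False
      then have "(2::real) \<le> 2 ^ l" using power_increasing[of 1 l "2::real"] by simp
      then show ?thesis using zero[of 1] True False by simp
    qed (use one[of 1] True in simp)
  next
    case False
    then have f: "fourier (\<phi> j) \<xi> = fourier (\<phi> 0) ((1 / 2 ^ j) *\<^sub>R \<xi>) - fourier (\<phi> 0) ((2 / 2 ^ j) *\<^sub>R \<xi>)"
      by (intro fourier_phi) simp
    consider "j = l" | "j < l" | "j > l" by linarith
    then show ?thesis
    proof cases
      case 1
      then show ?thesis using f one[of "1 / 2 ^ l"] zero[of "2 / 2 ^ l"] by simp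
    next
      case 2
      then have "(2::real) * 2 ^ j \<le> 2 ^ l" using power_increasing[of "Suc j" l "2::real"] by simp
      then have "2 / 2 ^ l \<le> 1 / (2::real) ^ j" by (simp add: field_simps)
      moreover have "1 / (2::real) ^ j \<le> 2 / 2 ^ j" by (simp add: divide_right_mono)
      ultimately show ?thesis using f zero[of "1 / 2 ^ j"] zero[of "2 / 2 ^ j"] 2 by simp
    next
      case 3
      then have "(2::real) * 2 ^ l \<le> 2 ^ j" using power_increasing[of "Suc l" j "2::real"] by simp
      then have "2 / 2 ^ j \<le> 1 / (2::real) ^ l" by (simp add: field_simps)
      moreover have "1 / (2::real) ^ j \<le> 2 / 2 ^ j" by (simp add: divide_right_mono)
      ultimately show ?thesis using f one[of "1 / 2 ^ j"] one[of "2 / 2 ^ j"] 3 by simp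
    qed
  qed
qed

lemma conv_band:
  assumes g: "band l g" shows "conv (\<phi> j) (tdist g) = (if j = l then g else (\<lambda>x. 0))"
proof -
  have gr: "rapid g" using g by (simp add: band_def)
  have "convol g (\<phi> j) = (if j = l then g else (\<lambda>x. 0))"
  proof (rule fourier_inject)
    fix \<xi>
    have "fourier (convol g (\<phi> j)) \<xi> = fourier g \<xi> * fourier (\<phi> j) \<xi>" by (rule fourier_convol[OF gr phi_rapid])
    also have "\<dots> = fourier (if j = l then g else (\<lambda>x. 0)) \<xi>"
    proof (cases "fourier g \<xi> = 0")
      case True
      then show ?thesis by (simp add: fourier_def)
    next
      case False
      then show ?thesis using g fourier_phi_annulus[of l \<xi> j] by (auto simp: band_def fourier_def)
    qed
    finally show "fourier (convol g (\<phi> j)) \<xi> = fourier (if j = l then g else (\<lambda>x. 0)) \<xi>" .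
  qed (use gr rapid_zero in \<open>auto intro: rapid_convol phi_rapid\<close>)
  then show ?thesis by (simp add: conv_tdist phi_schwartz)
qed

text \<open>The annulus between \<open>rho / 2\<close> and 1 has half-width \<open>4 * eps\<close>.
  A packet with \<open>t \<le> 2 ^ l * eps\<close> has its frequencies within
  \<open>rho * t < 2 ^ l * (2 * eps)\<close> of the midpoint, half of the available
  distance.\<close>

definition eps :: real where "eps = (1 - rho / 2) / 8"

lemma eps_pos: "eps > 0" using rho by (simp add: eps_def)

text \<open>The modulation frequency is the midpoint of the annulus of level l in an arbitrary fixed
  direction; t is the bandwidth and y the centre in space.\<close>

definition packet :: "nat \<Rightarrow> real \<Rightarrow> real^'n \<Rightarrow> real^'n \<Rightarrow> complex" where
  "packet l t y x = cis (2 * pi * (x \<bullet> (2 ^ l * ((1 + rho / 2) / 2)) *\<^sub>R axis undefined 1)) * \<phi> 0 (t *\<^sub>R (x - y))"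

lemma norm_packet: "norm (packet l t y x) = norm (\<phi> 0 (t *\<^sub>R (x - y)))"
  by (simp add: packet_def norm_mult)

lemma band_packet:
  assumes t: "0 < t" "t \<le> 2 ^ l * eps" shows "band l (packet l t y)"
proof -
  let ?\<eta> = "(2 ^ l * ((1 + rho / 2) / 2)) *\<^sub>R axis undefined 1 :: real^'n"
  have r: "rapid (\<lambda>x. \<phi> 0 (t *\<^sub>R (x - y)))"
    using rapid_affine[OF phi_rapid[of 0], of t "- (t *\<^sub>R y)"] t by (simp add: scaleR_diff_right)
  have e: "packet l t y = (\<lambda>x. cis (2 * pi * (x \<bullet> ?\<eta>)) * \<phi> 0 (t *\<^sub>R (x - y)))" by (simp add: packet_def fun_eq_iff)
  show ?thesis
    unfolding band_def
  proof (intro conjI allI impI)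
    show "rapid (packet l t y)" unfolding e by (rule rapid_cis[OF r])
    fix \<xi> assume "fourier (packet l t y) \<xi> \<noteq> 0"
    then have "fourier (\<lambda>x. \<phi> 0 (t *\<^sub>R (x - y))) (\<xi> - ?\<eta>) \<noteq> 0" unfolding e fourier_modulate .
    then have "fourier (\<phi> 0) ((1 / t) *\<^sub>R (\<xi> - ?\<eta>)) \<noteq> 0"
      using t by (subst (asm) fourier_affine[OF phi_rapid]) auto
    then have "norm ((1 / t) *\<^sub>R (\<xi> - ?\<eta>)) \<le> rho" using rho(3) by (meson not_le)
    then have "norm (\<xi> - ?\<eta>) / t \<le> rho" unfolding norm_scaleR using t by simp
    then have "norm (\<xi> - ?\<eta>) \<le> rho * t" unfolding pos_divide_le_eq[OF t(1)] .
    also have "\<dots> < 2 * t" using rho t by simp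
    also have "\<dots> \<le> 2 * (2 ^ l * eps)" using t by simp
    finally have d: "norm (\<xi> - ?\<eta>) < 2 ^ l * (2 * eps)" by simp
    have n: "norm ?\<eta> = 2 ^ l * ((1 + rho / 2) / 2)" using rho by (simp add: abs_mult)
    have "norm \<xi> \<le> norm ?\<eta> + norm (\<xi> - ?\<eta>)" using norm_triangle_ineq[of ?\<eta> "\<xi> - ?\<eta>"] by simp
    also have "\<dots> < 2 ^ l * ((1 + rho / 2) / 2) + 2 ^ l * (2 * eps)" using d n by simp
    also have "\<dots> = 2 ^ l * ((1 + rho / 2) / 2 + 2 * eps)" by (simp add: distrib_left)
    also have "\<dots> \<le> 2 ^ l * 1" using rho(1,2) by (intro mult_left_mono) (auto simp: eps_def field_simps)
    finally show "norm \<xi> < 2 ^ l" by simp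
    have "rho * 2 ^ l / 2 = 2 ^ l * (rho / 2)" by simp
    also have "\<dots> \<le> 2 ^ l * ((1 + rho / 2) / 2 - 2 * eps)" using rho(1,2) by (intro mult_left_mono) (auto simp: eps_def field_simps)
    also have "\<dots> = norm ?\<eta> - 2 ^ l * (2 * eps)" unfolding n by (simp add: right_diff_distrib)
    also have "\<dots> < norm ?\<eta> - norm (\<xi> - ?\<eta>)" using d by simp
    also have "\<dots> \<le> norm \<xi>" using norm_triangle_ineq[of \<xi> "?\<eta> - \<xi>"] by (simp add: norm_minus_commute)
    finally show "rho * 2 ^ l / 2 < norm \<xi>" .
  qed
qed

lemma phi0_nonzero: obtains w where "\<phi> 0 w \<noteq> 0"
proof -
  have "\<exists>w. \<phi> 0 w \<noteq> 0"
  proof (rule ccontr)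
    assume "\<nexists>w. \<phi> 0 w \<noteq> 0"
    then have "fourier (\<phi> 0) 0 = 0" by (simp add: fourier_def)
    then show False using fourier_phi0_eq_1[of 0] by simp
  qed
  then show ?thesis using that by blast
qed

definition phi0_norm :: "ennreal \<Rightarrow> real" where "phi0_norm p = enn2real (Lp_en p (\<phi> 0))"

lemma phi0_norm_nonneg: "phi0_norm p \<ge> 0"
  by (simp add: phi0_norm_def)

lemma Lp_phi0_finite:
  assumes p: "0 < p" shows "Lp_en p (\<phi> 0) = ennreal (phi0_norm p)"
proof -
  have [measurable]: "\<phi> 0 \<in> borel_measurable borel" using phi_rapid by (rule rapid_measurable)
  have "Lp_en p (\<phi> 0) < top"
  proof (cases "p = top")
    case True
    obtain B where "\<And>x. norm (\<phi> 0 x) \<le> B" using rapid_bounded[OF phi_rapid] by metis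
    then have "Lp_en p (\<phi> 0) \<le> ennreal B"
      unfolding Lp_en_eq_Lnorm True by (intro Lnorm_top_le) (auto intro: ennreal_leI)
    then show ?thesis by (rule le_less_trans) simp
  next
    case False
    then obtain r where r: "p = ennreal r" "r > 0" using p by (cases p) auto
    let ?m = "2 * DIM(real^'n)"
    \<comment> \<open>The order of decay of \<open>\<phi> 0\<close> has to be chosen after r: order
      k with \<open>k r\<close> at least \<open>2 * DIM\<close> makes the r-th power integrable,
      however small r is.\<close>
    obtain k :: nat where k: "real ?m / r \<le> real k" using real_arch_simple by blast
    obtain C where C: "C > 0" "\<And>x. norm (\<phi> 0 x) \<le> C / (1 + norm x) ^ k" using rapid_boundE[OF phi_rapid] by metis
    have pt: "norm (\<phi> 0 x) powr r \<le> C powr r * (1 / (1 + norm x) ^ ?m)" for x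
    proof -
      have b: "1 + norm x > 0" by (simp add: add_pos_nonneg)
      have "norm (\<phi> 0 x) powr r \<le> (C / (1 + norm x) ^ k) powr r"
        using r by (intro powr_mono2 C) auto
      also have "\<dots> = C powr r / (1 + norm x) powr (real k * r)"
        using C b by (simp add: powr_divide powr_realpow[symmetric] powr_powr)
      also have "\<dots> \<le> C powr r / (1 + norm x) powr real ?m"
        by (intro divide_left_mono powr_mono mult_pos_pos) (use k r b in \<open>auto simp: field_simps\<close>)
      also have "\<dots> = C powr r * (1 / (1 + norm x) ^ ?m)" unfolding powr_realpow[OF b] by simp
      finally show ?thesis .
    qed
    have "integrable lborel (\<lambda>x. norm (\<phi> 0 x) powr r)"
    proof (rule Bochner_Integration.integrable_bound)
      show "integrable lborel (\<lambda>x::real^'n. C powr r * (1 / (1 + norm x) ^ ?m))"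
        by (intro integrable_mult_right integrable_inverse_weight)
      show "AE x in lborel. norm (norm (\<phi> 0 x) powr r) \<le> norm (C powr r * (1 / (1 + norm x) ^ ?m))"
        using pt by (intro AE_I2) (auto intro: order_trans[OF _ abs_ge_self])
    qed measurable
    then have "(\<integral>\<^sup>+x. ennreal (norm (\<phi> 0 x) powr r) \<partial>lborel) < top"
      by (simp add: integrable_iff_bounded)
    then show ?thesis using r by (simp add: Lp_en_def enn_powr_def)
  qed
  then show ?thesis by (simp add: phi0_norm_def)
qed

lemma Lp_packet:
  assumes p: "0 < p" and t: "0 < t"
  shows "Lp_en p (packet l t y) = ennreal (t powr (- (real CARD('n) * inv_en p)) * phi0_norm p)"
proof (cases "p = top")
  case True
  have c: "continuous_on UNIV (\<phi> 0)" by (rule rapid_continuous[OF phi_rapid])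
  have ct: "continuous_on UNIV (packet l t y)"
    unfolding packet_def[abs_def]
    by (intro continuous_intros continuous_on_compose2[OF c]) auto
  have Dp: "phi0_norm p \<ge> 0" by (rule phi0_norm_nonneg)
  have m: "\<phi> 0 \<in> borel_measurable borel" "packet l t y \<in> borel_measurable borel"
    using c ct by (auto intro: borel_measurable_continuous_onI)
  have b: "norm (\<phi> 0 x) \<le> phi0_norm p" for x
    using norm_le_Lp_top[OF c, of "phi0_norm p" x] Lp_phi0_finite[OF p] True Dp by simp
  have 1: "Lp_en p (packet l t y) \<le> ennreal (phi0_norm p)"
    unfolding Lp_en_eq_Lnorm True using m b by (intro Lnorm_top_le) (auto simp: norm_packet True intro!: ennreal_leI)
  then obtain L where L: "Lp_en p (packet l t y) = ennreal L" "L \<ge> 0"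
    by (cases "Lp_en p (packet l t y)") (auto simp: top_unique)
  have "norm (\<phi> 0 x) \<le> L" for x
    using norm_le_Lp_top[OF ct, of L "(1 / t) *\<^sub>R x + y"] L t True by (simp add: norm_packet)
  then have "Lp_en p (\<phi> 0) \<le> ennreal L"
    unfolding Lp_en_eq_Lnorm True using m by (intro Lnorm_top_le) (auto intro!: ennreal_leI)
  then have "phi0_norm p \<le> L" using L by (simp add: Lp_phi0_finite[OF p] ennreal_le_iff)
  moreover have "L \<le> phi0_norm p" using 1 L Dp by (simp add: ennreal_le_iff)
  ultimately show ?thesis using L t True by (simp add: inv_en_def)
next
  case False
  then obtain r where r: "p = ennreal r" "r > 0" using p by (cases p) auto
  have [measurable]: "\<phi> 0 \<in> borel_measurable borel" using phi_rapid by (rule rapid_measurable)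
  let ?u = "\<lambda>x. ennreal (norm (\<phi> 0 x) powr r)"
  have "(\<integral>\<^sup>+x. ennreal (norm (packet l t y x) powr r) \<partial>lborel) = (\<integral>\<^sup>+x. ?u (t *\<^sub>R x + - (t *\<^sub>R y)) \<partial>lborel)"
    by (simp add: norm_packet scaleR_diff_right)
  also have "\<dots> = ennreal (1 / \<bar>t\<bar> ^ CARD('n)) * (\<integral>\<^sup>+x. ?u x \<partial>lborel)"
    using t by (subst lborel_nn_integral_affine) auto
  finally have "Lp_en p (packet l t y) = enn_powr (ennreal (1 / t ^ CARD('n))) (1 / r) * Lp_en p (\<phi> 0)"
    using r t by (simp add: Lp_en_def enn_powr_mult)
  also have "\<dots> = ennreal ((1 / t ^ CARD('n)) powr (1 / r) * phi0_norm p)"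
    using t phi0_norm_nonneg by (simp add: Lp_phi0_finite[OF p] enn_powr_ennreal ennreal_mult)
  also have "(1 / t ^ CARD('n)) powr (1 / r) = t powr (- (real CARD('n) * inv_en p))"
    using t r by (simp add: inv_en_def powr_divide powr_realpow[symmetric] powr_powr powr_minus_divide)
  finally show ?thesis .
qed

text \<open>By the Nikolskii bound a packet whose quasi-norm vanishes would vanish
  pointwise.\<close>

lemma phi0_norm_pos:
  assumes p: "0 < p" shows "phi0_norm p > 0"
proof (rule ccontr)
  assume "\<not> phi0_norm p > 0"
  then have z: "phi0_norm p = 0" using phi0_norm_nonneg[of p] by linarith
  have bd: "band 0 (packet 0 eps 0)" using eps_pos by (intro band_packet) auto
  then have T: "tdist (packet 0 eps 0) \<in> tempered" by (intro tdist_tempered) (simp add: band_def)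
  obtain w where w: "\<phi> 0 w \<noteq> 0" using phi0_nonzero by blast
  obtain C where C: "C > 0" "\<And>L x. L > 0 \<Longrightarrow> Lp_en p (conv (\<phi> 0) (tdist (packet 0 eps 0))) \<le> ennreal L \<Longrightarrow>
     norm (conv (\<phi> 0) (tdist (packet 0 eps 0)) x) \<le> C * 2 powr (real 0 * (real CARD('n) * inv_en p)) * L"
    using nikolskii_sup[OF p] T by metis
  have "norm (packet 0 eps 0 x) \<le> C * L" if "L > 0" for L x
    using C(2)[OF that, of x] that by (simp add: conv_band[OF bd] Lp_packet[OF p eps_pos] z)
  \<comment> \<open>With this L the bound \<open>C * L\<close> is half of the modulus of the packet
    at the chosen point.\<close>
  from this[of "norm (\<phi> 0 w) / (2 * C)" "(1 / eps) *\<^sub>R w"] show False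
    using w C eps_pos by (simp add: norm_packet)
qed

lemma besov_norm_band:
  assumes g: "band l g" and p: "0 < p" "0 < q"
  shows "besov_norm \<phi> s p q (tdist g) = ennreal (2 powr (real l * s)) * Lp_en p g"
  unfolding besov_norm_eq_lnorm conv_band[OF g]
  using p by (subst lnorm_single[where l=l]) (auto simp: Lp_en_zero)

lemma besov_packet:
  assumes t: "0 < t" "t \<le> 2 ^ l * eps" and p: "0 < p" "0 < q"
  shows "tdist (packet l t y) \<in> besov \<phi> s p q"
    "besov_norm \<phi> s p q (tdist (packet l t y)) = ennreal (2 powr (real l * s) * (t powr (- (real CARD('n) * inv_en p)) * phi0_norm p))"
proof -
  show *: "besov_norm \<phi> s p q (tdist (packet l t y)) = ennreal (2 powr (real l * s) * (t powr (- (real CARD('n) * inv_en p)) * phi0_norm p))"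
    using phi0_norm_pos[OF p(1)] by (simp add: besov_norm_band[OF band_packet[OF t] p] Lp_packet[OF p(1) t(1)] ennreal_mult)
  show "tdist (packet l t y) \<in> besov \<phi> s p q"
    using band_packet[OF t, of y] by (simp add: besov_def * tdist_tempered band_def)
qed

text \<open>Comparing the explicit norms of one packet leaves two free parameters. Maximal bandwidth
  \<open>t = 2 ^ l * eps\<close> with growing l detects too little smoothness; level 0 with t
  tending to 0 detects \<open>p1 < p0\<close>.\<close>

lemma embeds_packet_bound:
  assumes em: "embeds (besov \<phi> s0 p0 q0) (besov_norm \<phi> s0 p0 q0) (besov \<phi> s1 p1 q1) (besov_norm \<phi> s1 p1 q1)"
    and p: "0 < p0" "0 < p1" "0 < q0" "0 < q1"
  obtains K where "\<And>l t. 0 < t \<Longrightarrow> t \<le> 2 ^ l * eps \<Longrightarrow>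
     2 powr (real l * (s1 - s0)) * t powr (real CARD('n) * inv_en p0 - real CARD('n) * inv_en p1) \<le> K"
proof -
  obtain C0 :: real where C0: "\<And>f. f \<in> besov \<phi> s0 p0 q0 \<Longrightarrow> besov_norm \<phi> s1 p1 q1 f \<le> ennreal C0 * besov_norm \<phi> s0 p0 q0 f"
    using em by (auto simp: embeds_def)
  define C where "C = max C0 0"
  have C: "ennreal C0 = ennreal C" "C \<ge> 0" by (auto simp: C_def max_def ennreal_neg)
  show ?thesis
  proof (rule that[of "C * phi0_norm p0 / phi0_norm p1"])
    fix l t assume t: "0 < t" "t \<le> 2 ^ l * eps"
    let ?n = "real CARD('n)"
    note D = phi0_norm_pos[OF p(1)] phi0_norm_pos[OF p(2)]
    have "ennreal (2 powr (real l * s1) * (t powr (- (?n * inv_en p1)) * phi0_norm p1)) \<le>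
       ennreal C * ennreal (2 powr (real l * s0) * (t powr (- (?n * inv_en p0)) * phi0_norm p0))"
      using C0[OF besov_packet(1)[OF t p(1,3)], of 0] C by (simp add: besov_packet(2)[OF t p(1,3)] besov_packet(2)[OF t p(2,4)])
    then have "2 powr (real l * s1) * (t powr (- (?n * inv_en p1)) * phi0_norm p1) \<le>
       C * (2 powr (real l * s0) * (t powr (- (?n * inv_en p0)) * phi0_norm p0))"
      using C D by (simp add: ennreal_mult[symmetric] ennreal_le_iff)
    then have "(2 powr (real l * s1) * t powr (- (?n * inv_en p1))) / (2 powr (real l * s0) * t powr (- (?n * inv_en p0))) \<le> C * phi0_norm p0 / phi0_norm p1"
      using D t by (simp add: field_simps)
    also have "(2 powr (real l * s1) * t powr (- (?n * inv_en p1))) / (2 powr (real l * s0) * t powr (- (?n * inv_en p0)))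
       = 2 powr (real l * (s1 - s0)) * t powr (?n * inv_en p0 - ?n * inv_en p1)"
      by (simp add: right_diff_distrib powr_diff powr_minus field_simps)
    finally show "2 powr (real l * (s1 - s0)) * t powr (?n * inv_en p0 - ?n * inv_en p1) \<le> C * phi0_norm p0 / phi0_norm p1" .
  qed
qed

lemma not_embeds_smoothness:
  assumes p: "0 < p0" "0 < p1" "0 < q0" "0 < q1"
    and s: "s0 - s1 < real CARD('n) * inv_en p0 - real CARD('n) * inv_en p1"
  shows "\<not> embeds (besov \<phi> s0 p0 q0) (besov_norm \<phi> s0 p0 q0) (besov \<phi> s1 p1 q1) (besov_norm \<phi> s1 p1 q1)"
proof
  let ?d = "real CARD('n) * inv_en p0 - real CARD('n) * inv_en p1"
  assume "embeds (besov \<phi> s0 p0 q0) (besov_norm \<phi> s0 p0 q0) (besov \<phi> s1 p1 q1) (besov_norm \<phi> s1 p1 q1)"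
  then obtain K where K: "\<And>l t. 0 < t \<Longrightarrow> t \<le> 2 ^ l * eps \<Longrightarrow> 2 powr (real l * (s1 - s0)) * t powr ?d \<le> K"
    using embeds_packet_bound[OF _ p] by metis
  have "2 powr (real l * (?d - (s0 - s1))) \<le> K / eps powr ?d" for l
  proof -
    have "2 powr (real l * (s1 - s0)) * (2 ^ l * eps) powr ?d \<le> K"
      using eps_pos by (intro K) auto
    also have "(2 ^ l * eps) powr ?d = 2 powr (real l * ?d) * eps powr ?d"
      using eps_pos by (simp add: powr_mult powr_realpow[symmetric] powr_powr)
    finally have "2 powr (real l * (s1 - s0)) * 2 powr (real l * ?d) \<le> K / eps powr ?d"
      using eps_pos by (simp add: pos_le_divide_eq mult.assoc)
    then show ?thesis by (simp add: powr_add[symmetric] algebra_simps)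
  qed
  then show False using s by (intro exponential_unbounded[of "?d - (s0 - s1)"]) auto
qed

lemma not_embeds_integrability:
  assumes p: "0 < p0" "0 < p1" "0 < q0" "0 < q1" and pp: "p1 < p0"
  shows "\<not> embeds (besov \<phi> s0 p0 q0) (besov_norm \<phi> s0 p0 q0) (besov \<phi> s1 p1 q1) (besov_norm \<phi> s1 p1 q1)"
proof
  let ?d = "real CARD('n) * inv_en p0 - real CARD('n) * inv_en p1"
  have d: "?d < 0" using inv_en_le_iff[OF p(1,2)] pp by (auto simp: not_le right_diff_distrib[symmetric] mult_pos_neg)
  assume "embeds (besov \<phi> s0 p0 q0) (besov_norm \<phi> s0 p0 q0) (besov \<phi> s1 p1 q1) (besov_norm \<phi> s1 p1 q1)"
  then obtain K where K: "\<And>l t. 0 < t \<Longrightarrow> t \<le> 2 ^ l * eps \<Longrightarrow> 2 powr (real l * (s1 - s0)) * t powr ?d \<le> K"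
    using embeds_packet_bound[OF _ p] by metis
  define e where "e = ?d"
  have "2 powr (real m * (- e)) \<le> K / eps powr e" for m :: nat
  proof -
    have le: "eps * 2 powr (- real m) \<le> eps * 2 powr 0"
      using eps_pos by (intro mult_left_mono powr_mono) auto
    have "2 powr (real 0 * (s1 - s0)) * (eps * 2 powr (- real m)) powr e \<le> K"
      unfolding e_def using eps_pos le by (intro K) auto
    then have "eps powr e * 2 powr (real m * (- e)) \<le> K"
      using eps_pos by (simp add: powr_mult powr_powr)
    then show ?thesis using eps_pos by (simp add: pos_le_divide_eq mult.commute)
  qed
  then show False using d unfolding e_def[symmetric] by (intro exponential_unbounded[of "- e"]) auto
qed

text \<open>At bandwidth \<open>2 ^ j * eps\<close> the j-th packet has quasi-norm proportional to
  \<open>2 powr (- j n / p)\<close>. Thus s and p enter the sequence only through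
  \<open>s - n / p\<close>, and the ladder is a weighted copy of l_q.\<close>

lemma besov_norm_ladder:
  assumes p: "0 < p" "0 < q" and T: "\<And>j x. conv (\<phi> j) T x = c j * packet j (2 ^ j * eps) 0 x"
  shows "besov_norm \<phi> s p q T = ennreal (eps powr (- (real CARD('n) * inv_en p)) * phi0_norm p) *
     lnorm q (\<lambda>j. ennreal (norm (c j) * 2 powr (real j * (s - real CARD('n) * inv_en p))))"
proof -
  let ?n = "real CARD('n)"
  have e: "2 ^ j * eps > 0" for j using eps_pos by simp
  have "ennreal (2 powr (real j * s)) * Lp_en p (conv (\<phi> j) T) =
    ennreal (eps powr (- (?n * inv_en p)) * phi0_norm p) * ennreal (norm (c j) * 2 powr (real j * (s - ?n * inv_en p)))" for j
  proof -
    have b: "band j (packet j (2 ^ j * eps) 0)" using e by (intro band_packet) auto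
    have "conv (\<phi> j) T = (\<lambda>x. c j * packet j (2 ^ j * eps) 0 x)" using T by blast
    then have "Lp_en p (conv (\<phi> j) T) = ennreal (norm (c j)) * ennreal ((2 ^ j * eps) powr (- (?n * inv_en p)) * phi0_norm p)"
      using b by (simp add: Lp_en_cmult[OF rapid_continuous p(1)] band_def Lp_packet[OF p(1) e])
    also have "(2 ^ j * eps) powr (- (?n * inv_en p)) = 2 powr (real j * - (?n * inv_en p)) * eps powr (- (?n * inv_en p))"
      using eps_pos by (simp add: powr_mult powr_realpow[symmetric] powr_powr)
    finally have "ennreal (2 powr (real j * s)) * Lp_en p (conv (\<phi> j) T) =
      ennreal (2 powr (real j * s) * (norm (c j) * ((2 powr (real j * - (?n * inv_en p)) * eps powr (- (?n * inv_en p))) * phi0_norm p)))"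
      using phi0_norm_pos[OF p(1)] by (simp add: ennreal_mult)
    also have "2 powr (real j * s) * (norm (c j) * ((2 powr (real j * - (?n * inv_en p)) * eps powr (- (?n * inv_en p))) * phi0_norm p))
      = (eps powr (- (?n * inv_en p)) * phi0_norm p) * (norm (c j) * (2 powr (real j * s) * 2 powr (real j * - (?n * inv_en p))))"
      by (simp only: mult_ac)
    also have "2 powr (real j * s) * 2 powr (real j * - (?n * inv_en p)) = 2 powr (real j * (s - ?n * inv_en p))"
      by (simp add: powr_add[symmetric] algebra_simps)
    finally show ?thesis using phi0_norm_pos[OF p(1)] by (simp add: ennreal_mult)
  qed
  then show ?thesis
    unfolding besov_norm_eq_lnorm using p phi0_norm_pos[OF p(1)] by (simp add: Lnorm_cmult)
qed

definition ladder :: "nat \<Rightarrow> 'n distr" where "ladder i = tdist (packet i (2 ^ i * eps) 0)"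

lemma ladder_besov: "0 < p \<Longrightarrow> 0 < q \<Longrightarrow> ladder i \<in> besov \<phi> s p q"
  unfolding ladder_def using eps_pos by (intro besov_packet(1)) auto

lemma conv_ladder: "conv (\<phi> j) (ladder i) x = (if j = i then packet j (2 ^ j * eps) 0 x else 0)"
proof -
  have "band i (packet i (2 ^ i * eps) 0)" using eps_pos by (intro band_packet) auto
  then show ?thesis by (simp add: ladder_def conv_band)
qed

lemma conv_lincomb_ladder:
  "conv (\<phi> j) (lincomb K c ladder) x = (if j < K then c j else 0) * packet j (2 ^ j * eps) 0 x"
proof -
  have "(\<Sum>i<K. c i * (if j = i then packet j (2 ^ j * eps) 0 x else 0)) = (\<Sum>i<K. if j = i then c i * packet j (2 ^ j * eps) 0 x else 0)"
    by (intro sum.cong) auto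
  then show ?thesis by (simp add: conv_lincomb conv_ladder)
qed

lemma not_embeds_fine_index:
  assumes p: "0 < p0" "0 < p1" "0 < q0" "0 < q1" and qq: "q1 < q0"
    and s: "s0 - s1 = real CARD('n) * inv_en p0 - real CARD('n) * inv_en p1"
  shows "\<not> embeds (besov \<phi> s0 p0 q0) (besov_norm \<phi> s0 p0 q0) (besov \<phi> s1 p1 q1) (besov_norm \<phi> s1 p1 q1)"
proof
  let ?n = "real CARD('n)"
  assume em: "embeds (besov \<phi> s0 p0 q0) (besov_norm \<phi> s0 p0 q0) (besov \<phi> s1 p1 q1) (besov_norm \<phi> s1 p1 q1)"
  obtain C0 :: real where C0: "\<And>f. f \<in> besov \<phi> s0 p0 q0 \<Longrightarrow> besov_norm \<phi> s1 p1 q1 f \<le> ennreal C0 * besov_norm \<phi> s0 p0 q0 f"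
    using em by (auto simp: embeds_def)
  define C where "C = max C0 0"
  have C: "ennreal C0 = ennreal C" "C \<ge> 0" by (auto simp: C_def max_def ennreal_neg)
  define a where "a = s0 - ?n * inv_en p0"
  have a1: "s1 - ?n * inv_en p1 = a" using s by (simp add: a_def)
  \<comment> \<open>These coefficients cancel the common weight, so K levels contribute K equal
    terms and the norm is a multiple of \<open>K powr (1/q)\<close>.\<close>
  define c where "c = (\<lambda>j::nat. complex_of_real (2 powr (- real j * a)))"
  let ?A = "\<lambda>p. eps powr (- (?n * inv_en p)) * phi0_norm p"
  have A: "?A p > 0" if "0 < p" for p using eps_pos phi0_norm_pos[OF that] by simp
  have N: "besov_norm \<phi> s p q (lincomb K c ladder) = ennreal (?A p * real K powr inv_en q)"
    if "0 < p" "0 < q" "s - ?n * inv_en p = a" "K > 0" for s p q K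
  proof -
    have e: "norm (if j < K then c j else 0) * 2 powr (real j * a) = (if j < K then 1 else 0)" for j
      by (simp add: c_def powr_add[symmetric])
    have "besov_norm \<phi> s p q (lincomb K c ladder) = ennreal (?A p) * lnorm q (\<lambda>j. ennreal (if j < K then 1 else 0))"
      unfolding besov_norm_ladder[OF that(1,2) conv_lincomb_ladder] that(3) e ..
    also have "(\<lambda>j. ennreal (if j < K then 1 else 0)) = (\<lambda>j. if j < K then ennreal 1 else 0)"
      by auto
    also have "ennreal (?A p) * lnorm q (\<lambda>j. if j < K then ennreal 1 else 0) = ennreal (?A p * real K powr inv_en q)"
      using that A[OF that(1)] by (subst lnorm_indicator) (auto simp: ennreal_mult)
    finally show ?thesis .
  qed
  have i: "inv_en q0 < inv_en q1" using inv_en_le_iff[OF p(3,4)] qq by (metis not_le)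
  have "2 powr (real m * (inv_en q1 - inv_en q0)) \<le> C * ?A p0 / ?A p1" for m :: nat
  proof -
    define K where "K = (2::nat) ^ m"
    have K: "K > 0" "real K = 2 powr real m" by (simp_all add: K_def powr_realpow)
    have "lincomb K c ladder \<in> besov \<phi> s0 p0 q0" by (intro besov_lincomb ladder_besov p)
    from C0[OF this] have "ennreal (?A p1 * real K powr inv_en q1) \<le> ennreal C * ennreal (?A p0 * real K powr inv_en q0)"
      unfolding C(1) N[OF p(1,3) a_def[symmetric] K(1)] N[OF p(2,4) a1 K(1)] .
    then have "?A p1 * real K powr inv_en q1 \<le> C * (?A p0 * real K powr inv_en q0)"
      using C A[OF p(1)] A[OF p(2)] by (subst (asm) ennreal_mult[symmetric]) (auto simp: ennreal_le_iff)
    then have "real K powr inv_en q1 / real K powr inv_en q0 \<le> C * ?A p0 / ?A p1"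
      using A[OF p(2)] K(1) by (simp add: pos_divide_le_eq pos_le_divide_eq mult_ac)
    also have "real K powr inv_en q1 / real K powr inv_en q0 = 2 powr (real m * (inv_en q1 - inv_en q0))"
      unfolding K(2) by (simp add: powr_powr powr_diff right_diff_distrib)
    finally show ?thesis .
  qed
  then show False using i by (intro exponential_unbounded[of "inv_en q1 - inv_en q0"]) auto
qed

end

section \<open>Strict singularity and compactness\<close>

text \<open>A subspace Z with \<open>nX \<le> C nY\<close> contains independent families of every
  length, and on the vectors of source norm 1 in their spans \<open>nY \<ge> 1 / C\<close>. So all
  Bernstein numbers are at least \<open>1 / C\<close>.\<close>

lemma fin_strictly_singular_imp_strictly_singular:
  assumes "fin_strictly_singular X nX nY"
  shows "strictly_singular X nX nY"
  unfolding strictly_singular_def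
proof (rule notI, elim exE conjE)
  fix Z and C0 :: real
  assume Z: "Z \<subseteq> X" "(\<lambda>f. 0) \<in> Z" "\<forall>x\<in>Z. \<forall>y\<in>Z. (\<lambda>f. x f + y f) \<in> Z"
      "\<forall>c. \<forall>x\<in>Z. (\<lambda>f. c * x f) \<in> Z" "\<forall>k. \<exists>e. (\<forall>i<k. e i \<in> Z) \<and> lin_indep k e"
      "\<forall>x\<in>Z. nX x \<le> ennreal C0 * nY x"
  \<comment> \<open>The given constant may be zero or negative; the lower bound \<open>1 / C\<close>
    calls for a positive one.\<close>
  define C where "C = max C0 1"
  have C: "C > 0" "ennreal C0 \<le> ennreal C" by (auto simp: C_def intro: ennreal_leI)
  have lc: "lincomb K c e \<in> Z" if "\<And>i. i < K \<Longrightarrow> e i \<in> Z" for K c e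
    using that
  proof (induction K)
    case 0
    then show ?case using Z(2) by (simp add: lincomb_def)
  next
    case (Suc K)
    have 1: "lincomb K c e \<in> Z" by (rule Suc.IH) (use Suc.prems in auto)
    have 2: "e K \<in> Z" by (rule Suc.prems) simp
    show ?case unfolding lincomb_Suc using Z(3,4) 1 2 by simp
  qed
  have "ennreal (1 / C) \<le> bernstein X nX nY k" for k
  proof -
    obtain e where e: "\<And>i. i < k \<Longrightarrow> e i \<in> Z" "lin_indep k e" using Z(5) by metis
    have "ennreal (1 / C) \<le> (INF c \<in> {c. nX (lincomb k c e) = 1}. nY (lincomb k c e))"
    proof (rule INF_greatest)
      fix c assume "c \<in> {c. nX (lincomb k c e) = 1}"
      then have "1 \<le> ennreal C0 * nY (lincomb k c e)" using bspec[OF Z(6) lc[where K=k and c=c and e=e, OF e(1)]] by simp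
      also have "\<dots> \<le> ennreal C * nY (lincomb k c e)" by (intro mult_right_mono C) simp
      finally have "ennreal (1 / C) * 1 \<le> ennreal (1 / C) * (ennreal C * nY (lincomb k c e))"
        by (intro mult_left_mono) auto
      also have "\<dots> = nY (lincomb k c e)"
        using C by (simp add: mult.assoc[symmetric] ennreal_mult[symmetric])
      finally show "ennreal (1 / C) \<le> nY (lincomb k c e)" by simp
    qed
    also have "\<dots> \<le> bernstein X nX nY k"
      unfolding bernstein_def using e Z(1) by (intro SUP_upper) auto
    finally show ?thesis .
  qed
  moreover have "bernstein X nX nY \<longlonglongrightarrow> 0" using assms by (simp add: fin_strictly_singular_def)
  ultimately have "ennreal (1 / C) \<le> 0"
    by (intro LIMSEQ_le_const[of "bernstein X nX nY"]) auto
  then show False using C by simp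
qed

context resolution
begin

section \<open>Separated translates and ladders of packets\<close>

lemma zero_besov: "0 < p \<Longrightarrow> 0 < q \<Longrightarrow> (\<lambda>f. 0) \<in> besov \<phi> s p q"
  using besov_lincomb[of 0] by (simp add: lincomb_def)

lemma phi0_decay:
  assumes "\<eta> > 0"
  obtains R where "R > 0" "\<And>z. norm z \<ge> R \<Longrightarrow> norm (\<phi> 0 (eps *\<^sub>R (z + v))) \<le> \<eta>"
proof -
  obtain C where C: "C > 0" "\<And>x. norm (\<phi> 0 x) \<le> C / (1 + norm x) ^ 1" using rapid_boundE[OF phi_rapid] by metis
  show ?thesis
  proof (rule that[of "norm v + C / (\<eta> * eps)"])
    show "norm v + C / (\<eta> * eps) > 0" using C eps_pos assms by (simp add: add_nonneg_pos)
    fix z :: "real^'n" assume z: "norm z \<ge> norm v + C / (\<eta> * eps)"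
    have "norm z \<le> norm (z + v) + norm v" using norm_triangle_ineq4[of "z + v" v] by simp
    then have "C / (\<eta> * eps) \<le> norm (z + v)" using z by linarith
    then have "eps * (C / (\<eta> * eps)) \<le> eps * norm (z + v)" using eps_pos by (intro mult_left_mono) auto
    then have "C / \<eta> \<le> 1 + norm (eps *\<^sub>R (z + v))" using eps_pos assms by simp
    then have "C \<le> \<eta> * (1 + norm (eps *\<^sub>R (z + v)))" using assms by (simp add: pos_divide_le_eq mult.commute)
    then have "C / (1 + norm (eps *\<^sub>R (z + v))) \<le> \<eta>"
      by (subst pos_divide_le_eq) (auto simp: add_pos_nonneg)
    then show "norm (\<phi> 0 (eps *\<^sub>R (z + v))) \<le> \<eta>" using C(2)[of "eps *\<^sub>R (z + v)"] by simp
  qed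
qed

definition spaced_pt :: "real \<Rightarrow> nat \<Rightarrow> real^'n" where "spaced_pt R k = (real k * R) *\<^sub>R axis undefined 1"

definition translate :: "real \<Rightarrow> nat \<Rightarrow> 'n distr" where "translate R k = tdist (packet 0 eps (spaced_pt R k))"

lemma spaced_pt_separated:
  assumes "R > 0" "a \<noteq> b" shows "norm (spaced_pt R a - spaced_pt R b) \<ge> R"
proof -
  have "spaced_pt R a - spaced_pt R b = ((real a - real b) * R) *\<^sub>R axis undefined 1"
    by (simp add: spaced_pt_def left_diff_distrib scaleR_diff_left)
  then have "norm (spaced_pt R a - spaced_pt R b) = \<bar>real a - real b\<bar> * R" using assms by (simp add: abs_mult)
  moreover have "\<bar>real a - real b\<bar> \<ge> 1" using assms(2) by linarith
  ultimately show ?thesis using assms(1) by simp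
qed

lemma conv_translate: "conv (\<phi> j) (translate R k) = (if j = 0 then packet 0 eps (spaced_pt R k) else (\<lambda>x. 0))"
  unfolding translate_def using eps_pos by (intro conv_band band_packet) auto

lemma translate_besov:
  "0 < p \<Longrightarrow> 0 < q \<Longrightarrow> translate R k \<in> besov \<phi> s p q"
  "0 < p \<Longrightarrow> 0 < q \<Longrightarrow> besov_norm \<phi> s p q (translate R k) = ennreal (eps powr (- (real CARD('n) * inv_en p)) * phi0_norm p)"
  unfolding translate_def using eps_pos besov_packet[of eps 0] by auto

text \<open>The offset w is chosen where the packet does not vanish; at the point belonging to one
  translate all others are small once the spacing R is large. This separation yields both linear
  independence and non-compactness.\<close>

lemma translates_spread:
  obtains c w where "c > 0" "\<And>R k. norm (packet 0 eps (spaced_pt R k) (spaced_pt R k + w)) = c"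
    "\<And>\<eta>. \<eta> > 0 \<Longrightarrow> \<exists>R>0. \<forall>i m. i \<noteq> m \<longrightarrow> norm (packet 0 eps (spaced_pt R i) (spaced_pt R m + w)) \<le> \<eta>"
proof -
  obtain w0 where w0: "\<phi> 0 w0 \<noteq> 0" using phi0_nonzero by blast
  define w where "w = (1 / eps) *\<^sub>R w0"
  show ?thesis
  proof (rule that[of "norm (\<phi> 0 w0)" w])
    show "norm (packet 0 eps (spaced_pt R k) (spaced_pt R k + w)) = norm (\<phi> 0 w0)" for R k
      using eps_pos by (simp add: norm_packet w_def)
    fix \<eta> :: real assume "\<eta> > 0"
    then obtain R where R: "R > 0" "\<And>z. norm z \<ge> R \<Longrightarrow> norm (\<phi> 0 (eps *\<^sub>R (z + w))) \<le> \<eta>"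
      using phi0_decay[of \<eta> w] by metis
    have "norm (packet 0 eps (spaced_pt R i) (spaced_pt R m + w)) \<le> \<eta>" if "i \<noteq> m" for i m
      using R(2)[of "spaced_pt R m - spaced_pt R i"] spaced_pt_separated[OF R(1), of m i] that by (simp add: norm_packet algebra_simps)
    then show "\<exists>R>0. \<forall>i m. i \<noteq> m \<longrightarrow> norm (packet 0 eps (spaced_pt R i) (spaced_pt R m + w)) \<le> \<eta>" using R(1) by blast
  qed (use w0 in simp)
qed

text \<open>Diagonal dominance: a vanishing combination is evaluated at the point of the largest
  coefficient. The other \<open>K - 1\<close> terms are each at most \<open>1 / (K + 1)\<close> of
  the diagonal one, so they cannot cancel it.\<close>

lemma lin_indep_translate: "\<exists>R. lin_indep K (translate R)"
proof -
  obtain a w where a: "a > 0" "\<And>R k. norm (packet 0 eps (spaced_pt R k) (spaced_pt R k + w)) = a"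
    "\<And>\<eta>. \<eta> > 0 \<Longrightarrow> \<exists>R>0. \<forall>i m. i \<noteq> m \<longrightarrow> norm (packet 0 eps (spaced_pt R i) (spaced_pt R m + w)) \<le> \<eta>"
    using translates_spread by blast
  have "a / (real K + 1) > 0" using a(1) by simp
  then obtain R where R: "\<And>i m. i \<noteq> m \<Longrightarrow> norm (packet 0 eps (spaced_pt R i) (spaced_pt R m + w)) \<le> a / (real K + 1)"
    using a(3) by metis
  have "lin_indep K (translate R)"
    unfolding lin_indep_def
  proof (intro allI impI, rule ccontr)
    fix c i assume z: "lincomb K c (translate R) = (\<lambda>f. 0)" and i: "i < K" "c i \<noteq> 0"
    have "Max ((\<lambda>i. norm (c i)) ` {..<K}) \<in> (\<lambda>i. norm (c i)) ` {..<K}" using i by (intro Max_in) auto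
    then obtain m where m: "m < K" "norm (c m) = Max ((\<lambda>i. norm (c i)) ` {..<K})" by auto
    have mx: "norm (c l) \<le> norm (c m)" if "l < K" for l unfolding m(2) using that by (intro Max_ge) auto
    have cm: "norm (c m) > 0" using mx[OF i(1)] i(2) by auto
    let ?x = "spaced_pt R m + w"
    let ?v = "\<lambda>i. c i * packet 0 eps (spaced_pt R i) ?x"
    have "(\<Sum>i<K. ?v i) = conv (\<phi> 0) (lincomb K c (translate R)) ?x" by (simp add: conv_lincomb conv_translate)
    also have "\<dots> = 0" by (simp add: z conv_def)
    finally have "?v m + (\<Sum>i\<in>{..<K} - {m}. ?v i) = 0" using m by (simp add: sum.remove)
    then have "?v m = - (\<Sum>i\<in>{..<K} - {m}. ?v i)" by (rule eq_neg_iff_add_eq_0[THEN iffD2])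
    then have "norm (?v m) = norm (\<Sum>i\<in>{..<K} - {m}. ?v i)" by (simp only: norm_minus_cancel)
    also have "\<dots> \<le> (\<Sum>i\<in>{..<K} - {m}. norm (c m) * (a / (real K + 1)))"
    proof (rule sum_norm_le)
      fix i assume "i \<in> {..<K} - {m}"
      then show "norm (?v i) \<le> norm (c m) * (a / (real K + 1))"
        unfolding norm_mult by (intro mult_mono mx R) auto
    qed
    also have "\<dots> = (real K - 1) * (norm (c m) * (a / (real K + 1)))" using m by (simp add: of_nat_diff)
    also have "\<dots> < (real K + 1) * (norm (c m) * (a / (real K + 1)))"
      using cm a(1) by (intro mult_strict_right_mono mult_pos_pos divide_pos_pos) auto
    also have "\<dots> = norm (c m) * a" by (simp add: field_simps)
    finally show False using a(2) by (simp add: norm_mult)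
  qed
  then show ?thesis by blast
qed

text \<open>Distributions consisting of level 0 alone have as norm the p-norm of that level,
  whatever s and q are. Taking all of them as Z makes linearity automatic, and the spacing of the
  translates may depend on k.\<close>

lemma not_strictly_singular_same_p:
  assumes p: "0 < p" "0 < q0" "0 < q1"
  shows "\<not> strictly_singular (besov \<phi> s0 p q0) (besov_norm \<phi> s0 p q0) (besov_norm \<phi> s1 p q1)"
proof -
  define Z where "Z = {T \<in> besov \<phi> s0 p q0. \<forall>j\<ge>1. \<forall>x. conv (\<phi> j) T x = 0}"
  have n: "besov_norm \<phi> s p q T = Lp_en p (conv (\<phi> 0) T)" if "T \<in> Z" "0 < q" for s q T
  proof -
    have "conv (\<phi> j) T = (\<lambda>x. 0)" if "j \<noteq> 0" for j using \<open>T \<in> Z\<close> that by (auto simp: Z_def)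
    then show ?thesis
      unfolding besov_norm_eq_lnorm using that p by (subst lnorm_single[where l=0]) (auto simp: Lp_en_zero)
  qed
  have "\<exists>e. (\<forall>i<k. e i \<in> Z) \<and> lin_indep k e" for k
  proof -
    obtain R where "lin_indep k (translate R)" using lin_indep_translate by blast
    moreover have "translate R i \<in> Z" for i using translate_besov(1)[OF p(1,2)] by (auto simp: Z_def conv_translate)
    ultimately show ?thesis by blast
  qed
  moreover have "\<forall>x\<in>Z. besov_norm \<phi> s0 p q0 x \<le> ennreal 1 * besov_norm \<phi> s1 p q1 x"
    using n p by simp
  moreover have "Z \<subseteq> besov \<phi> s0 p q0" "(\<lambda>f. 0) \<in> Z" "\<forall>x\<in>Z. \<forall>y\<in>Z. (\<lambda>f. x f + y f) \<in> Z" "\<forall>c. \<forall>x\<in>Z. (\<lambda>f. c * x f) \<in> Z"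
    using p by (auto simp: Z_def zero_besov besov_add besov_cmult conv_add conv_cmult) (simp add: conv_def)
  ultimately show ?thesis unfolding strictly_singular_def by blast
qed

lemma lin_indep_ladder: "lin_indep K ladder"
  unfolding lin_indep_def
proof (intro allI impI)
  fix c i assume z: "lincomb K c ladder = (\<lambda>f. 0)" and i: "i < K"
  obtain w where w: "\<phi> 0 w \<noteq> 0" using phi0_nonzero by blast
  let ?x = "(1 / (2 ^ i * eps)) *\<^sub>R w"
  have "c i * packet i (2 ^ i * eps) 0 ?x = conv (\<phi> i) (lincomb K c ladder) ?x"
    using i by (simp add: conv_lincomb_ladder)
  also have "\<dots> = 0" by (simp add: z conv_def)
  finally show "c i = 0"
    using w eps_pos norm_packet[of i "2 ^ i * eps" 0 ?x] by auto
qed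

text \<open>On ladders with arbitrary coefficients both quasi-norms are multiples of the same
  weighted l_q norm, because \<open>s - n / p\<close> agrees; the factor
  \<open>?A p0 / ?A p1\<close> compares them.\<close>

lemma not_strictly_singular_same_q:
  assumes p: "0 < p0" "0 < p1" "0 < q"
    and s: "s0 - s1 = real CARD('n) * inv_en p0 - real CARD('n) * inv_en p1"
  shows "\<not> strictly_singular (besov \<phi> s0 p0 q) (besov_norm \<phi> s0 p0 q) (besov_norm \<phi> s1 p1 q)"
proof -
  let ?n = "real CARD('n)"
  define Z where "Z = {T \<in> besov \<phi> s0 p0 q. \<exists>c. \<forall>j x. conv (\<phi> j) T x = c j * packet j (2 ^ j * eps) 0 x}"
  let ?A = "\<lambda>p. eps powr (- (?n * inv_en p)) * phi0_norm p"
  have A: "?A p > 0" if "0 < p" for p using eps_pos phi0_norm_pos[OF that] by simp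
  have s': "s1 - ?n * inv_en p1 = s0 - ?n * inv_en p0" using s by simp
  have "\<exists>e. (\<forall>i<k. e i \<in> Z) \<and> lin_indep k e" for k
  proof (intro exI conjI allI impI)
    show "lin_indep k ladder" by (rule lin_indep_ladder)
    show "ladder i \<in> Z" for i
      unfolding Z_def using ladder_besov[OF p(1,3)]
      by (auto simp: conv_ladder intro!: exI[of _ "\<lambda>j. if j = i then 1 else 0"])
  qed
  moreover have "\<forall>x\<in>Z. besov_norm \<phi> s0 p0 q x \<le> ennreal (?A p0 / ?A p1) * besov_norm \<phi> s1 p1 q x"
  proof
    fix T assume "T \<in> Z"
    then obtain c where c: "\<And>j x. conv (\<phi> j) T x = c j * packet j (2 ^ j * eps) 0 x" by (auto simp: Z_def)
    have "ennreal (?A p0) = ennreal (?A p0 / ?A p1) * ennreal (?A p1)"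
      using A[OF p(1)] A[OF p(2)] by (subst ennreal_mult[symmetric]) auto
    then show "besov_norm \<phi> s0 p0 q T \<le> ennreal (?A p0 / ?A p1) * besov_norm \<phi> s1 p1 q T"
      by (simp only: besov_norm_ladder[OF p(1,3) c] besov_norm_ladder[OF p(2,3) c] s' mult.assoc order_refl)
  qed
  moreover have "Z \<subseteq> besov \<phi> s0 p0 q" by (auto simp: Z_def)
  moreover have "(\<lambda>f. 0) \<in> Z" using zero_besov[OF p(1,3)] by (auto simp: Z_def conv_def intro!: exI[of _ "\<lambda>_. 0"])
  moreover have "\<forall>x\<in>Z. \<forall>y\<in>Z. (\<lambda>f. x f + y f) \<in> Z"
  proof (intro ballI)
    fix S T assume "S \<in> Z" "T \<in> Z"
    then obtain c c' where c: "\<And>j x. conv (\<phi> j) S x = c j * packet j (2 ^ j * eps) 0 x" "\<And>j x. conv (\<phi> j) T x = c' j * packet j (2 ^ j * eps) 0 x"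
      and "S \<in> besov \<phi> s0 p0 q" "T \<in> besov \<phi> s0 p0 q" by (auto simp: Z_def)
    then show "(\<lambda>f. S f + T f) \<in> Z"
      unfolding Z_def using p by (auto simp: besov_add conv_add distrib_right intro!: exI[of _ "\<lambda>j. c j + c' j"])
  qed
  moreover have "\<forall>a. \<forall>x\<in>Z. (\<lambda>f. a * x f) \<in> Z"
  proof (intro allI ballI)
    fix a T assume "T \<in> Z"
    then obtain c where "\<And>j x. conv (\<phi> j) T x = c j * packet j (2 ^ j * eps) 0 x" and "T \<in> besov \<phi> s0 p0 q" by (auto simp: Z_def)
    then show "(\<lambda>f. a * T f) \<in> Z"
      unfolding Z_def using p by (auto simp: besov_cmult conv_cmult mult.assoc intro!: exI[of _ "\<lambda>j. a * c j"])
  qed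
  ultimately show ?thesis unfolding strictly_singular_def by blast
qed

text \<open>Convergence of a subsequence in the target would, by \<open>nikolskii_sup\<close> at
  level 0, be uniform convergence of the packets, whereas each of them has a peak that the others
  lack.\<close>

lemma not_compact:
  assumes p: "0 < p0" "0 < p1" "0 < q0" "0 < q1"
  shows "\<not> compact_emb (besov \<phi> s0 p0 q0) (besov_norm \<phi> s0 p0 q0) (besov \<phi> s1 p1 q1) (besov_norm \<phi> s1 p1 q1)"
proof
  assume cm: "compact_emb (besov \<phi> s0 p0 q0) (besov_norm \<phi> s0 p0 q0) (besov \<phi> s1 p1 q1) (besov_norm \<phi> s1 p1 q1)"
  obtain a w where a: "a > 0" "\<And>R k. norm (packet 0 eps (spaced_pt R k) (spaced_pt R k + w)) = a"
    "\<And>\<eta>. \<eta> > 0 \<Longrightarrow> \<exists>R>0. \<forall>i m. i \<noteq> m \<longrightarrow> norm (packet 0 eps (spaced_pt R i) (spaced_pt R m + w)) \<le> \<eta>"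
    using translates_spread by blast
  obtain R where R: "\<And>i m. i \<noteq> m \<Longrightarrow> norm (packet 0 eps (spaced_pt R i) (spaced_pt R m + w)) \<le> a / 2"
    using a(1) a(3)[of "a / 2"] by auto
  have "(\<forall>k. translate R k \<in> besov \<phi> s0 p0 q0) \<and> (\<exists>B::real. \<forall>k. besov_norm \<phi> s0 p0 q0 (translate R k) \<le> ennreal B)"
    using translate_besov[OF p(1,3)] by auto
  from cm[unfolded compact_emb_def, THEN spec, THEN mp, OF this]
  obtain r :: "nat \<Rightarrow> nat" and G where r: "strict_mono r" and G: "G \<in> besov \<phi> s1 p1 q1"
    and lim: "(\<lambda>k. besov_norm \<phi> s1 p1 q1 (\<lambda>f. translate R (r k) f - G f)) \<longlonglongrightarrow> 0"
    by (elim exE conjE)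
  obtain C where C: "C > 0" "\<And>T j L x. T \<in> tempered \<Longrightarrow> L > 0 \<Longrightarrow> Lp_en p1 (conv (\<phi> j) T) \<le> ennreal L \<Longrightarrow>
     norm (conv (\<phi> j) T x) \<le> C * 2 powr (real j * (real CARD('n) * inv_en p1)) * L"
    using nikolskii_sup[OF p(2)] by metis
  \<comment> \<open>Two elements near the limit then differ by at most \<open>a / 4\<close>
    everywhere, while at the peak of one of them the difference is at least
    \<open>a / 2\<close>.\<close>
  define L where "L = a / (8 * C)"
  have L: "L > 0" using a C by (simp add: L_def)
  have "\<forall>\<^sub>F k in sequentially. besov_norm \<phi> s1 p1 q1 (\<lambda>f. translate R (r k) f - G f) < ennreal L"
    using order_tendstoD(2)[OF lim, of "ennreal L"] L by simp
  then obtain k0 where k0: "\<And>k. k \<ge> k0 \<Longrightarrow> besov_norm \<phi> s1 p1 q1 (\<lambda>f. translate R (r k) f - G f) < ennreal L"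
    by (auto simp: eventually_sequentially)
  have close: "norm (packet 0 eps (spaced_pt R (r k)) x - conv (\<phi> 0) G x) \<le> a / 8" if "k \<ge> k0" for k x
  proof -
    let ?T = "\<lambda>f. translate R (r k) f - G f"
    have T: "?T \<in> tempered"
      using translate_besov(1)[OF p(1,3)] G by (intro tempered_diff_closed) (auto dest: besov_tempered)
    have "Lp_en p1 (conv (\<phi> 0) ?T) \<le> besov_norm \<phi> s1 p1 q1 ?T"
      using lnorm_ge[OF p(4), of "\<lambda>j. ennreal (2 powr (real j * s1)) * Lp_en p1 (conv (\<phi> j) ?T)" 0]
      by (simp add: besov_norm_eq_lnorm)
    also have "\<dots> \<le> ennreal L" using k0[OF that] by simp
    finally have "norm (conv (\<phi> 0) ?T x) \<le> C * L" using C(2)[OF T L, of 0 x] by simp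
    moreover have "conv (\<phi> 0) ?T x = packet 0 eps (spaced_pt R (r k)) x - conv (\<phi> 0) G x"
    proof -
      have "conv (\<phi> 0) ?T x = conv (\<phi> 0) (translate R (r k)) x - conv (\<phi> 0) G x" by (simp add: conv_def)
      then show ?thesis by (simp add: conv_translate)
    qed
    ultimately show ?thesis using C by (simp add: L_def)
  qed
  let ?x = "spaced_pt R (r k0) + w"
  have "r (Suc k0) \<noteq> r k0" using r by (simp add: strict_mono_eq)
  then have "norm (packet 0 eps (spaced_pt R (r (Suc k0))) ?x) \<le> a / 2" by (rule R)
  moreover have "norm (packet 0 eps (spaced_pt R (r k0)) ?x) = a" by (rule a)
  moreover have "norm (packet 0 eps (spaced_pt R (r k0)) ?x) \<le> norm (packet 0 eps (spaced_pt R (r (Suc k0))) ?x)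
      + (norm (packet 0 eps (spaced_pt R (r k0)) ?x - conv (\<phi> 0) G ?x) + norm (packet 0 eps (spaced_pt R (r (Suc k0))) ?x - conv (\<phi> 0) G ?x))"
  proof -
    have "norm u \<le> norm v + (norm (u - h) + norm (v - h))" for u v h :: complex
      using norm_triangle_sub[of u v] norm_triangle_ineq4[of "u - h" "v - h"] by simp
    then show ?thesis by blast
  qed
  ultimately show False using close[of k0 ?x] close[of "Suc k0" ?x] a(1) by simp
qed

end

section \<open>Functions with many peaks\<close>

text \<open>Gaussian elimination: \<open>e'\<close> is the system after removing equation a with
  pivot l, and the value of c at l solves the removed equation by back substitution.\<close>

lemma underdetermined_system:
  fixes e :: "'i \<Rightarrow> 'g \<Rightarrow> complex"
  assumes "finite A" "finite I" "card A < card I"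
  shows "\<exists>c. (\<exists>i\<in>I. c i \<noteq> 0) \<and> (\<forall>a\<in>A. (\<Sum>i\<in>I. c i * e i a) = 0)"
  using assms
proof (induction A arbitrary: I e rule: finite_induct)
  case empty
  then have "I \<noteq> {}" by auto
  then show ?case by (intro exI[of _ "\<lambda>_. 1"]) auto
next
  case (insert a A)
  show ?case
  proof (cases "\<forall>i\<in>I. e i a = 0")
    case True
    have "card A < card I" using insert by simp
    then obtain c where "\<exists>i\<in>I. c i \<noteq> 0" "\<forall>a\<in>A. (\<Sum>i\<in>I. c i * e i a) = 0"
      using insert.IH[of I e] insert.prems by blast
    with True show ?thesis by (intro exI[of _ c]) auto
  next
    case False
    then obtain l where l: "l \<in> I" "e l a \<noteq> 0" by blast
    define I' where "I' = I - {l}"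
    define e' where "e' = (\<lambda>i g. e i g - e i a / e l a * e l g)"
    have "finite I'" "card A < card I'" using insert l by (auto simp: I'_def)
    then obtain c' where c': "\<exists>i\<in>I'. c' i \<noteq> 0" "\<And>a. a \<in> A \<Longrightarrow> (\<Sum>i\<in>I'. c' i * e' i a) = 0"
      using insert.IH[of I' e'] by blast
    define c where "c = c'(l := - (\<Sum>i\<in>I'. c' i * (e i a / e l a)))"
    have eq: "(\<Sum>i\<in>I. c i * e i g) = (\<Sum>i\<in>I'. c' i * e' i g)" for g
    proof -
      have "(\<Sum>i\<in>I. c i * e i g) = c l * e l g + (\<Sum>i\<in>I'. c i * e i g)"
        using l insert by (simp add: I'_def sum.remove)
      also have "(\<Sum>i\<in>I'. c i * e i g) = (\<Sum>i\<in>I'. c' i * e i g)"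
        by (intro sum.cong) (auto simp: c_def I'_def)
      also have "c l * e l g = - (\<Sum>i\<in>I'. c' i * (e i a / e l a) * e l g)"
        by (simp add: c_def sum_distrib_right)
      finally show ?thesis by (simp add: e'_def right_diff_distrib sum_subtractf mult.assoc)
    qed
    show ?thesis
    proof (intro exI[of _ c] conjI ballI)
      show "\<exists>i\<in>I. c i \<noteq> 0" using c'(1) by (auto simp: c_def I'_def)
      show "(\<Sum>i\<in>I. c i * e i b) = 0" if "b \<in> insert a A" for b
        using that c'(2) l by (auto simp: eq e'_def)
    qed
  qed
qed

text \<open>Let s be the last parameter for which \<open>x + t y\<close> stays in the unit ball.
  Coordinates with \<open>y g = 0\<close> do not move; of the others only finitely many can come
  near 1. If all of these were strictly below 1 at s, the path could be continued.\<close>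

lemma ex_new_peak:
  fixes x y :: "'g \<Rightarrow> complex"
  assumes fx: "\<And>\<delta>. \<delta> > 0 \<Longrightarrow> finite {g. \<delta> \<le> norm (x g)}" and fy: "\<And>\<delta>. \<delta> > 0 \<Longrightarrow> finite {g. \<delta> \<le> norm (y g)}"
    and x1: "\<And>g. norm (x g) \<le> 1" and y0: "y g0 \<noteq> 0"
  shows "\<exists>t::real. (\<forall>g. norm (x g + t * y g) \<le> 1) \<and> (\<exists>g. y g \<noteq> 0 \<and> norm (x g + t * y g) = 1)"
proof -
  define S where "S = {0..} \<inter> (\<Inter>g. {t::real. norm (x g + t * y g) \<le> 1})"
  have cont: "continuous_on A (\<lambda>t::real. norm (x g + t * y g))" for A g
    by (intro continuous_intros)
  have cl: "closed S" unfolding S_def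
    by (intro closed_Int closed_atLeast closed_INT ballI closed_Collect_le cont continuous_on_const)
  have S0: "0 \<in> S" using x1 by (simp add: S_def)
  have bd: "t \<le> 2 / norm (y g0)" if "t \<in> S" for t
  proof -
    have "norm (of_real t * y g0) \<le> norm (x g0 + t * y g0) + norm (x g0)"
      using norm_triangle_ineq4[of "x g0 + t * y g0" "x g0"] by simp
    also have "\<dots> \<le> 1 + 1" using that x1[of g0] by (intro add_mono) (auto simp: S_def)
    finally show ?thesis using y0 that by (simp add: pos_le_divide_eq norm_mult S_def)
  qed
  define s where "s = Sup S"
  have bdd: "bdd_above S" by (rule bdd_aboveI[OF bd])
  have sS: "s \<in> S" unfolding s_def using S0 bdd cl by (intro closed_contains_Sup) auto
  then have s: "s \<ge> 0" "\<And>g. norm (x g + s * y g) \<le> 1" by (auto simp: S_def)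
  have "\<exists>g. y g \<noteq> 0 \<and> norm (x g + s * y g) = 1"
  proof (rule ccontr)
    assume no: "\<nexists>g. y g \<noteq> 0 \<and> norm (x g + s * y g) = 1"
    \<comment> \<open>For \<open>t < s + 1\<close> a coordinate with
      \<open>norm (y g) \<le> \<delta>\<close> moves by at most 1/4, hence stays below 1 if it
      starts at most at 1/4. Only the finite set Q is left to a continuity argument.\<close>
    define \<delta> where "\<delta> = 1 / (4 * (s + 1))"
    have \<delta>: "\<delta> > 0" using s by (simp add: \<delta>_def)
    define Q where "Q = {g. y g \<noteq> 0 \<and> (1/4 \<le> norm (x g) \<or> \<delta> \<le> norm (y g))}"
    have Q: "finite Q"
    proof (rule finite_subset)
      show "Q \<subseteq> {g. 1/4 \<le> norm (x g)} \<union> {g. \<delta> \<le> norm (y g)}" unfolding Q_def by blast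
      show "finite ({g. 1/4 \<le> norm (x g)} \<union> {g. \<delta> \<le> norm (y g)})" by (intro finite_UnI fx fy \<delta>) simp
    qed
    have "\<forall>\<^sub>F t in at_right s. \<forall>g\<in>Q. norm (x g + t * y g) < 1"
    proof (rule eventually_ball_finite[OF Q], rule ballI)
      fix g assume "g \<in> Q"
      then have lt: "norm (x g + s * y g) < 1" using no s(2)[of g] by (auto simp: Q_def less_le)
      have "((\<lambda>t. norm (x g + of_real t * y g)) \<longlongrightarrow> norm (x g + s * y g)) (at_right s)"
        by (intro tendsto_intros)
      from order_tendstoD(2)[OF this lt] show "\<forall>\<^sub>F t in at_right s. norm (x g + of_real t * y g) < 1" .
    qed
    moreover have "\<forall>\<^sub>F t in at_right s. s < t \<and> t < s + 1"
      using eventually_at_right_field[of _ s] by (auto intro!: exI[of _ "s + 1"])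
    ultimately have "\<forall>\<^sub>F t in at_right s. (\<forall>g\<in>Q. norm (x g + t * y g) < 1) \<and> s < t \<and> t < s + 1"
      by eventually_elim auto
    then obtain t where t: "\<forall>g\<in>Q. norm (x g + t * y g) < 1" "s < t" "t < s + 1"
      using eventually_happens'[OF trivial_limit_at_right_real] by blast
    have "norm (x g + t * y g) \<le> 1" for g
    proof (cases "y g = 0 \<or> g \<in> Q")
      case True
      then show ?thesis using t(1) x1[of g] by auto
    next
      case False
      then have "norm (x g) \<le> 1/4" "norm (y g) \<le> \<delta>" by (auto simp: Q_def)
      have "norm (x g + t * y g) \<le> norm (x g) + norm (of_real t * y g)" by (rule norm_triangle_ineq)
      also have "\<dots> = norm (x g) + t * norm (y g)" using t s by (simp add: norm_mult)
      also have "\<dots> \<le> 1/4 + (s + 1) * \<delta>"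
        using t s \<open>norm (x g) \<le> 1/4\<close> \<open>norm (y g) \<le> \<delta>\<close> by (intro add_mono mult_mono) auto
      also have "(s + 1) * \<delta> = 1/4" using s(1) by (simp add: \<delta>_def field_simps)
      finally have "norm (x g + t * y g) \<le> 1/4 + 1/4" .
      then show ?thesis by simp
    qed
    then have "t \<in> S" using t s by (simp add: S_def)
    then have "t \<le> s" unfolding s_def using bdd by (intro cSup_upper)
    then show False using t by simp
  qed
  with s(2) show ?thesis by blast
qed

text \<open>Milman's argument: while there are fewer than \<open>n\<close> peaks, some direction vanishes at all of them, and
  moving along it keeps these peaks until a new one appears.\<close>

lemma ex_many_peaks:
  fixes e :: "nat \<Rightarrow> 'g \<Rightarrow> complex"
  assumes dec: "\<And>c \<delta>. \<delta> > 0 \<Longrightarrow> finite {g. \<delta> \<le> norm (\<Sum>i<n. c i * e i g)}"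
    and indep: "\<And>c. (\<And>g. (\<Sum>i<n. c i * e i g) = 0) \<Longrightarrow> \<forall>i<n. c i = 0"
  shows "k \<le> n \<Longrightarrow> \<exists>c A. finite A \<and> card A = k \<and> (\<forall>g. norm (\<Sum>i<n. c i * e i g) \<le> 1) \<and>
     (\<forall>g\<in>A. norm (\<Sum>i<n. c i * e i g) = 1)"
proof (induction k)
  case 0
  show ?case by (intro exI[of _ "\<lambda>_. 0"] exI[of _ "{}"]) auto
next
  case (Suc k)
  then obtain c A where A: "finite A" "card A = k" and c: "\<And>g. norm (\<Sum>i<n. c i * e i g) \<le> 1"
    and cA: "\<And>g. g \<in> A \<Longrightarrow> norm (\<Sum>i<n. c i * e i g) = 1" by auto
  have "\<exists>d. (\<exists>i\<in>{..<n}. d i \<noteq> 0) \<and> (\<forall>a\<in>A. (\<Sum>i<n. d i * e i a) = 0)"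
    using A Suc.prems by (intro underdetermined_system) auto
  then obtain d where d: "\<exists>i<n. d i \<noteq> 0" "\<And>a. a \<in> A \<Longrightarrow> (\<Sum>i<n. d i * e i a) = 0" by blast
  then obtain g0 where g0: "(\<Sum>i<n. d i * e i g0) \<noteq> 0" using indep[of d] by blast
  obtain t :: real and g where t: "\<And>g. norm ((\<Sum>i<n. c i * e i g) + t * (\<Sum>i<n. d i * e i g)) \<le> 1"
    and g: "(\<Sum>i<n. d i * e i g) \<noteq> 0" "norm ((\<Sum>i<n. c i * e i g) + t * (\<Sum>i<n. d i * e i g)) = 1"
    using ex_new_peak[of "\<lambda>g. \<Sum>i<n. c i * e i g" "\<lambda>g. \<Sum>i<n. d i * e i g" g0, OF dec dec c g0] by blast
  let ?c = "\<lambda>i. c i + of_real t * d i"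
  have eq: "(\<Sum>i<n. ?c i * e i g) = (\<Sum>i<n. c i * e i g) + t * (\<Sum>i<n. d i * e i g)" for g
    by (simp add: distrib_right sum.distrib sum_distrib_left mult.assoc)
  show ?case
  proof (intro exI[of _ ?c] exI[of _ "insert g A"] conjI ballI allI)
    have "g \<notin> A" using g(1) d(2) by auto
    then show "card (insert g A) = Suc k" using A by simp
    show "norm (\<Sum>i<n. ?c i * e i g') \<le> 1" for g' unfolding eq by (rule t)
    show "norm (\<Sum>i<n. ?c i * e i g') = 1" if "g' \<in> insert g A" for g'
      unfolding eq using that g(2) d(2) cA by auto
  qed (use A in auto)
qed

section \<open>Sampling lattices\<close>

definition grid :: "real \<Rightarrow> nat \<Rightarrow> (real^'n::finite) set" where
  "grid h j = {x. \<forall>i. x $ i * 2 ^ j / h \<in> \<int>}"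

lemma grid_near:
  fixes x :: "real^'n::finite"
  assumes h: "h > 0"
  shows "\<exists>y\<in>grid h j. norm (x - y) \<le> real CARD('n) * (h / 2 ^ j)"
proof
  define y :: "real^'n" where "y = (\<chi> i. h / 2 ^ j * of_int \<lfloor>x $ i * 2 ^ j / h\<rfloor>)"
  show "y \<in> grid h j" using h by (simp add: grid_def y_def)
  have "\<bar>(x - y) $ i\<bar> \<le> h / 2 ^ j" for i
  proof -
    define u where "u = x $ i * 2 ^ j / h"
    have "(x - y) $ i = h / 2 ^ j * (u - of_int \<lfloor>u\<rfloor>)"
      using h by (simp add: y_def u_def right_diff_distrib)
    moreover have "0 \<le> u - of_int \<lfloor>u\<rfloor>" "u - of_int \<lfloor>u\<rfloor> \<le> 1" by linarith+
    moreover from this have "h / 2 ^ j * (u - of_int \<lfloor>u\<rfloor>) \<le> h / 2 ^ j" using h by (intro mult_left_le) auto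
    ultimately show ?thesis using h by (simp only: abs_of_nonneg mult_nonneg_nonneg divide_nonneg_nonneg less_imp_le zero_le_power zero_le_numeral)
  qed
  then have "(\<Sum>i\<in>UNIV. \<bar>(x - y) $ i\<bar>) \<le> (\<Sum>i\<in>(UNIV::'n set). h / 2 ^ j)" by (rule sum_mono)
  then show "norm (x - y) \<le> real CARD('n) * (h / 2 ^ j)" using norm_le_l1_cart[of "x - y"] by simp
qed

lemma grid_separated:
  fixes x y :: "real^'n::finite"
  assumes h: "h > 0" and xy: "x \<in> grid h j" "y \<in> grid h j" "x \<noteq> y"
  shows "h / 2 ^ j \<le> norm (x - y)"
proof -
  obtain i where i: "x $ i \<noteq> y $ i" using xy(3) by (auto simp: vec_eq_iff)
  have "x $ i * 2 ^ j / h - y $ i * 2 ^ j / h \<in> \<int>" using xy(1,2) by (intro Ints_diff) (auto simp: grid_def)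
  moreover have e: "x $ i * 2 ^ j / h - y $ i * 2 ^ j / h = (x - y) $ i * 2 ^ j / h" by (simp add: diff_divide_distrib left_diff_distrib)
  ultimately have "1 \<le> \<bar>(x - y) $ i * 2 ^ j / h\<bar>" using i h by (intro Ints_nonzero_abs_ge1) auto
  also have "\<dots> = \<bar>(x - y) $ i\<bar> * 2 ^ j / h" using h by (simp add: abs_mult)
  finally have "h / 2 ^ j \<le> \<bar>(x - y) $ i\<bar>" using h unfolding pos_le_divide_eq[OF h] by (simp add: pos_divide_le_eq)
  also have "\<dots> \<le> norm (x - y)" by (rule component_le_norm_cart)
  finally show ?thesis .
qed

lemma powr_le_cancel_base:
  assumes "(x::real) powr b \<le> y powr b" "b > 0" "y \<ge> 0" shows "x \<le> y"
proof (rule ccontr)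
  assume "\<not> x \<le> y"
  then have "y powr b < x powr b" using assms by (intro powr_less_mono2) auto
  with assms show False by simp
qed

context resolution
begin

text \<open>The disjoint balls of radius \<open>r / 2 ^ j\<close> around the peaks each carry a fixed amount of mass.\<close>

lemma peak_count:
  assumes p: "0 < p" "p \<noteq> top" "0 < q" "q \<noteq> top" and h: "h > 0" and K: "K \<ge> 1"
  obtains v where "v > 0" "\<And>T c P B. T \<in> tempered \<Longrightarrow> c > 0 \<Longrightarrow> finite P \<Longrightarrow>
     (\<And>j x. norm (conv (\<phi> j) T x) * 2 powr (real j * (s - real CARD('n) * inv_en p)) \<le> K * c) \<Longrightarrow>
     (\<And>j x. (j, x) \<in> P \<Longrightarrow> x \<in> grid h j \<and> c \<le> norm (conv (\<phi> j) T x) * 2 powr (real j * (s - real CARD('n) * inv_en p))) \<Longrightarrow>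
     0 \<le> B \<Longrightarrow> besov_norm \<phi> s p q T \<le> ennreal B \<Longrightarrow>
     v * c * real (card P) powr min (inv_en p) (inv_en q) \<le> B"
proof -
  let ?n = "real CARD('n)"
  obtain a where a: "p = ennreal a" "a > 0" using p by (cases p) auto
  obtain b where b: "q = ennreal b" "b > 0" using p by (cases q) auto
  \<comment> \<open>A level is bounded by K times the peak height, so the tolerance
    \<open>1 / (2 * K)\<close> keeps it above half that height near each peak.\<close>
  have "1 / (2 * K) > 0" using K by simp
  then obtain h1 where h1: "h1 > 0" "\<And>T j x x' S. T \<in> tempered \<Longrightarrow> (\<And>y. norm (conv (\<phi> j) T y) \<le> S) \<Longrightarrow>
     2 ^ j * norm (x - x') \<le> h1 \<Longrightarrow> norm (conv (\<phi> j) T x - conv (\<phi> j) T x') \<le> 1 / (2 * K) * S"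
    using modulus by metis
  \<comment> \<open>\<open>h1\<close> controls the oscillation on the balls, and
    \<open>h / 2\<close> makes balls around distinct lattice points disjoint.\<close>
  define r where "r = min h1 (h / 2)"
  have r: "r > 0" "r \<le> h1" "2 * r \<le> h" using h1 h by (auto simp: r_def)
  define V where "V = unit_ball_vol ?n * r ^ CARD('n)"
  have V: "V > 0" using r by (simp add: V_def)
  define v where "v = V powr (1 / a) / 2"
  have v: "v > 0" using V by (simp add: v_def)
  show ?thesis
  proof (rule that[OF v])
    fix T :: "'n distr" and c P B
    let ?w = "\<lambda>j::nat. 2 powr (real j * (s - ?n * inv_en p))"
    assume T: "T \<in> tempered" and c: "(c::real) > 0" and P: "finite P"
      and up: "\<And>j x. norm (conv (\<phi> j) T x) * ?w j \<le> K * c"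
      and lo: "\<And>j x. (j, x) \<in> P \<Longrightarrow> x \<in> grid h j \<and> c \<le> norm (conv (\<phi> j) T x) * ?w j"
      and B: "0 \<le> (B::real)" "besov_norm \<phi> s p q T \<le> ennreal B"
    define X where "X = (\<lambda>j. {x. (j, x) \<in> P})"
    define m where "m = (\<lambda>j. card (X j))"
    have Xf: "finite (X j)" for j
      unfolding X_def by (rule finite_subset[of _ "snd ` P"]) (use P in force)+
    have near: "c / (2 * ?w j) \<le> norm (conv (\<phi> j) T y)" if x: "x \<in> X j" and y: "y \<in> ball x (r / 2 ^ j)" for j x y
    proof -
      have S: "norm (conv (\<phi> j) T z) \<le> K * c / ?w j" for z using up[of j z] by (simp add: pos_le_divide_eq)
      have "norm (x - y) \<le> r / 2 ^ j" using y by (simp add: dist_norm)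
      then have "2 ^ j * norm (x - y) \<le> r" by (simp add: field_simps)
      then have "2 ^ j * norm (x - y) \<le> h1" using r by simp
      from h1(2)[OF T S this] have "norm (conv (\<phi> j) T x - conv (\<phi> j) T y) \<le> 1 / (2 * K) * (K * c / ?w j)" .
      also have "\<dots> = c / (2 * ?w j)" using K by simp
      finally have 1: "norm (conv (\<phi> j) T x - conv (\<phi> j) T y) \<le> c / (2 * ?w j)" .
      have "c / ?w j \<le> norm (conv (\<phi> j) T x)" using lo[of j x] x by (simp add: X_def pos_divide_le_eq)
      also have "\<dots> \<le> norm (conv (\<phi> j) T y) + norm (conv (\<phi> j) T x - conv (\<phi> j) T y)" by (rule norm_triangle_sub)
      finally show ?thesis using 1 by (simp add: field_simps)
    qed
    define I where "I = (\<lambda>j. \<integral>\<^sup>+y. ennreal (norm (conv (\<phi> j) T y) powr a) \<partial>lborel)"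
    have I: "ennreal (real (m j) * ((c / (2 * ?w j)) powr a * (V / 2 powr (real j * ?n)))) \<le> I j" for j
    proof -
      let ?C = "ennreal ((c / (2 * ?w j)) powr a)"
      let ?b = "\<lambda>x. ball x (r / 2 ^ j) :: (real^'n) set"
      have "(\<Sum>x\<in>X j. ?C * emeasure lborel (?b x)) = (\<integral>\<^sup>+y. (\<Sum>x\<in>X j. ?C * indicator (?b x) y) \<partial>lborel)"
      proof -
        have "(\<integral>\<^sup>+y. (\<Sum>x\<in>X j. ?C * indicator (?b x) y) \<partial>lborel) = (\<Sum>x\<in>X j. \<integral>\<^sup>+y. ?C * indicator (?b x) y \<partial>lborel)"
          by (intro nn_integral_sum borel_measurable_times_ennreal borel_measurable_const borel_measurable_indicator) simp
        also have "\<dots> = (\<Sum>x\<in>X j. ?C * emeasure lborel (?b x))"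
          by (intro sum.cong refl nn_integral_cmult_indicator) simp
        finally show ?thesis by (rule sym)
      qed
      also have "\<dots> \<le> I j"
        unfolding I_def
      proof (rule nn_integral_mono)
        fix y :: "real^'n"
        show "(\<Sum>x\<in>X j. ?C * indicator (?b x) y) \<le> ennreal (norm (conv (\<phi> j) T y) powr a)"
        proof (cases "\<exists>x\<in>X j. y \<in> ?b x")
          case False
          have "?C * indicator (?b x) y = 0" if "x \<in> X j" for x
          proof -
            have n: "y \<notin> ?b x" using False that by blast
            show ?thesis by (simp only: indicator_simps(2)[OF n] mult_zero_right)
          qed
          then have "(\<Sum>x\<in>X j. ?C * indicator (?b x) y) = 0" by (intro sum.neutral ballI)
          then show ?thesis by (simp only:) simp
        next
          case True
          then obtain x0 where x0: "x0 \<in> X j" "y \<in> ?b x0" by blast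
          have "y \<notin> ?b x" if "x \<in> X j" "x \<noteq> x0" for x
          proof
            assume "y \<in> ?b x"
            have "norm (x - x0) \<le> norm (x - y) + norm (x0 - y)" using norm_triangle_ineq4[of "x - y" "x0 - y"] by simp
            also have "\<dots> < r / 2 ^ j + r / 2 ^ j" using \<open>y \<in> ?b x\<close> x0(2) unfolding mem_ball dist_norm by (rule add_strict_mono)
            also have "\<dots> = 2 * r / 2 ^ j" by simp
            also have "\<dots> \<le> h / 2 ^ j" using r by (intro divide_right_mono) auto
            also have "\<dots> \<le> norm (x - x0)"
              using conjunct1[OF lo[of j x]] conjunct1[OF lo[of j x0]] that x0(1) unfolding X_def mem_Collect_eq
              by (intro grid_separated[OF h])
            finally show False by simp
          qed
          then have "(\<Sum>x\<in>X j. ?C * indicator (?b x) y) = (\<Sum>x\<in>{x0}. ?C * indicator (?b x) y)"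
            using x0(1) Xf by (intro sum.mono_neutral_right) (simp_all add: indicator_def)
          also have "\<dots> = ?C" using x0(2) by (simp only: sum.insert finite.emptyI empty_iff not_False_eq_True sum.empty indicator_simps mult_1_right add_0_right)
          also have "\<dots> \<le> ennreal (norm (conv (\<phi> j) T y) powr a)"
            by (intro ennreal_leI powr_mono2 near[OF x0]) (use c a in simp_all)
          finally show ?thesis .
        qed
      qed
      also have "(\<Sum>x\<in>X j. ?C * emeasure lborel (?b x)) = (\<Sum>x\<in>X j. ?C * ennreal (V / 2 powr (real j * ?n)))"
      proof (intro sum.cong refl)
        fix x :: "real^'n"
        have "emeasure lborel (?b x) = ennreal (unit_ball_vol ?n * (r / 2 ^ j) ^ CARD('n))"
          using r by (subst emeasure_ball) auto
        also have "unit_ball_vol ?n * (r / 2 ^ j) ^ CARD('n) = V / 2 powr (real j * ?n)"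
        proof -
          have "(2 ^ j) ^ CARD('n) = 2 powr (real j * ?n)"
            by (simp add: powr_realpow[symmetric] powr_powr)
          then show ?thesis by (simp add: V_def power_divide)
        qed
        finally show "?C * emeasure lborel (?b x) = ?C * ennreal (V / 2 powr (real j * ?n))" by simp
      qed
      also have "\<dots> = ennreal (real (m j) * ((c / (2 * ?w j)) powr a * (V / 2 powr (real j * ?n))))"
      proof -
        have "V / 2 powr (real j * ?n) \<ge> 0" using V by simp
        then have "ennreal (real (m j) * ((c / (2 * ?w j)) powr a * (V / 2 powr (real j * ?n)))) =
          ennreal (real (m j)) * (?C * ennreal (V / 2 powr (real j * ?n)))"
          by (simp only: ennreal_mult of_nat_0_le_iff powr_ge_zero mult_nonneg_nonneg)
        then show ?thesis by (simp only: sum_constant m_def ennreal_of_nat_eq_real_of_nat)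
      qed
      finally show ?thesis .
    qed
    let ?a = "\<lambda>j. ennreal (2 powr (real j * s)) * Lp_en p (conv (\<phi> j) T)"
    \<comment> \<open>The volume contributes \<open>2 powr (- j n / a)\<close> and the peak height
      \<open>2 powr (- j (s - n / a))\<close>; their product cancels the smoothness weight, so the
      contribution of a level depends on its number of peaks but not on its frequency.\<close>
    have aj: "ennreal (real (m j) powr (1 / a) * (c * v)) \<le> ?a j" for j
    proof -
      have "enn_powr (ennreal (real (m j) * ((c / (2 * ?w j)) powr a * (V / 2 powr (real j * ?n))))) (1 / a) \<le> enn_powr (I j) (1 / a)"
        using a by (intro enn_powr_mono I) auto
      also have "enn_powr (I j) (1 / a) = Lp_en p (conv (\<phi> j) T)" using a by (simp add: Lp_en_def I_def)
      also have "enn_powr (ennreal (real (m j) * ((c / (2 * ?w j)) powr a * (V / 2 powr (real j * ?n))))) (1 / a)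
        = ennreal (real (m j) powr (1 / a) * ((c / (2 * ?w j)) * (V powr (1 / a) / 2 powr (real j * ?n / a))))"
        using a c V by (simp add: enn_powr_ennreal powr_mult powr_powr powr_divide)
      finally have "ennreal (2 powr (real j * s)) * ennreal (real (m j) powr (1 / a) * ((c / (2 * ?w j)) * (V powr (1 / a) / 2 powr (real j * ?n / a)))) \<le> ?a j"
        by (intro mult_left_mono) auto
      also have "ennreal (2 powr (real j * s)) * ennreal (real (m j) powr (1 / a) * ((c / (2 * ?w j)) * (V powr (1 / a) / 2 powr (real j * ?n / a))))
        = ennreal (real (m j) powr (1 / a) * (c * v) * (2 powr (real j * s) / (?w j * 2 powr (real j * ?n / a))))"
        using c V by (simp add: ennreal_mult[symmetric] v_def mult_ac)
      also have "?w j * 2 powr (real j * ?n / a) = 2 powr (real j * s)"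
        using a by (simp add: powr_add[symmetric] inv_en_def algebra_simps)
      finally show ?thesis by simp
    qed
    define J where "J = fst ` P"
    have J: "finite J" using P by (simp add: J_def)
    have fin: "(\<Sum>j\<in>J. (real (m j) powr (1 / a) * (c * v)) powr b) \<le> B powr b"
    proof -
      have "ennreal (\<Sum>j\<in>J. (real (m j) powr (1 / a) * (c * v)) powr b) = (\<Sum>j\<in>J. enn_powr (ennreal (real (m j) powr (1 / a) * (c * v))) b)"
        using c v by (simp add: enn_powr_ennreal sum_ennreal)
      also have "\<dots> \<le> (\<Sum>j\<in>J. enn_powr (?a j) b)" using b by (intro sum_mono enn_powr_mono aj) auto
      also have "\<dots> \<le> (\<Sum>j. enn_powr (?a j) b)" using J by (intro sum_le_suminf) auto
      also have "\<dots> \<le> ennreal (B powr b)"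
        using B b Lnorm_le_iff[of q B "count_space UNIV" ?a] p
        by (simp add: besov_norm_eq_lnorm nn_integral_count_space_nat)
      finally show ?thesis by (simp add: ennreal_le_iff)
    qed
    define N where "N = card P"
    have mN: "m j \<le> N" for j
      unfolding m_def N_def
      by (rule card_inj_on_le[of "\<lambda>x. (j, x)"]) (use P in \<open>auto simp: X_def inj_on_def\<close>)
    have sumN: "(\<Sum>j\<in>J. real (m j)) = real N"
    proof -
      have "P = Sigma J X" by (force simp: J_def X_def)
      then have "N = (\<Sum>j\<in>J. m j)" unfolding N_def m_def using J Xf by (simp add: card_SigmaI)
      then show ?thesis by simp
    qed
    show "v * c * real (card P) powr min (inv_en p) (inv_en q) \<le> B"
    proof (cases "N = 0")
      case True
      then show ?thesis using B by (simp add: N_def)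
    next
      case False
      \<comment> \<open>Peaks are distributed arbitrarily over the levels. As
        \<open>m j \<le> N\<close> and \<open>\<kappa> \<le> 1\<close>, each term satisfies
        \<open>m j powr \<kappa> \<ge> m j * N powr (\<kappa> - 1)\<close>, and these sum to
        \<open>N powr \<kappa>\<close>; taking the root yields the smaller of 1/p and 1/q.\<close>
      define \<kappa> where "\<kappa> = min (b / a) 1"
      have term_ge: "real (m j) * real N powr (\<kappa> - 1) \<le> real (m j) powr (b / a)" for j
      proof (cases "m j = 0")
        case False
        then have mj: "real (m j) \<ge> 1" by simp
        have "real N powr (\<kappa> - 1) \<le> real (m j) powr (\<kappa> - 1)"
          using mj mN[of j] by (intro powr_mono2') (auto simp: \<kappa>_def)
        then have "real (m j) * real N powr (\<kappa> - 1) \<le> real (m j) powr 1 * real (m j) powr (\<kappa> - 1)"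
          using mj by (simp add: mult_left_mono)
        also have "\<dots> = real (m j) powr \<kappa>" unfolding powr_add[symmetric] by simp
        also have "\<dots> \<le> real (m j) powr (b / a)" using mj by (intro powr_mono) (auto simp: \<kappa>_def)
        finally show ?thesis .
      qed simp
      have "real N powr \<kappa> = real N powr 1 * real N powr (\<kappa> - 1)" by (simp only: powr_add[symmetric]) simp
      also have "\<dots> = (\<Sum>j\<in>J. real (m j) * real N powr (\<kappa> - 1))"
        by (simp only: sum_distrib_right[symmetric] sumN powr_one of_nat_0_le_iff)
      also have "\<dots> \<le> (\<Sum>j\<in>J. real (m j) powr (b / a))" by (intro sum_mono term_ge)
      finally have "real N powr \<kappa> * (c * v) powr b \<le> (\<Sum>j\<in>J. real (m j) powr (b / a)) * (c * v) powr b"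
        by (intro mult_right_mono) auto
      also have "\<dots> = (\<Sum>j\<in>J. (real (m j) powr (1 / a) * (c * v)) powr b)"
        using c v by (simp add: sum_distrib_right powr_mult powr_powr)
      also have "\<dots> \<le> B powr b" by (rule fin)
      also have "real N powr \<kappa> * (c * v) powr b = (v * c * real N powr (\<kappa> / b)) powr b"
        using b c v by (simp add: powr_mult powr_powr mult_ac)
      finally have "v * c * real N powr (\<kappa> / b) \<le> B" by (rule powr_le_cancel_base[OF _ b(2) B(1)])
      moreover have "\<kappa> / b = min (inv_en p) (inv_en q)"
        using a b by (auto simp: \<kappa>_def inv_en_def min_def field_simps)
      ultimately show ?thesis by (simp add: N_def)
    qed
  qed
qed

end

section \<open>Bernstein numbers\<close>

context resolution
begin

lemma besov_level_bound:
  assumes q: "0 < q" and L: "besov_norm \<phi> s p q T \<le> ennreal L"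
  shows "Lp_en p (conv (\<phi> j) T) \<le> ennreal (2 powr (- (real j * s)) * L)"
proof -
  have "ennreal (2 powr (real j * s)) * Lp_en p (conv (\<phi> j) T) \<le> ennreal L"
    using lnorm_ge[OF q, of "\<lambda>j. ennreal (2 powr (real j * s)) * Lp_en p (conv (\<phi> j) T)" j] L
    unfolding besov_norm_eq_lnorm by (rule order_trans)
  then have "ennreal (2 powr (- (real j * s))) * (ennreal (2 powr (real j * s)) * Lp_en p (conv (\<phi> j) T)) \<le> ennreal (2 powr (- (real j * s))) * ennreal L"
    by (rule mult_left_mono) simp
  then show ?thesis
    by (simp add: mult.assoc[symmetric] ennreal_mult'[symmetric] powr_add[symmetric])
qed

text \<open>The Nikolskii growth \<open>2 powr (j n / p)\<close> lowers the weight from s to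
  \<open>s - n / p\<close>. In particular the weighted supremum is finite on the whole
  space.\<close>

lemma besov_sup_bound:
  assumes p: "0 < p" "0 < q"
  obtains C where "C > 0" "\<And>T j x L. T \<in> tempered \<Longrightarrow> L > 0 \<Longrightarrow> besov_norm \<phi> s p q T \<le> ennreal L \<Longrightarrow>
     norm (conv (\<phi> j) T x) * 2 powr (real j * (s - real CARD('n) * inv_en p)) \<le> C * L"
proof -
  let ?n = "real CARD('n)"
  obtain C where C: "C > 0" "\<And>T j L x. T \<in> tempered \<Longrightarrow> L > 0 \<Longrightarrow> Lp_en p (conv (\<phi> j) T) \<le> ennreal L \<Longrightarrow>
     norm (conv (\<phi> j) T x) \<le> C * 2 powr (real j * (?n * inv_en p)) * L"
    using nikolskii_sup[OF p(1)] by metis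
  show ?thesis
  proof (rule that[OF C(1)])
    fix T :: "'n distr" and j x L assume T: "T \<in> tempered" and L: "(L::real) > 0" "besov_norm \<phi> s p q T \<le> ennreal L"
    have "Lp_en p (conv (\<phi> j) T) \<le> ennreal (2 powr (- (real j * s)) * L)"
      by (rule besov_level_bound[OF p(2) L(2)])
    then have "norm (conv (\<phi> j) T x) \<le> C * 2 powr (real j * (?n * inv_en p)) * (2 powr (- (real j * s)) * L)"
      using L by (intro C T) auto
    then have "norm (conv (\<phi> j) T x) * 2 powr (real j * (s - ?n * inv_en p)) \<le>
      C * 2 powr (real j * (?n * inv_en p)) * (2 powr (- (real j * s)) * L) * 2 powr (real j * (s - ?n * inv_en p))"
      by (intro mult_right_mono) auto
    also have "\<dots> = C * L * (2 powr (real j * (?n * inv_en p)) * 2 powr (- (real j * s)) * 2 powr (real j * (s - ?n * inv_en p)))"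
      by simp
    also have "2 powr (real j * (?n * inv_en p)) * 2 powr (- (real j * s)) * 2 powr (real j * (s - ?n * inv_en p)) = 1"
      by (simp add: powr_add[symmetric] algebra_simps)
    finally show "norm (conv (\<phi> j) T x) * 2 powr (real j * (s - ?n * inv_en p)) \<le> C * L" by simp
  qed
qed

text \<open>The Bernstein numbers of the critical embedding are small because a function with many
  equally high peaks is, in the target norm, small compared to its source norm.\<close>

lemma ratio_small_critical:
  assumes p: "0 < p0" "p0 < p1" "0 < q0" "q0 < q1"
    and s: "s0 - s1 = real CARD('n) * inv_en p0 - real CARD('n) * inv_en p1" and \<epsilon>: "\<epsilon> > 0"
  obtains k0 where "\<And>k e. k \<ge> k0 \<Longrightarrow> (\<And>i. i < k \<Longrightarrow> e i \<in> besov \<phi> s0 p0 q0) \<Longrightarrow> lin_indep k e \<Longrightarrow>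
     \<exists>c. 0 < besov_norm \<phi> s0 p0 q0 (lincomb k c e) \<and>
         besov_norm \<phi> s1 p1 q1 (lincomb k c e) \<le> ennreal \<epsilon> * besov_norm \<phi> s0 p0 q0 (lincomb k c e)"
proof -
  let ?n = "real CARD('n)"
  have p1: "0 < p1" "0 < q1" "p0 \<noteq> top" "q0 \<noteq> top" using p by auto
  let ?w = "\<lambda>j::nat. 2 powr (real j * (s0 - ?n * inv_en p0))"
  obtain h1 where h1: "h1 > 0" "\<And>T j x x' S. T \<in> tempered \<Longrightarrow> (\<And>y. norm (conv (\<phi> j) T y) \<le> S) \<Longrightarrow>
     2 ^ j * norm (x - x') \<le> h1 \<Longrightarrow> norm (conv (\<phi> j) T x - conv (\<phi> j) T x') \<le> 1 / 2 * S"
    using modulus[of "1/2"] by auto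
  \<comment> \<open>The nearest lattice point lies within
    \<open>?n * h / 2 ^ j = h1 / 2 ^ j\<close>, the range in which a level varies by at most half
    its supremum.\<close>
  define h where "h = h1 / ?n"
  have h: "h > 0" "?n * h = h1" using h1 by (simp_all add: h_def)
  obtain A where A: "A > 0" "\<And>T j x L. T \<in> tempered \<Longrightarrow> L > 0 \<Longrightarrow> besov_norm \<phi> s0 p0 q0 T \<le> ennreal L \<Longrightarrow>
     norm (conv (\<phi> j) T x) * ?w j \<le> A * L"
    using besov_sup_bound[OF p(1,3), where s=s0] by metis
  define \<kappa> where "\<kappa> = min (inv_en p0) (inv_en q0)"
  have ip: "inv_en p0 > 0" "inv_en q0 > 0" using p p1 enn2real_pos[of p0] enn2real_pos[of q0] by (auto simp: inv_en_def)
  have \<kappa>: "\<kappa> > 0" using ip by (simp add: \<kappa>_def)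
  have two: "(2::real) \<ge> 1" by simp
  obtain v where v: "v > 0" "\<And>T c P B. T \<in> tempered \<Longrightarrow> c > 0 \<Longrightarrow> finite P \<Longrightarrow>
     (\<And>j x. norm (conv (\<phi> j) T x) * ?w j \<le> 2 * c) \<Longrightarrow>
     (\<And>j x. (j, x) \<in> P \<Longrightarrow> x \<in> grid h j \<and> c \<le> norm (conv (\<phi> j) T x) * ?w j) \<Longrightarrow>
     0 \<le> B \<Longrightarrow> besov_norm \<phi> s0 p0 q0 T \<le> ennreal B \<Longrightarrow> v * c * real (card P) powr \<kappa> \<le> B"
    using peak_count[OF p(1) p1(3) p(3) p1(4) h(1) two, where s=s0] unfolding \<kappa>_def by metis
  obtain C where C: "C > 0" "\<And>T j. T \<in> tempered \<Longrightarrow> Lp_en p1 (conv (\<phi> j) T) \<le>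
     ennreal (C * 2 powr (real j * (?n * inv_en p0 - ?n * inv_en p1))) * Lp_en p0 (conv (\<phi> j) T)"
    using nikolskii[OF p(1) less_imp_le[OF p(2)]] by metis
  define \<theta> where "\<theta> = inv_en p1 / inv_en p0"
  define \<theta>' where "\<theta>' = inv_en q1 / inv_en q0"
  have "inv_en p1 < inv_en p0" "inv_en q1 < inv_en q0"
    using inv_en_le_iff[OF p1(1) p(1)] inv_en_le_iff[OF p1(2) p(3)] p(2,4) by (metis not_le)+
  then have th: "\<theta> < 1" "\<theta>' < 1" using ip by (auto simp: \<theta>_def \<theta>'_def)
  \<comment> \<open>The power of B gained by the target norm; it is positive because both ratios are
    below 1.\<close>
  define \<gamma> where "\<gamma> = (1 - \<theta>) * (1 - \<theta>')"
  have \<gamma>: "\<gamma> > 0" using th by (simp add: \<gamma>_def)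
  define Q where "Q = C powr \<theta>' * (2 powr (1 - \<theta>)) powr (1 - \<theta>')"
  have Q: "Q > 0" using C by (simp add: Q_def)

  \<comment> \<open>Two interpolations. \<open>b1\<close> bounds every target level by interpolating
    in x between the source level and the supremum; \<open>b2\<close> is the Nikolskii bound summed
    with q0; interpolating the sequence between these two raises the second index to q1.\<close>
  have target: "besov_norm \<phi> s1 p1 q1 T \<le> ennreal (Q * B powr (- \<gamma>) * B)"
    if T: "T \<in> tempered" and B: "B > 0" "besov_norm \<phi> s0 p0 q0 T \<le> ennreal B"
      and up: "\<And>j x. norm (conv (\<phi> j) T x) * ?w j \<le> 2" for T B
  proof -
    let ?b = "\<lambda>j. ennreal (2 powr (real j * s1)) * Lp_en p1 (conv (\<phi> j) T)"
    define e1 where "e1 = B powr \<theta> * 2 powr (1 - \<theta>)"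
    have e1: "e1 > 0" using B by (simp add: e1_def)
    have b1: "?b j \<le> ennreal e1" for j
    proof -
      have [measurable]: "conv (\<phi> j) T \<in> borel_measurable borel" by (intro borel_measurable_continuous_onI conv_continuous T)
      have l0: "Lnorm lborel p0 (\<lambda>x. ennreal (norm (conv (\<phi> j) T x))) \<le> ennreal (2 powr (- (real j * s0)) * B)"
        using besov_level_bound[OF p(3) B(2)] by (simp add: Lp_en_eq_Lnorm)
      have u: "ennreal (norm (conv (\<phi> j) T x)) \<le> ennreal (2 / ?w j)" for x
        using up[of j x] by (intro ennreal_leI) (simp add: pos_le_divide_eq)
      have "Lp_en p1 (conv (\<phi> j) T) \<le> ennreal ((2 powr (- (real j * s0)) * B) powr \<theta> * (2 / ?w j) powr (1 - \<theta>))"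
        unfolding Lp_en_eq_Lnorm \<theta>_def
        by (rule Lnorm_interp[OF _ p(1) less_imp_le[OF p(2)] p1(3) u _ _ l0]) (use B in auto)
      then have "?b j \<le> ennreal (2 powr (real j * s1)) * ennreal ((2 powr (- (real j * s0)) * B) powr \<theta> * (2 / ?w j) powr (1 - \<theta>))"
        by (intro mult_left_mono) auto
      also have "\<dots> = ennreal (2 powr (real j * s1) * ((2 powr (- (real j * s0)) * B) powr \<theta> * (2 / ?w j) powr (1 - \<theta>)))"
        by (simp add: ennreal_mult)
      also have "2 powr (real j * s1) * ((2 powr (- (real j * s0)) * B) powr \<theta> * (2 / ?w j) powr (1 - \<theta>)) = e1"
      proof -
        have a: "(2 powr (- (real j * s0)) * B) powr \<theta> = 2 powr (- (real j * s0) * \<theta>) * B powr \<theta>"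
          using B by (simp add: powr_mult powr_powr)
        have b: "(2 / ?w j) powr (1 - \<theta>) = 2 powr (1 - \<theta>) * 2 powr (- (real j * (s0 - ?n * inv_en p0)) * (1 - \<theta>))"
          by (simp add: powr_divide powr_powr powr_minus_divide)
        \<comment> \<open>The powers of \<open>2 ^ j\<close> cancel exactly on the critical line, so
          \<open>e1\<close> is the same for all levels.\<close>
        have ex: "real j * s1 + (- (real j * s0) * \<theta>) + (- (real j * (s0 - ?n * inv_en p0)) * (1 - \<theta>)) = 0"
        proof -
          have t: "?n * inv_en p0 * \<theta> = ?n * inv_en p1" using ip by (simp add: \<theta>_def)
          have "real j * s1 + (- (real j * s0) * \<theta>) + (- (real j * (s0 - ?n * inv_en p0)) * (1 - \<theta>))
            = real j * (s1 - s0 + ?n * inv_en p0 - ?n * inv_en p0 * \<theta>)" by (simp add: algebra_simps)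
          also have "\<dots> = 0" unfolding t using s by simp
          finally show ?thesis .
        qed
        have "2 powr (real j * s1) * 2 powr (- (real j * s0) * \<theta>) * 2 powr (- (real j * (s0 - ?n * inv_en p0)) * (1 - \<theta>)) = (2::real) powr 0"
          by (simp only: powr_add[symmetric] ex)
        then show ?thesis unfolding a b e1_def by (simp add: mult_ac)
      qed
      finally show ?thesis .
    qed
    have b2: "lnorm q0 ?b \<le> ennreal (C * B)"
    proof -
      have "?b j \<le> ennreal C * (ennreal (2 powr (real j * s0)) * Lp_en p0 (conv (\<phi> j) T))" for j
      proof -
        have "?b j \<le> ennreal (2 powr (real j * s1)) * (ennreal (C * 2 powr (real j * (s0 - s1))) * Lp_en p0 (conv (\<phi> j) T))"
          unfolding s by (intro mult_left_mono C T) auto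
        also have "\<dots> = ennreal (2 powr (real j * s1) * (C * 2 powr (real j * (s0 - s1)))) * Lp_en p0 (conv (\<phi> j) T)"
          using C by (simp add: ennreal_mult mult.assoc)
        also have "2 powr (real j * s1) * (C * 2 powr (real j * (s0 - s1))) = C * 2 powr (real j * s0)"
          by (simp add: powr_add[symmetric] algebra_simps)
        finally show ?thesis using C by (simp add: ennreal_mult mult.assoc)
      qed
      then have "lnorm q0 ?b \<le> lnorm q0 (\<lambda>j. ennreal C * (ennreal (2 powr (real j * s0)) * Lp_en p0 (conv (\<phi> j) T)))"
        using p by (intro Lnorm_mono) auto
      also have "\<dots> = ennreal C * besov_norm \<phi> s0 p0 q0 T"
        unfolding besov_norm_eq_lnorm using p C by (intro Lnorm_cmult) auto
      also have "\<dots> \<le> ennreal C * ennreal B" by (intro mult_left_mono B) auto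
      finally show ?thesis using B C by (simp add: ennreal_mult)
    qed
    have "lnorm q1 ?b \<le> ennreal ((C * B) powr \<theta>' * e1 powr (1 - \<theta>'))"
      unfolding \<theta>'_def
      by (rule Lnorm_interp[OF _ p(3) less_imp_le[OF p(4)] p1(4) b1 e1 _ b2]) (use B C in auto)
    also have "(C * B) powr \<theta>' * e1 powr (1 - \<theta>') = Q * (B powr \<theta>' * B powr (\<theta> * (1 - \<theta>')))"
      using B C by (simp add: e1_def Q_def powr_mult powr_powr mult_ac)
    also have "B powr \<theta>' * B powr (\<theta> * (1 - \<theta>')) = B powr (- \<gamma>) * B powr 1"
      unfolding powr_add[symmetric] by (simp add: \<gamma>_def algebra_simps)
    finally show ?thesis using B by (simp add: besov_norm_eq_lnorm mult.assoc)
  qed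

  \<comment> \<open>D solves \<open>Q * D powr (- \<gamma>) = \<epsilon>\<close>; the choice of
    \<open>k1\<close> then makes the source norm of a function with k peaks of height 1 at least
    D.\<close>
  define D where "D = (Q / \<epsilon>) powr (1 / \<gamma>)"
  have D: "D > 0" using Q \<epsilon> by (simp add: D_def)
  obtain k1 :: nat where k1: "(D / v) powr (1 / \<kappa>) \<le> real k1" using real_arch_simple by blast
  show ?thesis
  proof (rule that[of "max 1 k1"])
    fix k :: nat and e :: "nat \<Rightarrow> 'n distr"
    assume k: "k \<ge> max 1 k1" and e: "\<And>i. i < k \<Longrightarrow> e i \<in> besov \<phi> s0 p0 q0" and li: "lin_indep k e"
    \<comment> \<open>The weighted samples of all levels on their lattices form one family of
      coordinates; the value 0 off the lattice lets all pairs serve as index set. The peak argument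
      runs in the supremum norm of these coordinates.\<close>
    define E where "E = (\<lambda>i (j, x). if x \<in> grid h j then of_real (?w j) * conv (\<phi> j) (e i) x else 0)"
    have fb: "lincomb k c e \<in> besov \<phi> s0 p0 q0" for c by (intro besov_lincomb e p)
    then have ft: "lincomb k c e \<in> tempered" for c by (rule besov_tempered)
    have E: "(\<Sum>i<k. c i * E i (j, x)) = (if x \<in> grid h j then of_real (?w j) * conv (\<phi> j) (lincomb k c e) x else 0)" for c j x
      by (simp add: E_def conv_lincomb sum_distrib_left mult.left_commute)
    have fin: "\<exists>L>0. besov_norm \<phi> s0 p0 q0 (lincomb k c e) \<le> ennreal L" for c
    proof -
      obtain l where "besov_norm \<phi> s0 p0 q0 (lincomb k c e) = ennreal l" "l \<ge> 0"
        using fb[of c] by (cases "besov_norm \<phi> s0 p0 q0 (lincomb k c e)") (auto simp: besov_def)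
      then show ?thesis by (intro exI[of _ "l + 1"]) (auto intro: ennreal_leI)
    qed
    \<comment> \<open>A nearby lattice point gives \<open>S \<le> b / ?w j + S / 2\<close> for the
      supremum S of the level. The absorption requires S to be finite, which the source norm
      guarantees, and costs the factor 2.\<close>
    have off_grid: "norm (conv (\<phi> j) (lincomb k c e) x) * ?w j \<le> 2 * b"
      if g: "\<And>g. norm (\<Sum>i<k. c i * E i g) \<le> b" for c b j x
    proof -
      let ?f = "conv (\<phi> j) (lincomb k c e)"
      obtain L where L: "L > 0" "besov_norm \<phi> s0 p0 q0 (lincomb k c e) \<le> ennreal L" using fin by blast
      have bd: "bdd_above (range (\<lambda>x. norm (?f x)))"
        using A(2)[OF ft L, of j] by (intro bdd_aboveI2[where M="A * L / ?w j"]) (simp add: pos_le_divide_eq)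
      define S where "S = (SUP x. norm (?f x))"
      have S: "norm (?f x) \<le> S" for x unfolding S_def by (rule cSUP_upper[OF UNIV_I bd])
      have "norm (?f x) \<le> b / ?w j + S / 2" for x
      proof -
        obtain y where y: "y \<in> grid h j" "norm (x - y) \<le> ?n * (h / 2 ^ j)" using grid_near[OF h(1)] by blast
        then have "2 ^ j * norm (x - y) \<le> h1" using h(2) by (simp add: field_simps)
        then have 1: "norm (?f x - ?f y) \<le> 1 / 2 * S" by (intro h1(2) ft S)
        have "norm (?f y) * ?w j \<le> b" using g[of "(j, y)"] y(1) by (simp add: E norm_mult mult.commute)
        then have "norm (?f y) \<le> b / ?w j" by (simp add: pos_le_divide_eq)
        then show ?thesis using 1 norm_triangle_sub[of "?f x" "?f y"] by simp
      qed
      then have "S \<le> b / ?w j + S / 2" unfolding S_def by (intro cSUP_least) auto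
      then have "S \<le> 2 * b / ?w j" by simp
      then have "norm (?f x) \<le> 2 * b / ?w j" using S[of x] by simp
      then show ?thesis by (simp add: pos_le_divide_eq)
    qed
    \<comment> \<open>With K chosen so that \<open>A * L \<le> K * \<delta>\<close>, the peak count
      bounds the size of every finite set of samples above \<open>\<delta>\<close>, and hence of the
      set of all of them.\<close>
    have dec: "finite {g. \<delta> \<le> norm (\<Sum>i<k. c i * E i g)}" if \<delta>: "\<delta> > 0" for c \<delta>
    proof -
      obtain L where L: "L > 0" "besov_norm \<phi> s0 p0 q0 (lincomb k c e) \<le> ennreal L" using fin by blast
      define K where "K = max 1 (A * L / \<delta>)"
      have K: "K \<ge> 1" "A * L \<le> K * \<delta>" using \<delta> by (auto simp: K_def max_def field_simps)
      obtain u where u: "u > 0" "\<And>T c P B. T \<in> tempered \<Longrightarrow> c > 0 \<Longrightarrow> finite P \<Longrightarrow>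
         (\<And>j x. norm (conv (\<phi> j) T x) * ?w j \<le> K * c) \<Longrightarrow>
         (\<And>j x. (j, x) \<in> P \<Longrightarrow> x \<in> grid h j \<and> c \<le> norm (conv (\<phi> j) T x) * ?w j) \<Longrightarrow>
         0 \<le> B \<Longrightarrow> besov_norm \<phi> s0 p0 q0 T \<le> ennreal B \<Longrightarrow> u * c * real (card P) powr \<kappa> \<le> B"
        using peak_count[OF p(1) p1(3) p(3) p1(4) h(1) K(1), where s=s0] unfolding \<kappa>_def by metis
      obtain m :: nat where m: "(L / (u * \<delta>)) powr (1 / \<kappa>) \<le> real m" using real_arch_simple by blast
      have "card P \<le> m" if P: "P \<subseteq> {g. \<delta> \<le> norm (\<Sum>i<k. c i * E i g)}" "finite P" for P
      proof -
        have "u * \<delta> * real (card P) powr \<kappa> \<le> L"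
        proof (rule u(2)[OF ft \<delta> P(2)])
          show "norm (conv (\<phi> j) (lincomb k c e) x) * ?w j \<le> K * \<delta>" for j x
            using A(2)[OF ft L, where j=j and x=x] K(2) by linarith
          show "x \<in> grid h j \<and> \<delta> \<le> norm (conv (\<phi> j) (lincomb k c e) x) * ?w j" if "(j, x) \<in> P" for j x
          proof -
            have d: "\<delta> \<le> norm (\<Sum>i<k. c i * E i (j, x))" using subsetD[OF P(1) that] by simp
            then have "x \<in> grid h j" using \<delta> unfolding E by (auto split: if_splits)
            with d show ?thesis unfolding E by (simp add: norm_mult mult.commute)
          qed
        qed (use L in auto)
        then have "real (card P) powr \<kappa> \<le> L / (u * \<delta>)" using u(1) \<delta> by (simp add: pos_le_divide_eq mult.commute)
        then have "(real (card P) powr \<kappa>) powr (1 / \<kappa>) \<le> (L / (u * \<delta>)) powr (1 / \<kappa>)"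
          using \<kappa> by (intro powr_mono2) auto
        then show ?thesis using \<kappa> m by (simp add: powr_powr)
      qed
      then show ?thesis using finite_if_finite_subsets_card_bdd by blast
    qed
    \<comment> \<open>Vanishing samples force all levels to vanish, by the sampling bound with b =
      0, and a distribution whose levels all vanish is 0 by \<open>conv_injective\<close>.\<close>
    have indep: "\<forall>i<k. c i = 0" if "\<And>g. (\<Sum>i<k. c i * E i g) = 0" for c
    proof -
      have "norm (conv (\<phi> j) (lincomb k c e) x) * ?w j \<le> 2 * 0" for j x
        using that by (intro off_grid) simp
      then have "conv (\<phi> j) (lincomb k c e) x = 0" for j x
        by (simp add: mult_le_0_iff)
      then have "lincomb k c e = (\<lambda>f. 0)" by (intro conv_injective ft)
      then show ?thesis using li by (simp add: lin_indep_def)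
    qed
    obtain c P where P: "finite P" "card P = k" and c1: "\<And>g. norm (\<Sum>i<k. c i * E i g) \<le> 1"
      and c2: "\<And>g. g \<in> P \<Longrightarrow> norm (\<Sum>i<k. c i * E i g) = 1"
      using ex_many_peaks[where n=k and e=E and k=k, OF dec indep order_refl] by metis
    let ?f = "lincomb k c e"
    obtain B where B: "besov_norm \<phi> s0 p0 q0 ?f = ennreal B" "B \<ge> 0"
      using fb[of c] by (cases "besov_norm \<phi> s0 p0 q0 ?f") (auto simp: besov_def)
    have up: "norm (conv (\<phi> j) ?f x) * ?w j \<le> 2" for j x using off_grid[of c 1, OF c1, of j x] by simp
    have "v * 1 * real (card P) powr \<kappa> \<le> B"
    proof (rule v(2)[OF ft _ P(1)])
      show "x \<in> grid h j \<and> 1 \<le> norm (conv (\<phi> j) ?f x) * ?w j" if "(j, x) \<in> P" for j x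
      proof -
        have d: "norm (\<Sum>i<k. c i * E i (j, x)) = 1" using c2[OF that] .
        then have "x \<in> grid h j" unfolding E by (auto split: if_splits)
        with d show ?thesis unfolding E by (simp add: norm_mult mult.commute)
      qed
    qed (use up B in auto)
    then have vB: "v * real k powr \<kappa> \<le> B" using P by simp
    have "D / v = ((D / v) powr (1 / \<kappa>)) powr \<kappa>" using D v \<kappa> by (simp add: powr_powr)
    also have "\<dots> \<le> real k powr \<kappa>" using k k1 \<kappa> by (intro powr_mono2) auto
    finally have "D \<le> B" using vB v(1) by (simp add: pos_divide_le_eq mult.commute)
    then have B0: "B > 0" using D by simp
    have "B powr (- \<gamma>) \<le> D powr (- \<gamma>)" using D \<open>D \<le> B\<close> \<gamma> by (intro powr_mono2') auto
    also have "D powr (- \<gamma>) = \<epsilon> / Q" using Q \<epsilon> \<gamma> by (simp add: D_def powr_powr powr_minus_divide)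
    finally have "Q * B powr (- \<gamma>) \<le> \<epsilon>" using Q by (simp add: pos_le_divide_eq mult.commute)
    then have le: "Q * B powr (- \<gamma>) * B \<le> \<epsilon> * B" using B0 by (intro mult_right_mono) auto
    have "besov_norm \<phi> s1 p1 q1 ?f \<le> ennreal (Q * B powr (- \<gamma>) * B)"
      by (rule target[OF ft B0 _ up]) (simp add: B)
    also have "\<dots> \<le> ennreal (\<epsilon> * B)" by (rule ennreal_leI[OF le])
    finally have "besov_norm \<phi> s1 p1 q1 ?f \<le> ennreal (\<epsilon> * B)" .
    then show "\<exists>c. 0 < besov_norm \<phi> s0 p0 q0 (lincomb k c e) \<and>
         besov_norm \<phi> s1 p1 q1 (lincomb k c e) \<le> ennreal \<epsilon> * besov_norm \<phi> s0 p0 q0 (lincomb k c e)"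
      using B B0 \<epsilon> by (intro exI[of _ c]) (simp add: ennreal_mult)
  qed
qed

text \<open>The Bernstein number takes an infimum over normalised vectors, so one vector of small
  ratio in every k-dimensional subspace suffices after division by its source norm.\<close>

lemma fin_strictly_singular_if_ratio_small:
  assumes p: "0 < p0" "0 < q0" "0 < p1" "0 < q1"
    and ratio: "\<And>\<epsilon>. \<epsilon> > 0 \<Longrightarrow> \<exists>k0. \<forall>k\<ge>k0. \<forall>e. (\<forall>i<k. e i \<in> besov \<phi> s0 p0 q0) \<longrightarrow> lin_indep k e \<longrightarrow>
     (\<exists>c. 0 < besov_norm \<phi> s0 p0 q0 (lincomb k c e) \<and>
         besov_norm \<phi> s1 p1 q1 (lincomb k c e) \<le> ennreal \<epsilon> * besov_norm \<phi> s0 p0 q0 (lincomb k c e))"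
  shows "fin_strictly_singular (besov \<phi> s0 p0 q0) (besov_norm \<phi> s0 p0 q0) (besov_norm \<phi> s1 p1 q1)"
proof -
  let ?X = "besov \<phi> s0 p0 q0" and ?nX = "besov_norm \<phi> s0 p0 q0" and ?nY = "besov_norm \<phi> s1 p1 q1"
  have small: "\<exists>k0. \<forall>k\<ge>k0. bernstein ?X ?nX ?nY k \<le> ennreal \<epsilon>" if \<epsilon>: "\<epsilon> > 0" for \<epsilon>
  proof -
    obtain k0 where k0: "\<And>k e. k \<ge> k0 \<Longrightarrow> (\<forall>i<k. e i \<in> ?X) \<Longrightarrow> lin_indep k e \<Longrightarrow>
       \<exists>c. 0 < ?nX (lincomb k c e) \<and> ?nY (lincomb k c e) \<le> ennreal \<epsilon> * ?nX (lincomb k c e)"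
      using ratio[OF \<epsilon>] by metis
    have "bernstein ?X ?nX ?nY k \<le> ennreal \<epsilon>" if k: "k \<ge> k0" for k
      unfolding bernstein_def
    proof (rule SUP_least)
      fix e assume "e \<in> {e. (\<forall>i<k. e i \<in> ?X) \<and> lin_indep k e}"
      then have e: "\<forall>i<k. e i \<in> ?X" "lin_indep k e" by auto
      obtain c where c: "0 < ?nX (lincomb k c e)" "?nY (lincomb k c e) \<le> ennreal \<epsilon> * ?nX (lincomb k c e)"
        using k0[OF k e] by blast
      have fb: "lincomb k c e \<in> ?X" using e by (intro besov_lincomb p) auto
      then have ft: "lincomb k c e \<in> tempered" by (rule besov_tempered)
      obtain b where b: "?nX (lincomb k c e) = ennreal b" "b > 0"
        using fb c(1) by (cases "?nX (lincomb k c e)") (auto simp: besov_def)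
      define c' where "c' = (\<lambda>i. complex_of_real (1 / b) * c i)"
      have sc: "lincomb k c' e = (\<lambda>f. complex_of_real (1 / b) * lincomb k c e f)"
        by (simp add: lincomb_def c'_def sum_distrib_left mult.assoc)
      have nb: "ennreal (norm (complex_of_real (1 / b))) = ennreal (1 / b)" using b by (simp add: norm_divide)
      have "?nX (lincomb k c' e) = 1"
        unfolding sc besov_norm_cmult[OF ft p(1,2)] nb b(1) using b(2) by (simp add: ennreal_mult[symmetric])
      moreover have "?nY (lincomb k c' e) \<le> ennreal \<epsilon>"
      proof -
        have "?nY (lincomb k c' e) \<le> ennreal (1 / b) * (ennreal \<epsilon> * ennreal b)"
          unfolding sc besov_norm_cmult[OF ft p(3,4)] nb using c(2) b(1) by (intro mult_left_mono) auto
        also have "\<dots> = ennreal \<epsilon>" using b \<epsilon> by (simp add: ennreal_mult[symmetric])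
        finally show ?thesis .
      qed
      ultimately show "(INF c \<in> {c. ?nX (lincomb k c e) = 1}. ?nY (lincomb k c e)) \<le> ennreal \<epsilon>"
        by (intro INF_lower2[of c']) auto
    qed
    then show ?thesis by blast
  qed
  show ?thesis
    unfolding fin_strictly_singular_def
  proof (rule order_tendstoI)
    fix a :: ennreal assume "0 < a"
    then obtain d where d: "0 < d" "d < a" using dense by blast
    then obtain \<epsilon> where \<epsilon>: "d = ennreal \<epsilon>" "\<epsilon> > 0" by (cases d) auto
    obtain k0 where "\<forall>k\<ge>k0. bernstein ?X ?nX ?nY k \<le> ennreal \<epsilon>" using small[OF \<epsilon>(2)] by blast
    then show "\<forall>\<^sub>F k in sequentially. bernstein ?X ?nX ?nY k < a"
      using d \<epsilon> unfolding eventually_sequentially by (meson le_less_trans)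
  qed simp
qed

lemma fin_strictly_singular_besov:
  assumes p: "0 < p0" "p0 < p1" "0 < q0" "0 < q1"
    and s: "s0 - s1 \<ge> real CARD('n) * inv_en p0 - real CARD('n) * inv_en p1"
    and q: "s0 - s1 > real CARD('n) * inv_en p0 - real CARD('n) * inv_en p1 \<or> q0 < q1"
  shows "fin_strictly_singular (besov \<phi> s0 p0 q0) (besov_norm \<phi> s0 p0 q0) (besov_norm \<phi> s1 p1 q1)"
proof -
  let ?d = "real CARD('n) * inv_en p0 - real CARD('n) * inv_en p1"
  have p1: "0 < p1" using p by simp
  \<comment> \<open>Above the critical line any q below q1 will do, because the excess smoothness
    absorbs the second index; on the line q0 itself is taken.\<close>
  obtain q where q': "0 < q" "q < q1" "s0 > s1 + ?d \<or> q0 \<le> q"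
  proof (cases "s0 - s1 > ?d")
    case True
    then show ?thesis using that dense[OF p(4)] by force
  next
    case False
    then show ?thesis using that[of q0] q p by auto
  qed
  obtain C where C: "C > 0" "\<And>T. T \<in> tempered \<Longrightarrow> besov_norm \<phi> (s1 + ?d) p0 q T \<le> ennreal C * besov_norm \<phi> s0 p0 q0 T"
  proof -
    have "s0 - (s1 + ?d) \<ge> real CARD('n) * inv_en p0 - real CARD('n) * inv_en p0"
      "s0 - (s1 + ?d) > real CARD('n) * inv_en p0 - real CARD('n) * inv_en p0 \<or> q0 \<le> q"
      using s q'(3) by auto
    from besov_embedding[OF p(1) order_refl p(3) q'(1) this] show ?thesis using that by metis
  qed
  show ?thesis
  proof (rule fin_strictly_singular_if_ratio_small[OF p(1,3) p1 p(4)])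
    fix \<epsilon> :: real assume "\<epsilon> > 0"
    \<comment> \<open>The constant of the first embedding is divided out in advance. A linearly
      independent family stays one, being the same distributions read in the intermediate
      space.\<close>
    then have e: "\<epsilon> / C > 0" using C by simp
    have sd: "s1 + ?d - s1 = ?d" by simp
    obtain k0 where k0: "\<And>k e. k \<ge> k0 \<Longrightarrow> (\<And>i. i < k \<Longrightarrow> e i \<in> besov \<phi> (s1 + ?d) p0 q) \<Longrightarrow> lin_indep k e \<Longrightarrow>
     \<exists>c. 0 < besov_norm \<phi> (s1 + ?d) p0 q (lincomb k c e) \<and>
         besov_norm \<phi> s1 p1 q1 (lincomb k c e) \<le> ennreal (\<epsilon> / C) * besov_norm \<phi> (s1 + ?d) p0 q (lincomb k c e)"
      using ratio_small_critical[OF p(1,2) q'(1,2) sd e] by metis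
    show "\<exists>k0. \<forall>k\<ge>k0. \<forall>e. (\<forall>i<k. e i \<in> besov \<phi> s0 p0 q0) \<longrightarrow> lin_indep k e \<longrightarrow>
     (\<exists>c. 0 < besov_norm \<phi> s0 p0 q0 (lincomb k c e) \<and>
         besov_norm \<phi> s1 p1 q1 (lincomb k c e) \<le> ennreal \<epsilon> * besov_norm \<phi> s0 p0 q0 (lincomb k c e))"
    proof (intro exI[of _ k0] allI impI)
      fix k e assume k: "k \<ge> k0" and e: "\<forall>i<k. e i \<in> besov \<phi> s0 p0 q0" and li: "lin_indep k e"
      have "e i \<in> besov \<phi> (s1 + ?d) p0 q" if "i < k" for i
      proof -
        have X: "e i \<in> besov \<phi> s0 p0 q0" using e that by blast
        then have "besov_norm \<phi> (s1 + ?d) p0 q (e i) \<le> ennreal C * besov_norm \<phi> s0 p0 q0 (e i)"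
          by (intro C besov_tempered)
        also have "\<dots> < top" using X by (simp add: besov_def ennreal_mult_less_top)
        finally show ?thesis using X by (simp add: besov_def)
      qed
      from k0[OF k this li] obtain c where c: "0 < besov_norm \<phi> (s1 + ?d) p0 q (lincomb k c e)"
         "besov_norm \<phi> s1 p1 q1 (lincomb k c e) \<le> ennreal (\<epsilon> / C) * besov_norm \<phi> (s1 + ?d) p0 q (lincomb k c e)"
        by blast
      have "lincomb k c e \<in> tempered" by (rule besov_tempered[OF besov_lincomb[OF _ p(1,3), where s=s0]]) (use e in auto)
      then have emb: "besov_norm \<phi> (s1 + ?d) p0 q (lincomb k c e) \<le> ennreal C * besov_norm \<phi> s0 p0 q0 (lincomb k c e)"
        by (rule C)
      \<comment> \<open>A vanishing source norm would make the intermediate norm vanish as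
        well.\<close>
      then have "0 < besov_norm \<phi> s0 p0 q0 (lincomb k c e)" using c(1) by (auto simp: zero_less_iff_neq_zero)
      moreover have "besov_norm \<phi> s1 p1 q1 (lincomb k c e) \<le> ennreal \<epsilon> * besov_norm \<phi> s0 p0 q0 (lincomb k c e)"
      proof -
        have "besov_norm \<phi> s1 p1 q1 (lincomb k c e) \<le> ennreal (\<epsilon> / C) * (ennreal C * besov_norm \<phi> s0 p0 q0 (lincomb k c e))"
          by (rule order_trans[OF c(2) mult_left_mono[OF emb]]) simp
        also have "\<dots> = ennreal \<epsilon> * besov_norm \<phi> s0 p0 q0 (lincomb k c e)"
          using C \<open>\<epsilon> > 0\<close> by (simp add: mult.assoc[symmetric] ennreal_mult[symmetric])
        finally show ?thesis .
      qed
      ultimately show "\<exists>c. 0 < besov_norm \<phi> s0 p0 q0 (lincomb k c e) \<and>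
         besov_norm \<phi> s1 p1 q1 (lincomb k c e) \<le> ennreal \<epsilon> * besov_norm \<phi> s0 p0 q0 (lincomb k c e)" by blast
    qed
  qed
qed

lemma embeds_besov:
  assumes p: "0 < p0" "p0 \<le> p1" "0 < q0" "0 < q1"
    and s: "s0 - s1 \<ge> real CARD('n) * inv_en p0 - real CARD('n) * inv_en p1"
    and q: "s0 - s1 > real CARD('n) * inv_en p0 - real CARD('n) * inv_en p1 \<or> q0 \<le> q1"
  shows "embeds (besov \<phi> s0 p0 q0) (besov_norm \<phi> s0 p0 q0) (besov \<phi> s1 p1 q1) (besov_norm \<phi> s1 p1 q1)"
proof -
  obtain C where C: "C > 0" "\<And>T. T \<in> tempered \<Longrightarrow> besov_norm \<phi> s1 p1 q1 T \<le> ennreal C * besov_norm \<phi> s0 p0 q0 T"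
    using besov_embedding[OF assms] by metis
  have "besov \<phi> s0 p0 q0 \<subseteq> besov \<phi> s1 p1 q1"
  proof
    fix T assume T: "T \<in> besov \<phi> s0 p0 q0"
    then have "besov_norm \<phi> s1 p1 q1 T \<le> ennreal C * besov_norm \<phi> s0 p0 q0 T" by (intro C besov_tempered)
    also have "\<dots> < top" using T by (simp add: besov_def ennreal_mult_less_top)
    finally show "T \<in> besov \<phi> s1 p1 q1" using T by (simp add: besov_def)
  qed
  then show ?thesis unfolding embeds_def using C by (auto dest: besov_tempered)
qed

end

theorem theorem1p2:
  fixes \<phi> :: "nat \<Rightarrow> real^'n::finite \<Rightarrow> complex"
    and p0 p1 q0 q1 :: ennreal and s0 s1 :: real
  assumes "admissible \<phi>" and "p0 > 0" and "p1 > 0" and "q0 > 0" and "q1 > 0"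
  defines "X \<equiv> besov \<phi> s0 p0 q0" and "Y \<equiv> besov \<phi> s1 p1 q1"
    and "nX \<equiv> besov_norm \<phi> s0 p0 q0" and "nY \<equiv> besov_norm \<phi> s1 p1 q1"
    and "d \<equiv> real CARD('n) * inv_en p0 - real CARD('n) * inv_en p1"
  shows "(\<not> embeds X nX Y nY \<longleftrightarrow>
            (p0 > p1 \<or> s0 - s1 < d \<or> (s0 - s1 = d \<and> d \<ge> 0 \<and> q0 > q1)))
       \<and> ((embeds X nX Y nY \<and> \<not> compact_emb X nX Y nY \<and> fin_strictly_singular X nX nY) \<longleftrightarrow>
            ((s0 - s1 = d \<and> d > 0 \<and> q0 < q1) \<or> (s0 - s1 > d \<and> d > 0)))
       \<and> ((embeds X nX Y nY \<and> \<not> strictly_singular X nX nY) \<longleftrightarrow>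
            ((s0 - s1 > 0 \<and> p0 = p1) \<or> (s0 = s1 \<and> p0 = p1 \<and> q0 \<le> q1) \<or>
             (s0 - s1 = d \<and> d > 0 \<and> q0 = q1)))"
proof -
  interpret resolution \<phi> by unfold_locales (rule assms)
  note pos = assms(2-5)
  \<comment> \<open>The sign of d records the order of p0 and p1, since \<open>inv_en\<close>
    reverses it.\<close>
  have d_pos: "d > 0 \<longleftrightarrow> p0 < p1"
    using inv_en_le_iff[OF pos(2,1)] by (auto simp: d_def not_le[symmetric] right_diff_distrib[symmetric] mult_le_0_iff)
  have d_zero: "d = 0" if "p0 = p1" using that by (simp add: d_def)
  have emb: "embeds X nX Y nY \<longleftrightarrow> \<not> (p0 > p1 \<or> s0 - s1 < d \<or> (s0 - s1 = d \<and> d \<ge> 0 \<and> q0 > q1))"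
  proof (cases "p0 > p1 \<or> s0 - s1 < d \<or> (s0 - s1 = d \<and> d \<ge> 0 \<and> q0 > q1)")
    case True
    then show ?thesis
      using not_embeds_integrability[OF pos] not_embeds_smoothness[OF pos] not_embeds_fine_index[OF pos]
      unfolding X_def Y_def nX_def nY_def d_def by blast
  next
    case False
    then have "p0 \<le> p1" "s0 - s1 \<ge> d" by auto
    \<comment> \<open>With d nonnegative, failure of the third condition leaves
      \<open>q0 \<le> q1\<close> on the critical line.\<close>
    moreover have "d \<ge> 0" using \<open>p0 \<le> p1\<close> d_pos d_zero by (cases "p0 = p1") (auto simp: less_le)
    ultimately have "s0 - s1 > d \<or> q0 \<le> q1" using False by auto
    then show ?thesis
      using embeds_besov[OF pos(1) \<open>p0 \<le> p1\<close> pos(3,4)] \<open>s0 - s1 \<ge> d\<close> False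
      unfolding X_def Y_def nX_def nY_def d_def by blast
  qed
  have nc: "\<not> compact_emb X nX Y nY"
    unfolding X_def Y_def nX_def nY_def by (rule not_compact[OF pos])
  have fss: "fin_strictly_singular X nX nY" if "p0 < p1" "s0 - s1 \<ge> d" "s0 - s1 > d \<or> q0 < q1"
    using fin_strictly_singular_besov[OF pos(1) that(1) pos(3,4)] that(2,3)
    unfolding X_def nX_def nY_def d_def by blast
  have ss: "strictly_singular X nX nY" if "fin_strictly_singular X nX nY"
    using that by (rule fin_strictly_singular_imp_strictly_singular)
  have nss1: "\<not> strictly_singular X nX nY" if "p0 = p1"
    unfolding X_def nX_def nY_def that by (rule not_strictly_singular_same_p[OF pos(2-4)])
  have nss2: "\<not> strictly_singular X nX nY" if "s0 - s1 = d" "q0 = q1"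
    using not_strictly_singular_same_q[OF pos(1,2,3)] that unfolding X_def nX_def nY_def d_def by auto
  \<comment> \<open>For \<open>p0 < p1\<close> the position relative to the critical line decides,
    and on the line the order of q0 and q1; for \<open>p0 = p1\<close> strict singularity always
    fails; for \<open>p1 < p0\<close> there is no embedding and d is not positive.\<close>
  consider "p0 < p1" "d > 0" | "p0 = p1" "d = 0" | "p1 < p0"
    using d_pos d_zero by (metis less_linear)
  then show ?thesis
  proof cases
    case 1
    consider "s0 - s1 < d" | "s0 - s1 > d" | "s0 - s1 = d" "q0 < q1" | "s0 - s1 = d" "q0 = q1" | "s0 - s1 = d" "q1 < q0"
      by (metis less_linear)
    then show ?thesis
    proof cases
      case 2
      then have "fin_strictly_singular X nX nY" using 1 by (intro fss) auto
      then show ?thesis using 1 2 emb nc ss by auto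
    next
      case 3
      then have "fin_strictly_singular X nX nY" using 1 by (intro fss) auto
      then show ?thesis using 1 3 emb nc ss by auto
    next
      case 4
      then show ?thesis using 1 emb ss nss2 by auto
    qed (use 1 emb in auto)
  next
    case 2
    then show ?thesis using emb nc ss nss1 by auto
  next
    case 3
    then have "\<not> d > 0" using d_pos by auto
    with 3 show ?thesis using emb by auto
  qed
qed

end
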